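(* Let $R$ and $S$ be rings. (1) If $L$ is an $R$-$S$-bimodule, $M$ a projective left $S$-module and $N$ a left $R$-module, then $$\operatorname{Ext}^{\mathcal{WI}}_n(L\otimes_S M,N)\cong \operatorname{Hom}_S(M,\operatorname{Ext}^{\mathcal{WI}}_n(L,N))$$ for any non-negative integer $n$. (2) If $L$ is an $S$-$R$-bimodule, $M$ a projective right $S$-module and $N$ a right $R$-module, then $$\operatorname{Ext}^{\mathcal{WF}}_n(M\otimes_S L,N)\cong \operatorname{Hom}_S(M,\operatorname{Ext}^{\mathcal{WF}}_n(L,N))$$ for any non-negative integer $n$. (3) If $L$ is a flat right $S$-module, $M$ an $S$-$R$-bimodule and $N$ a left $R$-module, then $$\operatorname{Tor}^n_{\mathcal{W}}(L\otimes_S M,N)\cong L\otimes_S\operatorname{Tor}^n_{\mathcal{W}}(M,N)$$ for any non-negative integer $n$.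
   Context: Rings are associative with identity and modules are unitary. An $A$-$B$-bimodule is a left $A$-, right $B$-bimodule. A left $R$-module $F$ is super finitely presented if there is an exact sequence $\cdots\to F_1\to F_0\to F\to 0$ with each $F_i$ finitely generated projective. A left $R$-module $M$ is weak injective if $\operatorname{Ext}^1_R(F,M)=0$ for every super finitely presented left $R$-module $F$; a right $R$-module $M$ is weak flat if $\operatorname{Tor}_1^R(M,F)=0$ for every super finitely presented left $R$-module $F$. $\mathcal{WI}$ is the class of weak injective left $R$-modules and $\mathcal{WF}$ the class of weak flat right $R$-modules. For a class $\mathcal C$ (either $\mathcal{WI}$ or $\mathcal{WF}$), a right $\mathcal C$-resolution of $M$ is a complex $0\to M\to W^0\to W^1\to\cdots$ with all $W^i\in\mathcal C$ which becomes exact after applying $\operatorname{Hom}_R(-,W)$ for every $W\in\mathcal C$; a left $\mathcal C$-resolution of $M$ is a complex $\cdots\to W_1\to W_0\to M\to 0$ with all $W_i\in\mathcal C$ which becomes exact after applying $\operatorname{Hom}_R(W,-)$ for every $W\in\mathcal C$. It is known that every left $R$-module has left and right $\mathcal{WI}$-resolutions and every right $R$-module has left and right $\mathcal{WF}$-resolutions. A deleted resolution is one with the term $M$ removed. For left $R$-modules $M,N$, $\operatorname{Ext}^{\mathcal{WI}}_n(M,N)$ is $H_n(\operatorname{Hom}_R(W^\bullet,N))$ with $W^\bullet$ a deleted right $\mathcal{WI}$-resolution of $M$, or equivalently $H_n(\operatorname{Hom}_R(M,W_\bullet))$ with $W_\bullet$ a deleted left $\mathcal{WI}$-resolution of $N$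 (the two are known to agree). For right $R$-modules $M,N$, $\operatorname{Ext}^{\mathcal{WF}}_n(M,N)$ is defined in the same way with $\mathcal{WF}$ in place of $\mathcal{WI}$. For a right $R$-module $M$ and a left $R$-module $N$, $\operatorname{Tor}^n_{\mathcal W}(M,N)$ is $H^n(W^\bullet\otimes_R N)$ with $W^\bullet$ a deleted right $\mathcal{WF}$-resolution of $M$, or equivalently $H^n(M\otimes_R V^\bullet)$ with $V^\bullet$ a deleted right $\mathcal{WI}$-resolution of $N$ (known to agree). In the statement all these functors are taken over $R$; $\operatorname{Ext}^{\mathcal{WI}}_n(L,N)$, $\operatorname{Ext}^{\mathcal{WF}}_n(L,N)$ and $\operatorname{Tor}^n_{\mathcal W}(M,N)$ carry the $S$-module structures induced from the bimodule argument (computing with a resolution of $N$). Isomorphisms are of abelian groups. *)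

theory Defs
  imports "HOL-Algebra.Algebra"
begin

section \<open>Modules over arbitrary rings\<close>

text \<open>The locale \<^locale>\<open>module\<close> of the library requires a commutative ring; only its record type
  is used here. The multiplicative fields of a module record carry no information. A right module
  over \<open>R\<close> is a left module over the opposite ring: \<open>r \<odot> x\<close> then stands for \<open>x r\<close>.\<close>

locale left_module = R?: ring R + M?: abelian_group M
  for R :: "('r, 'x) ring_scheme" (structure) and M :: "('r, 'm, 'z) module_scheme" (structure) +
  assumes smult_closed [simp, intro]:
      "\<lbrakk>a \<in> carrier R; x \<in> carrier M\<rbrakk> \<Longrightarrow> a \<odot>\<^bsub>M\<^esub> x \<in> carrier M"
    and smult_l_distr:
      "\<lbrakk>a \<in> carrier R; b \<in> carrier R; x \<in> carrier M\<rbrakk> \<Longrightarrow>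
        (a \<oplus> b) \<odot>\<^bsub>M\<^esub> x = a \<odot>\<^bsub>M\<^esub> x \<oplus>\<^bsub>M\<^esub> b \<odot>\<^bsub>M\<^esub> x"
    and smult_r_distr:
      "\<lbrakk>a \<in> carrier R; x \<in> carrier M; y \<in> carrier M\<rbrakk> \<Longrightarrow>
        a \<odot>\<^bsub>M\<^esub> (x \<oplus>\<^bsub>M\<^esub> y) = a \<odot>\<^bsub>M\<^esub> x \<oplus>\<^bsub>M\<^esub> a \<odot>\<^bsub>M\<^esub> y"
    and smult_assoc1:
      "\<lbrakk>a \<in> carrier R; b \<in> carrier R; x \<in> carrier M\<rbrakk> \<Longrightarrow>
        (a \<otimes> b) \<odot>\<^bsub>M\<^esub> x = a \<odot>\<^bsub>M\<^esub> (b \<odot>\<^bsub>M\<^esub> x)"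
    and smult_one [simp]:
      "x \<in> carrier M \<Longrightarrow> \<one> \<odot>\<^bsub>M\<^esub> x = x"

definition opp :: "('r, 'x) ring_scheme \<Rightarrow> ('r, 'x) ring_scheme" where
  "opp R = R\<lparr>monoid.mult := \<lambda>a b. b \<otimes>\<^bsub>R\<^esub> a\<rparr>"

abbreviation right_module ::
    "('r, 'x) ring_scheme \<Rightarrow> ('r, 'm, 'z) module_scheme \<Rightarrow> bool" where
  "right_module R M \<equiv> left_module (opp R) M"

text \<open>\<open>rsmult L x s\<close> is \<open>x s\<close>. The operation \<open>flip\<close> exchanges the two actions: it turns an
  \<open>R\<close>-\<open>S\<close>-bimodule into an \<open>(opp S)\<close>-\<open>(opp R)\<close>-bimodule, and in particular \<open>flip L\<close> is the right
  \<open>S\<close>-module underlying \<open>L\<close>.\<close>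

record ('r, 's, 'l) bimodule = "('r, 'l) module" +
  rsmult :: "'l \<Rightarrow> 's \<Rightarrow> 'l"

definition flip :: "('r, 's, 'l) bimodule \<Rightarrow> ('s, 'r, 'l) bimodule" where
  "flip L = \<lparr>carrier = carrier L, monoid.mult = monoid.mult L, one = one L,
     ring.zero = ring.zero L, ring.add = ring.add L, smult = (\<lambda>s x. rsmult L x s),
     rsmult = (\<lambda>x r. r \<odot>\<^bsub>L\<^esub> x)\<rparr>"

definition bimodule ::
    "('r, 'x) ring_scheme \<Rightarrow> ('s, 'y) ring_scheme \<Rightarrow> ('r, 's, 'l) bimodule \<Rightarrow> bool" where
  "bimodule R S L \<longleftrightarrow> left_module R L \<and> right_module S (flip L) \<and>
     (\<forall>r\<in>carrier R. \<forall>s\<in>carrier S. \<forall>x\<in>carrier L.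
        rsmult L (r \<odot>\<^bsub>L\<^esub> x) s = r \<odot>\<^bsub>L\<^esub> rsmult L x s)"

definition fin_gen :: "('r, 'x) ring_scheme \<Rightarrow> ('r, 'm) module \<Rightarrow> bool" where
  "fin_gen R M \<longleftrightarrow> (\<exists>A. finite A \<and> A \<subseteq> carrier M \<and>
     \<Inter>{H. submodule H R M \<and> A \<subseteq> H} = carrier M)"


section \<open>Homomorphism groups\<close>

definition lmod_hom :: "('r, 'x) ring_scheme \<Rightarrow> ('r, 'm, 'y) module_scheme \<Rightarrow>
    ('r, 'n, 'z) module_scheme \<Rightarrow> ('m \<Rightarrow> 'n) set" where
  "lmod_hom R M N = {f \<in> carrier M \<rightarrow> carrier N.
     (\<forall>x\<in>carrier M. \<forall>y\<in>carrier M. f (x \<oplus>\<^bsub>M\<^esub> y) = f x \<oplus>\<^bsub>N\<^esub> f y) \<and>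
     (\<forall>r\<in>carrier R. \<forall>x\<in>carrier M. f (r \<odot>\<^bsub>M\<^esub> x) = r \<odot>\<^bsub>N\<^esub> f x)}"

text \<open>Elements of \<open>hom_group R M N\<close> are extensional, so that equality of functions is equality
  on the carrier.\<close>

definition hom_group :: "('r, 'x) ring_scheme \<Rightarrow> ('r, 'm, 'y) module_scheme \<Rightarrow>
    ('r, 'n, 'z) module_scheme \<Rightarrow> ('m \<Rightarrow> 'n) ring" where
  "hom_group R M N = \<lparr>carrier = lmod_hom R M N \<inter> extensional (carrier M),
     monoid.mult = undefined, one = undefined,
     ring.zero = (\<lambda>x\<in>carrier M. \<zero>\<^bsub>N\<^esub>),
     ring.add = (\<lambda>f g. \<lambda>x\<in>carrier M. f x \<oplus>\<^bsub>N\<^esub> g x)\<rparr>"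

text \<open>For an \<open>R\<close>-\<open>S\<close>-bimodule \<open>L\<close>, the left \<open>S\<close>-module structure \<open>(s f)(x) = f (x s)\<close>.\<close>

definition hom_mod :: "('r, 'x) ring_scheme \<Rightarrow> ('r, 's, 'l) bimodule \<Rightarrow>
    ('r, 'n, 'z) module_scheme \<Rightarrow> ('s, 'l \<Rightarrow> 'n) module" where
  "hom_mod R L N = ring.extend (hom_group R L N)
     (module.fields (\<lambda>s f. \<lambda>x\<in>carrier L. f (rsmult L x s)))"


section \<open>Tensor products\<close>

text \<open>\<open>A\<close> is a right and \<open>B\<close> a left \<open>S\<close>-module.\<close>

definition tensor_relations :: "('s, 'x) ring_scheme \<Rightarrow> ('s, 'a, 'y) module_scheme \<Rightarrow>
    ('s, 'b, 'z) module_scheme \<Rightarrow> ('a \<times> 'b \<Rightarrow>\<^sub>0 int) set" where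
  "tensor_relations S A B =
     {frag_of (a \<oplus>\<^bsub>A\<^esub> a', b) - frag_of (a, b) - frag_of (a', b) | a a' b.
        a \<in> carrier A \<and> a' \<in> carrier A \<and> b \<in> carrier B} \<union>
     {frag_of (a, b \<oplus>\<^bsub>B\<^esub> b') - frag_of (a, b) - frag_of (a, b') | a b b'.
        a \<in> carrier A \<and> b \<in> carrier B \<and> b' \<in> carrier B} \<union>
     {frag_of (s \<odot>\<^bsub>A\<^esub> a, b) - frag_of (a, s \<odot>\<^bsub>B\<^esub> b) | s a b.
        s \<in> carrier S \<and> a \<in> carrier A \<and> b \<in> carrier B}"

definition tensor_null :: "('s, 'x) ring_scheme \<Rightarrow> ('s, 'a, 'y) module_scheme \<Rightarrow>
    ('s, 'b, 'z) module_scheme \<Rightarrow> ('a \<times> 'b \<Rightarrow>\<^sub>0 int) set" where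
  "tensor_null S A B =
     generate (free_Abelian_group (carrier A \<times> carrier B)) (tensor_relations S A B)"

definition tensor :: "('s, 'x) ring_scheme \<Rightarrow> ('s, 'a, 'y) module_scheme \<Rightarrow>
    ('s, 'b, 'z) module_scheme \<Rightarrow> ('a \<times> 'b \<Rightarrow>\<^sub>0 int) set ring" where
  "tensor S A B =
     (let Q = free_Abelian_group (carrier A \<times> carrier B) Mod tensor_null S A B
      in \<lparr>carrier = carrier Q, monoid.mult = undefined, one = undefined,
          ring.zero = monoid.one Q, ring.add = monoid.mult Q\<rparr>)"

text \<open>The map \<open>f \<otimes> g\<close> into \<open>A \<otimes> B\<close>, where \<open>A\<close> and \<open>B\<close> are the codomains of \<open>f\<close> and \<open>g\<close>. Every
  representative of a coset \<open>Y\<close> yields the same coset, so the union is that coset.\<close>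

definition tensor_map :: "('s, 'x) ring_scheme \<Rightarrow> ('s, 'a, 'y) module_scheme \<Rightarrow>
    ('s, 'b, 'z) module_scheme \<Rightarrow> ('c \<Rightarrow> 'a) \<Rightarrow> ('d \<Rightarrow> 'b) \<Rightarrow>
    ('c \<times> 'd \<Rightarrow>\<^sub>0 int) set \<Rightarrow> ('a \<times> 'b \<Rightarrow>\<^sub>0 int) set" where
  "tensor_map S A B f g Y =
     (\<Union>c\<in>Y. r_coset (free_Abelian_group (carrier A \<times> carrier B)) (tensor_null S A B)
        (frag_extend (\<lambda>(x, y). frag_of (f x, g y)) c))"

text \<open>\<open>L \<otimes>\<^sub>S B\<close> as a left \<open>R\<close>-module, for an \<open>R\<close>-\<open>S\<close>-bimodule \<open>L\<close> and a left \<open>S\<close>-module \<open>B\<close>.\<close>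

definition tensor_left :: "('s, 'x) ring_scheme \<Rightarrow> ('r, 's, 'l) bimodule \<Rightarrow>
    ('s, 'b, 'z) module_scheme \<Rightarrow> ('r, ('l \<times> 'b \<Rightarrow>\<^sub>0 int) set) module" where
  "tensor_left S L B = ring.extend (tensor S (flip L) B)
     (module.fields (\<lambda>r. tensor_map S (flip L) B (\<lambda>x. r \<odot>\<^bsub>L\<^esub> x) (\<lambda>y. y)))"

text \<open>\<open>A \<otimes>\<^sub>S L\<close> as a right \<open>R\<close>-module, for a right \<open>S\<close>-module \<open>A\<close> and an \<open>S\<close>-\<open>R\<close>-bimodule \<open>L\<close>.\<close>

definition tensor_right :: "('s, 'x) ring_scheme \<Rightarrow> ('s, 'a, 'z) module_scheme \<Rightarrow>
    ('s, 'r, 'l) bimodule \<Rightarrow> ('r, ('a \<times> 'l \<Rightarrow>\<^sub>0 int) set) module" where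
  "tensor_right S A L = ring.extend (tensor S A L)
     (module.fields (\<lambda>r. tensor_map S A L (\<lambda>x. x) (\<lambda>y. rsmult L y r)))"


section \<open>Projective and flat modules\<close>

text \<open>The lifting property, tested on epimorphisms \<open>A \<rightarrow> B\<close> whose target has its carrier in the
  type of \<open>P\<close>. Together with the identity of \<open>P\<close> and the canonical epimorphism onto \<open>P\<close> from the
  free module on \<open>carrier P\<close>, which lives in \<open>'p \<Rightarrow> 'r\<close>, this gives the lifting property for
  modules of all types.\<close>

definition projective :: "('r, 'x) ring_scheme \<Rightarrow> ('r, 'p) module \<Rightarrow> bool" where
  "projective R P \<longleftrightarrow> left_module R P \<and>
     (\<forall>(A :: ('r, 'p \<Rightarrow> 'r) module) (B :: ('r, 'p) module) g f.
        left_module R A \<and> left_module R B \<and> g \<in> lmod_hom R A B \<and> g ` carrier A = carrier B \<and>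
        f \<in> lmod_hom R P B \<longrightarrow>
        (\<exists>h\<in>lmod_hom R P A. \<forall>x\<in>carrier P. g (h x) = f x))"

text \<open>Every countably generated module is isomorphic to one with carrier in \<open>nat \<Rightarrow> 's\<close> (choose
  representatives in \<open>S\<^sup>(\<^sup>\<nat>\<^sup>)\<close>), and a module that preserves monomorphisms between finitely
  generated modules preserves all monomorphisms.\<close>

definition flat_right :: "('s, 'x) ring_scheme \<Rightarrow> ('s, 'l) module \<Rightarrow> bool" where
  "flat_right S L \<longleftrightarrow> right_module S L \<and>
     (\<forall>(A :: ('s, nat \<Rightarrow> 's) module) (B :: ('s, nat \<Rightarrow> 's) module) f.
        left_module S A \<and> left_module S B \<and> f \<in> lmod_hom S A B \<and> inj_on f (carrier A) \<longrightarrow>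
        inj_on (tensor_map S L B (\<lambda>x. x) f) (carrier (tensor S L A)))"


section \<open>Homology\<close>

definition exact_at :: "('a, 'x) ring_scheme \<Rightarrow> ('a \<Rightarrow> 'b) \<Rightarrow> ('b, 'y) ring_scheme \<Rightarrow>
    ('b \<Rightarrow> 'c) \<Rightarrow> ('c, 'z) ring_scheme \<Rightarrow> bool" where
  "exact_at A f B g C \<longleftrightarrow> f ` carrier A = a_kernel B C g"

text \<open>The quotient \<open>Z / B\<close> for subgroups (submodules) \<open>B \<subseteq> Z\<close> of \<open>G\<close>.\<close>

definition subquot :: "('a, 'x) ring_scheme \<Rightarrow> 'a set \<Rightarrow> 'a set \<Rightarrow> 'a set ring" where
  "subquot G Z B = \<lparr>carrier = (\<lambda>z. B +>\<^bsub>G\<^esub> z) ` Z, monoid.mult = undefined, one = undefined,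
     ring.zero = B, ring.add = set_add G\<rparr>"

definition subquot_mod ::
    "('s, 'a, 'x) module_scheme \<Rightarrow> 'a set \<Rightarrow> 'a set \<Rightarrow> ('s, 'a set) module" where
  "subquot_mod G Z B = ring.extend (subquot G Z B)
     (module.fields (\<lambda>s Y. \<Union>x\<in>Y. B +>\<^bsub>G\<^esub> (s \<odot>\<^bsub>G\<^esub> x)))"

text \<open>A chain complex \<open>C\<close> in degrees \<open>\<ge> 0\<close> has \<open>d n : C (n+1) \<rightarrow> C n\<close>, a cochain complex has
  \<open>d n : C n \<rightarrow> C (n+1)\<close>.\<close>

definition cycles :: "(nat \<Rightarrow> ('a, 'x) ring_scheme) \<Rightarrow> (nat \<Rightarrow> 'a \<Rightarrow> 'a) \<Rightarrow> nat \<Rightarrow> 'a set" where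
  "cycles C d n = (case n of 0 \<Rightarrow> carrier (C 0) | Suc k \<Rightarrow> a_kernel (C (Suc k)) (C k) (d k))"

definition boundaries ::
    "(nat \<Rightarrow> ('a, 'x) ring_scheme) \<Rightarrow> (nat \<Rightarrow> 'a \<Rightarrow> 'a) \<Rightarrow> nat \<Rightarrow> 'a set" where
  "boundaries C d n = d n ` carrier (C (Suc n))"

definition cocycles :: "(nat \<Rightarrow> ('a, 'x) ring_scheme) \<Rightarrow> (nat \<Rightarrow> 'a \<Rightarrow> 'a) \<Rightarrow> nat \<Rightarrow> 'a set" where
  "cocycles C d n = a_kernel (C n) (C (Suc n)) (d n)"

definition coboundaries ::
    "(nat \<Rightarrow> ('a, 'x) ring_scheme) \<Rightarrow> (nat \<Rightarrow> 'a \<Rightarrow> 'a) \<Rightarrow> nat \<Rightarrow> 'a set" where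
  "coboundaries C d n = (case n of 0 \<Rightarrow> {\<zero>\<^bsub>C 0\<^esub>} | Suc k \<Rightarrow> d k ` carrier (C k))"

definition homology ::
    "(nat \<Rightarrow> ('a, 'x) ring_scheme) \<Rightarrow> (nat \<Rightarrow> 'a \<Rightarrow> 'a) \<Rightarrow> nat \<Rightarrow> 'a set ring" where
  "homology C d n = subquot (C n) (cycles C d n) (boundaries C d n)"

definition homology_mod ::
    "(nat \<Rightarrow> ('s, 'a, 'x) module_scheme) \<Rightarrow> (nat \<Rightarrow> 'a \<Rightarrow> 'a) \<Rightarrow> nat \<Rightarrow> ('s, 'a set) module" where
  "homology_mod C d n = subquot_mod (C n) (cycles C d n) (boundaries C d n)"

definition cohomology ::
    "(nat \<Rightarrow> ('a, 'x) ring_scheme) \<Rightarrow> (nat \<Rightarrow> 'a \<Rightarrow> 'a) \<Rightarrow> nat \<Rightarrow> 'a set ring" where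
  "cohomology C d n = subquot (C n) (cocycles C d n) (coboundaries C d n)"

definition cohomology_mod ::
    "(nat \<Rightarrow> ('s, 'a, 'x) module_scheme) \<Rightarrow> (nat \<Rightarrow> 'a \<Rightarrow> 'a) \<Rightarrow> nat \<Rightarrow> ('s, 'a set) module" where
  "cohomology_mod C d n = subquot_mod (C n) (cocycles C d n) (coboundaries C d n)"


section \<open>Weak injective and weak flat modules\<close>

text \<open>The data of an augmented complex; the augmentation maps \<open>obj 0\<close> to the resolved module, or
  the resolved module to \<open>obj 0\<close>. The deleted complex consists of \<open>obj\<close> and \<open>diff\<close>.\<close>

record ('r, 'u, 'e) aug_complex =
  obj :: "nat \<Rightarrow> ('r, 'u) module"
  diff :: "nat \<Rightarrow> 'u \<Rightarrow> 'u"
  aug :: 'e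

definition projective_resolution :: "('r, 'x) ring_scheme \<Rightarrow> ('r, 'f) module \<Rightarrow>
    ('r, 'u, 'u \<Rightarrow> 'f) aug_complex \<Rightarrow> bool" where
  "projective_resolution R F P \<longleftrightarrow>
     (\<forall>n. projective R (obj P n)) \<and>
     (\<forall>n. diff P n \<in> lmod_hom R (obj P (Suc n)) (obj P n)) \<and>
     aug P \<in> lmod_hom R (obj P 0) F \<and>
     aug P ` carrier (obj P 0) = carrier F \<and>
     exact_at (obj P 1) (diff P 0) (obj P 0) (aug P) F \<and>
     (\<forall>n. exact_at (obj P (Suc (Suc n))) (diff P (Suc n)) (obj P (Suc n)) (diff P n) (obj P n))"

text \<open>Finitely generated modules, and in particular super finitely presented modules and the terms
  of their resolutions by finitely generated projectives, are up to isomorphism modules with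
  carrier in \<open>nat \<Rightarrow> 'r\<close>. Quantifying over that type is therefore no restriction, here and in the
  definitions of weak injectivity and weak flatness.\<close>

definition super_fin_pres :: "('r, 'x) ring_scheme \<Rightarrow> ('r, 'f) module \<Rightarrow> bool" where
  "super_fin_pres R F \<longleftrightarrow> left_module R F \<and>
     (\<exists>P :: ('r, nat \<Rightarrow> 'r, (nat \<Rightarrow> 'r) \<Rightarrow> 'f) aug_complex.
        projective_resolution R F P \<and> (\<forall>n. fin_gen R (obj P n)))"

text \<open>\<open>Ext\<^sup>n\<^sub>R(F,M)\<close> and \<open>Tor\<^sub>n\<^sup>R(M,F)\<close>, computed with a projective resolution \<open>P\<close> of \<open>F\<close>.\<close>

definition Ext :: "('r, 'x) ring_scheme \<Rightarrow> ('r, 'u, 'e) aug_complex \<Rightarrow>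
    ('r, 'm) module \<Rightarrow> nat \<Rightarrow> ('u \<Rightarrow> 'm) set ring" where
  "Ext R P M n = cohomology (\<lambda>i. hom_group R (obj P i) M)
     (\<lambda>i f. compose (carrier (obj P (Suc i))) f (diff P i)) n"

definition Tor :: "('r, 'x) ring_scheme \<Rightarrow> ('r, 'm) module \<Rightarrow>
    ('r, 'u, 'e) aug_complex \<Rightarrow> nat \<Rightarrow> ('m \<times> 'u \<Rightarrow>\<^sub>0 int) set set ring" where
  "Tor R M P n = homology (\<lambda>i. tensor R M (obj P i))
     (\<lambda>i. tensor_map R M (obj P i) (\<lambda>x. x) (diff P i)) n"

definition weak_injective :: "('r, 'x) ring_scheme \<Rightarrow> ('r, 'm) module \<Rightarrow> bool" where
  "weak_injective R M \<longleftrightarrow> left_module R M \<and>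
     (\<forall>(F :: ('r, nat \<Rightarrow> 'r) module)
        (P :: ('r, nat \<Rightarrow> 'r, (nat \<Rightarrow> 'r) \<Rightarrow> (nat \<Rightarrow> 'r)) aug_complex).
        super_fin_pres R F \<and> projective_resolution R F P \<longrightarrow>
        carrier (Ext R P M 1) = {\<zero>\<^bsub>Ext R P M 1\<^esub>})"

definition weak_flat :: "('r, 'x) ring_scheme \<Rightarrow> ('r, 'm) module \<Rightarrow> bool" where
  "weak_flat R M \<longleftrightarrow> right_module R M \<and>
     (\<forall>(F :: ('r, nat \<Rightarrow> 'r) module)
        (P :: ('r, nat \<Rightarrow> 'r, (nat \<Rightarrow> 'r) \<Rightarrow> (nat \<Rightarrow> 'r)) aug_complex).
        super_fin_pres R F \<and> projective_resolution R F P \<longrightarrow>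
        carrier (Tor R M P 1) = {\<zero>\<^bsub>Tor R M P 1\<^esub>})"

definition WI :: "('r, 'x) ring_scheme \<Rightarrow> ('r, 'u) module set" where
  "WI R = {M. weak_injective R M}"

definition WF :: "('r, 'x) ring_scheme \<Rightarrow> ('r, 'u) module set" where
  "WF R = {M. weak_flat R M}"


section \<open>Relative resolutions and derived functors\<close>

text \<open>The class \<open>\<C>\<close>, hence both the terms of a resolution and the modules against which it is
  tested, consists of modules with carrier in one type \<open>'u\<close>. An unrestricted resolution, with
  terms transported to a sufficiently large type \<open>'u\<close>, is a resolution in this sense, so a statement
  about all \<open>'u\<close> and all such resolutions covers the unrestricted ones. The resolved module may
  live in another type. For right modules take the opposite ring as \<open>R\<close>.\<close>

definition left_resolution :: "('r, 'x) ring_scheme \<Rightarrow> ('r, 'u) module set \<Rightarrow>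
    ('r, 'm) module \<Rightarrow> ('r, 'u, 'u \<Rightarrow> 'm) aug_complex \<Rightarrow> bool" where
  "left_resolution R \<C> M W \<longleftrightarrow>
     (\<forall>n. obj W n \<in> \<C>) \<and>
     (\<forall>n. diff W n \<in> lmod_hom R (obj W (Suc n)) (obj W n)) \<and>
     aug W \<in> lmod_hom R (obj W 0) M \<and>
     (\<forall>x\<in>carrier (obj W 1). aug W (diff W 0 x) = \<zero>\<^bsub>M\<^esub>) \<and>
     (\<forall>n. \<forall>x\<in>carrier (obj W (Suc (Suc n))). diff W n (diff W (Suc n) x) = \<zero>\<^bsub>obj W n\<^esub>) \<and>
     (\<forall>Y\<in>\<C>.
        compose (carrier Y) (aug W) ` carrier (hom_group R Y (obj W 0)) = carrier (hom_group R Y M) \<and>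
        exact_at (hom_group R Y (obj W 1)) (compose (carrier Y) (diff W 0))
          (hom_group R Y (obj W 0)) (compose (carrier Y) (aug W)) (hom_group R Y M) \<and>
        (\<forall>n. exact_at (hom_group R Y (obj W (Suc (Suc n)))) (compose (carrier Y) (diff W (Suc n)))
          (hom_group R Y (obj W (Suc n))) (compose (carrier Y) (diff W n))
          (hom_group R Y (obj W n))))"

definition right_resolution :: "('r, 'x) ring_scheme \<Rightarrow> ('r, 'u) module set \<Rightarrow>
    ('r, 'm) module \<Rightarrow> ('r, 'u, 'm \<Rightarrow> 'u) aug_complex \<Rightarrow> bool" where
  "right_resolution R \<C> M W \<longleftrightarrow>
     (\<forall>n. obj W n \<in> \<C>) \<and>
     (\<forall>n. diff W n \<in> lmod_hom R (obj W n) (obj W (Suc n))) \<and>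
     aug W \<in> lmod_hom R M (obj W 0) \<and>
     (\<forall>x\<in>carrier M. diff W 0 (aug W x) = \<zero>\<^bsub>obj W 1\<^esub>) \<and>
     (\<forall>n. \<forall>x\<in>carrier (obj W n). diff W (Suc n) (diff W n x) = \<zero>\<^bsub>obj W (Suc (Suc n))\<^esub>) \<and>
     (\<forall>Y\<in>\<C>.
        (\<lambda>f. compose (carrier M) f (aug W)) ` carrier (hom_group R (obj W 0) Y)
          = carrier (hom_group R M Y) \<and>
        exact_at (hom_group R (obj W 1) Y) (\<lambda>f. compose (carrier (obj W 0)) f (diff W 0))
          (hom_group R (obj W 0) Y) (\<lambda>f. compose (carrier M) f (aug W)) (hom_group R M Y) \<and>
        (\<forall>n. exact_at (hom_group R (obj W (Suc (Suc n))) Y)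
          (\<lambda>f. compose (carrier (obj W (Suc n))) f (diff W (Suc n)))
          (hom_group R (obj W (Suc n)) Y) (\<lambda>f. compose (carrier (obj W n)) f (diff W n))
          (hom_group R (obj W n) Y)))"

text \<open>\<open>rel_Ext R M W n\<close> is \<open>H\<^sub>n(Hom\<^sub>R(M, W\<^sub>\<bullet>))\<close>: it is the relative \<open>Ext\<^sub>n(M, N)\<close> when \<open>W\<close> is a left
  resolution of \<open>N\<close> by weak injective left modules, respectively (with \<open>opp R\<close> in place of \<open>R\<close>) by
  weak flat right modules. When \<open>M\<close> is an \<open>R\<close>-\<open>S\<close>-bimodule, \<open>rel_Ext_mod\<close> is the same group as a
  left \<open>S\<close>-module.\<close>

definition rel_Ext :: "('r, 'x) ring_scheme \<Rightarrow> ('r, 'm) module \<Rightarrow>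
    ('r, 'u, 'e) aug_complex \<Rightarrow> nat \<Rightarrow> ('m \<Rightarrow> 'u) set ring" where
  "rel_Ext R M W n = homology (\<lambda>i. hom_group R M (obj W i)) (\<lambda>i. compose (carrier M) (diff W i)) n"

definition rel_Ext_mod :: "('r, 'x) ring_scheme \<Rightarrow> ('r, 's, 'm) bimodule \<Rightarrow>
    ('r, 'u, 'e) aug_complex \<Rightarrow> nat \<Rightarrow> ('s, ('m \<Rightarrow> 'u) set) module" where
  "rel_Ext_mod R M W n =
     homology_mod (\<lambda>i. hom_mod R M (obj W i)) (\<lambda>i. compose (carrier M) (diff W i)) n"

text \<open>\<open>rel_Tor R M V n\<close> is \<open>H\<^sup>n(M \<otimes>\<^sub>R V\<^sup>\<bullet>)\<close>: it is the relative \<open>Tor\<^sup>n(M, N)\<close> when \<open>V\<close> is a right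
  resolution of the left module \<open>N\<close> by weak injective modules. When \<open>M\<close> is an \<open>S\<close>-\<open>R\<close>-bimodule,
  \<open>rel_Tor_mod\<close> is the same group as a left \<open>S\<close>-module.\<close>

definition rel_Tor :: "('r, 'x) ring_scheme \<Rightarrow> ('r, 'm) module \<Rightarrow>
    ('r, 'u, 'e) aug_complex \<Rightarrow> nat \<Rightarrow> ('m \<times> 'u \<Rightarrow>\<^sub>0 int) set set ring" where
  "rel_Tor R M V n = cohomology (\<lambda>i. tensor R M (obj V i))
     (\<lambda>i. tensor_map R M (obj V (Suc i)) (\<lambda>x. x) (diff V i)) n"

definition rel_Tor_mod :: "('r, 'x) ring_scheme \<Rightarrow> ('s, 'r, 'm) bimodule \<Rightarrow>
    ('r, 'u, 'e) aug_complex \<Rightarrow> nat \<Rightarrow> ('s, ('m \<times> 'u \<Rightarrow>\<^sub>0 int) set set) module" where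
  "rel_Tor_mod R M V n = cohomology_mod (\<lambda>i. tensor_left R M (obj V i))
     (\<lambda>i. tensor_map R (flip M) (obj V (Suc i)) (\<lambda>x. x) (diff V i)) n"

end

theory Submission
  imports Defs
begin

text \<open>A projective \<open>M\<close> makes \<open>Hom\<^sub>S(M, -)\<close> exact and a flat \<open>L\<close> makes \<open>L \<otimes>\<^sub>S -\<close> exact, and exact
  functors commute with homology. So all three isomorphisms come from an isomorphism of complexes,
  which is the adjunction \<open>Hom\<^sub>R(L \<otimes>\<^sub>S M, W) \<cong> Hom\<^sub>S(M, Hom\<^sub>R(L, W))\<close> in the first two cases and
  the associativity \<open>(L \<otimes>\<^sub>S M) \<otimes>\<^sub>R V \<cong> L \<otimes>\<^sub>S (M \<otimes>\<^sub>R V)\<close> in the third.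

  The two sides may be computed with different resolutions of \<open>N\<close>. This is covered by the comparison
  theorem of relative homological algebra, \<open>rel_Ext_resolution_independent\<close> and
  \<open>rel_Tor_resolution_independent\<close>, which holds for resolutions by an arbitrary class of modules.

  For the first two isomorphisms, \<open>rel_Ext_hom_tensor\<close> sends a cycle \<open>f\<close> directly to the map
  \<open>m \<mapsto> [l \<mapsto> f (l \<otimes> m)]\<close> into homology; surjectivity and the kernel are read off by lifting maps
  along \<open>Z \<rightarrow> Z / B\<close> and along the differential onto \<open>B\<close>. It uses of the tensor product only its universal property,
  so that it applies to \<open>L \<otimes> M\<close> and, over the opposite rings, to \<open>M \<otimes> L\<close>. The third isomorphism
  combines \<open>tensor_assoc\<close> with \<open>flat_cohomology\<close>.

  Projectivity and flatness are given for modules in fixed types, but the modules of cycles,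
  boundaries and cohomology classes live in other types. The passage to arbitrary types is made in
  \<open>projective_lift\<close>, by splitting the epimorphism from a free module, and in \<open>flat_inj\<close>, by
  reduction to finitely generated submodules.\<close>

section \<open>Homomorphisms, submodules and quotients\<close>

lemma abelian_group_hom_intro:
  assumes "abelian_group G" "abelian_group H"
    and "\<And>x. x \<in> carrier G \<Longrightarrow> f x \<in> carrier H"
    and "\<And>x y. \<lbrakk>x \<in> carrier G; y \<in> carrier G\<rbrakk> \<Longrightarrow> f (x \<oplus>\<^bsub>G\<^esub> y) = f x \<oplus>\<^bsub>H\<^esub> f y"
  shows "abelian_group_hom G H f"
  using assms
  by (intro abelian_group_homI group_hom.intro abelian_group.a_group)
     (auto simp: group_hom_axioms_def hom_def)

lemma lmod_hom_closed: "\<lbrakk>f \<in> lmod_hom R M N; x \<in> carrier M\<rbrakk> \<Longrightarrow> f x \<in> carrier N"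
  by (auto simp: lmod_hom_def)

lemma lmod_hom_add:
  "\<lbrakk>f \<in> lmod_hom R M N; x \<in> carrier M; y \<in> carrier M\<rbrakk> \<Longrightarrow> f (x \<oplus>\<^bsub>M\<^esub> y) = f x \<oplus>\<^bsub>N\<^esub> f y"
  by (auto simp: lmod_hom_def)

lemma lmod_hom_smult:
  "\<lbrakk>f \<in> lmod_hom R M N; r \<in> carrier R; x \<in> carrier M\<rbrakk> \<Longrightarrow> f (r \<odot>\<^bsub>M\<^esub> x) = r \<odot>\<^bsub>N\<^esub> f x"
  by (auto simp: lmod_hom_def)

lemma lmod_homI:
  assumes "\<And>x. x \<in> carrier M \<Longrightarrow> f x \<in> carrier N"
    and "\<And>x y. \<lbrakk>x \<in> carrier M; y \<in> carrier M\<rbrakk> \<Longrightarrow> f (x \<oplus>\<^bsub>M\<^esub> y) = f x \<oplus>\<^bsub>N\<^esub> f y"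
    and "\<And>r x. \<lbrakk>r \<in> carrier R; x \<in> carrier M\<rbrakk> \<Longrightarrow> f (r \<odot>\<^bsub>M\<^esub> x) = r \<odot>\<^bsub>N\<^esub> f x"
  shows "f \<in> lmod_hom R M N"
  using assms by (auto simp: lmod_hom_def)

lemma lmod_hom_comp:
  "\<lbrakk>f \<in> lmod_hom R A B; g \<in> lmod_hom R B C\<rbrakk> \<Longrightarrow> (\<lambda>x. g (f x)) \<in> lmod_hom R A C"
  by (auto simp: lmod_hom_def Pi_iff)

lemma lmod_hom_id: "(\<lambda>x. x) \<in> lmod_hom R M M"
  by (auto simp: lmod_hom_def)

lemma lmod_hom_restrict:
  assumes "left_module R M" "f \<in> lmod_hom R M N"
  shows "restrict f (carrier M) \<in> lmod_hom R M N"
proof -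
  interpret M: left_module R M by fact
  show ?thesis using assms(2) by (auto simp: lmod_hom_def)
qed

lemma lmod_hom_abelian_group_hom:
  assumes "left_module R M" "left_module R N" "f \<in> lmod_hom R M N"
  shows "abelian_group_hom M N f"
  using assms by (intro abelian_group_hom_intro) (auto simp: lmod_hom_def left_module_def)

lemma lmod_hom_zero:
  assumes "left_module R M" "left_module R N" "f \<in> lmod_hom R M N"
  shows "f \<zero>\<^bsub>M\<^esub> = \<zero>\<^bsub>N\<^esub>"
  using abelian_group_hom.hom_zero[OF lmod_hom_abelian_group_hom[OF assms]] .

lemma abelian_group_hom_minus:
  assumes "abelian_group_hom G H f" "x \<in> carrier G" "y \<in> carrier G"
  shows "f (x \<ominus>\<^bsub>G\<^esub> y) = f x \<ominus>\<^bsub>H\<^esub> f y"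
proof -
  interpret abelian_group_hom G H f by fact
  show ?thesis using assms(2,3) by (simp add: a_minus_def)
qed

lemma abelian_subgroup_intro:
  assumes "abelian_group G" "B \<subseteq> carrier G" "\<zero>\<^bsub>G\<^esub> \<in> B"
    and "\<And>x y. \<lbrakk>x \<in> B; y \<in> B\<rbrakk> \<Longrightarrow> x \<oplus>\<^bsub>G\<^esub> y \<in> B"
    and "\<And>x. x \<in> B \<Longrightarrow> \<ominus>\<^bsub>G\<^esub> x \<in> B"
  shows "abelian_subgroup B G"
proof -
  interpret abelian_group G by fact
  show ?thesis
    using assms
    by (intro abelian_subgroupI3 additive_subgroupI) (auto simp: subgroup_def a_inv_def[symmetric])
qed

lemma abelian_group_minus_zero:
  assumes "abelian_group G" "x \<in> carrier G"
  shows "x \<ominus>\<^bsub>G\<^esub> \<zero>\<^bsub>G\<^esub> = x"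
proof -
  interpret abelian_group G by fact
  show ?thesis using assms(2) by (simp add: a_minus_def minus_equality)
qed

lemma abelian_group_minus_eq_zero_iff:
  assumes "abelian_group G" "x \<in> carrier G" "y \<in> carrier G"
  shows "x \<ominus>\<^bsub>G\<^esub> y = \<zero>\<^bsub>G\<^esub> \<longleftrightarrow> x = y"
proof -
  interpret abelian_group G by fact
  have "x = (x \<ominus>\<^bsub>G\<^esub> y) \<oplus>\<^bsub>G\<^esub> y" using assms(2,3) by (simp add: a_minus_def a_assoc l_neg)
  then show ?thesis using assms(2,3) by (metis a_minus_def l_zero r_neg)
qed

lemma coset_eq_iff:
  assumes "abelian_subgroup B G" "x \<in> carrier G" "y \<in> carrier G"
  shows "B +>\<^bsub>G\<^esub> x = B +>\<^bsub>G\<^esub> y \<longleftrightarrow> x \<ominus>\<^bsub>G\<^esub> y \<in> B"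
proof -
  interpret abelian_subgroup B G by fact
  have "B +>\<^bsub>G\<^esub> x = B +>\<^bsub>G\<^esub> y \<longleftrightarrow> x \<in> B +>\<^bsub>G\<^esub> y"
    using assms(2,3) a_repr_independence' a_rcos_self by metis
  also have "\<dots> \<longleftrightarrow> x \<ominus>\<^bsub>G\<^esub> y \<in> B"
    using assms(2,3) a_rcos_module by (metis a_minus_def)
  finally show ?thesis .
qed

text \<open>The first isomorphism theorem for the subquotient \<open>Z / B\<close>. Every isomorphism of homology
  groups below is obtained from it, so that maps out of homology groups never have to be defined on cosets.\<close>

lemma subquot_iso:
  assumes "abelian_subgroup B G" "abelian_subgroup Z G" "B \<subseteq> Z" "abelian_group H"
    and closed: "\<And>z. z \<in> Z \<Longrightarrow> \<phi> z \<in> carrier H"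
    and add: "\<And>y z. \<lbrakk>y \<in> Z; z \<in> Z\<rbrakk> \<Longrightarrow> \<phi> (y \<oplus>\<^bsub>G\<^esub> z) = \<phi> y \<oplus>\<^bsub>H\<^esub> \<phi> z"
    and surj: "\<And>h. h \<in> carrier H \<Longrightarrow> \<exists>z\<in>Z. \<phi> z = h"
    and ker: "\<And>z. z \<in> Z \<Longrightarrow> \<phi> z = \<zero>\<^bsub>H\<^esub> \<longleftrightarrow> z \<in> B"
  shows "add_monoid (subquot G Z B) \<cong> add_monoid H"
proof -
  interpret B: abelian_subgroup B G by fact
  interpret Z: abelian_subgroup Z G by fact
  interpret H: abelian_group H by fact
  have inG: "z \<in> carrier G" if "z \<in> Z" for z using that by simp
  have minus: "\<phi> (y \<ominus>\<^bsub>G\<^esub> z) = \<phi> y \<ominus>\<^bsub>H\<^esub> \<phi> z" if "y \<in> Z" "z \<in> Z" for y z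
  proof -
    have yz: "y \<ominus>\<^bsub>G\<^esub> z \<in> Z" using that by (simp add: a_minus_def)
    have "(y \<ominus>\<^bsub>G\<^esub> z) \<oplus>\<^bsub>G\<^esub> z = y"
      using that inG by (simp add: a_minus_def B.a_assoc B.l_neg)
    then have "\<phi> y = \<phi> (y \<ominus>\<^bsub>G\<^esub> z) \<oplus>\<^bsub>H\<^esub> \<phi> z" using add[OF yz that(2)] by simp
    then show ?thesis
      using closed[OF that(1)] closed[OF that(2)] closed[OF yz]
      by (simp add: a_minus_def[of H] H.a_assoc H.r_neg)
  qed
  have eq: "B +>\<^bsub>G\<^esub> y = B +>\<^bsub>G\<^esub> z \<longleftrightarrow> \<phi> y = \<phi> z" if "y \<in> Z" "z \<in> Z" for y z
  proof -
    have "y \<ominus>\<^bsub>G\<^esub> z \<in> Z" using that by (simp add: a_minus_def)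
    then have "B +>\<^bsub>G\<^esub> y = B +>\<^bsub>G\<^esub> z \<longleftrightarrow> \<phi> y \<ominus>\<^bsub>H\<^esub> \<phi> z = \<zero>\<^bsub>H\<^esub>"
      using coset_eq_iff[OF assms(1) inG[OF that(1)] inG[OF that(2)]] ker[of "y \<ominus>\<^bsub>G\<^esub> z"] minus[OF that]
      by metis
    then show ?thesis
      using abelian_group_minus_eq_zero_iff[OF assms(4) closed[OF that(1)] closed[OF that(2)]] by simp
  qed
  define \<psi> where "\<psi> Y = \<phi> (SOME z. z \<in> Z \<and> Y = B +>\<^bsub>G\<^esub> z)" for Y
  have \<psi>: "\<psi> (B +>\<^bsub>G\<^esub> z) = \<phi> z" if "z \<in> Z" for z
  proof -
    have "\<exists>y. y \<in> Z \<and> B +>\<^bsub>G\<^esub> z = B +>\<^bsub>G\<^esub> y" using that by blast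
    from someI_ex[OF this] show ?thesis unfolding \<psi>_def using eq that by metis
  qed
  have sum: "(B +>\<^bsub>G\<^esub> y) <+>\<^bsub>G\<^esub> (B +>\<^bsub>G\<^esub> z) = B +>\<^bsub>G\<^esub> (y \<oplus>\<^bsub>G\<^esub> z)" if "y \<in> Z" "z \<in> Z" for y z
    using B.a_rcos_sum inG that by blast
  have "\<psi> \<in> iso (add_monoid (subquot G Z B)) (add_monoid H)"
    unfolding iso_iff
  proof (intro conjI)
    show "\<psi> \<in> hom (add_monoid (subquot G Z B)) (add_monoid H)"
      by (auto simp: hom_def subquot_def \<psi> closed sum add)
    show "\<psi> ` carrier (add_monoid (subquot G Z B)) = carrier (add_monoid H)"
    proof
      show "carrier (add_monoid H) \<subseteq> \<psi> ` carrier (add_monoid (subquot G Z B))"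
      proof
        fix h assume "h \<in> carrier (add_monoid H)"
        then obtain z where "z \<in> Z" "\<phi> z = h" using surj by auto
        then show "h \<in> \<psi> ` carrier (add_monoid (subquot G Z B))"
          by (auto simp: subquot_def \<psi> intro!: rev_image_eqI[of "B +>\<^bsub>G\<^esub> z"])
      qed
    qed (auto simp: subquot_def \<psi> closed)
    show "inj_on \<psi> (carrier (add_monoid (subquot G Z B)))"
      by (auto simp: inj_on_def subquot_def \<psi> eq)
  qed
  then show ?thesis by (rule is_isoI)
qed

lemma abelian_group_surj_image:
  assumes "abelian_group G"
    and cH: "carrier H = f ` carrier G"
    and z: "\<zero>\<^bsub>H\<^esub> = f \<zero>\<^bsub>G\<^esub>"
    and a: "\<And>x y. \<lbrakk>x \<in> carrier G; y \<in> carrier G\<rbrakk> \<Longrightarrow> f x \<oplus>\<^bsub>H\<^esub> f y = f (x \<oplus>\<^bsub>G\<^esub> y)"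
  shows "abelian_group H"
proof -
  interpret abelian_group G by fact
  show ?thesis
  proof (rule abelian_groupI)
    fix x assume "x \<in> carrier H"
    then obtain u where u: "u \<in> carrier G" "x = f u" using cH by auto
    then show "\<exists>y\<in>carrier H. y \<oplus>\<^bsub>H\<^esub> x = \<zero>\<^bsub>H\<^esub>"
      using a[of "\<ominus>\<^bsub>G\<^esub> u" u] cH z by (auto intro!: bexI[of _ "f (\<ominus>\<^bsub>G\<^esub> u)"] simp: l_neg)
  qed (auto simp: cH z a a_ac)
qed

lemma subgroup_abelian_group:
  assumes "abelian_subgroup Z G"
  shows "abelian_group (G\<lparr>carrier := Z\<rparr>)"
proof -
  interpret abelian_subgroup Z G by fact
  show ?thesis
    by (rule abelian_groupI) (auto simp: a_ac r_neg intro!: bexI[of _ "\<ominus>\<^bsub>G\<^esub> _"])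
qed

lemma subquot_abelian_group:
  assumes "abelian_subgroup B G" "abelian_subgroup Z G"
  shows "abelian_group (subquot G Z B)"
proof -
  interpret B: abelian_subgroup B G by fact
  interpret Z: abelian_subgroup Z G by fact
  have "B +>\<^bsub>G\<^esub> \<zero>\<^bsub>G\<^esub> = B" using B.a_subset by simp
  then show ?thesis
    using B.a_rcos_sum
    by (intro abelian_group_surj_image[OF subgroup_abelian_group[OF assms(2)],
          where f = "\<lambda>z. B +>\<^bsub>G\<^esub> z"])
       (auto simp: subquot_def)
qed

text \<open>Maps between complexes are used only through the following criterion: homomorphisms in both
  directions that are mutually inverse up to boundaries.\<close>

lemma subquot_iso_mutual:
  assumes B: "abelian_subgroup B G" and Z: "abelian_subgroup Z G" and "B \<subseteq> Z"
    and B': "abelian_subgroup B' G'" and Z': "abelian_subgroup Z' G'" and "B' \<subseteq> Z'"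
    and \<alpha>: "abelian_group_hom G G' \<alpha>" and \<beta>: "abelian_group_hom G' G \<beta>"
    and "\<alpha> ` Z \<subseteq> Z'" "\<beta> ` Z' \<subseteq> Z" "\<alpha> ` B \<subseteq> B'" "\<beta> ` B' \<subseteq> B"
    and inv1: "\<And>z. z \<in> Z \<Longrightarrow> z \<ominus>\<^bsub>G\<^esub> \<beta> (\<alpha> z) \<in> B"
    and inv2: "\<And>z. z \<in> Z' \<Longrightarrow> z \<ominus>\<^bsub>G'\<^esub> \<alpha> (\<beta> z) \<in> B'"
  shows "add_monoid (subquot G Z B) \<cong> add_monoid (subquot G' Z' B')"
proof -
  interpret B: abelian_subgroup B G by fact
  interpret Z: abelian_subgroup Z G by fact
  interpret B': abelian_subgroup B' G' by fact
  interpret Z': abelian_subgroup Z' G' by fact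
  interpret \<alpha>: abelian_group_hom G G' \<alpha> by fact
  interpret \<beta>: abelian_group_hom G' G \<beta> by fact
  show ?thesis
  proof (rule subquot_iso[where \<phi> = "\<lambda>z. B' +>\<^bsub>G'\<^esub> \<alpha> z"])
    show "abelian_group (subquot G' Z' B')" by (rule subquot_abelian_group) fact+
    show "B' +>\<^bsub>G'\<^esub> \<alpha> z \<in> carrier (subquot G' Z' B')" if "z \<in> Z" for z
      using that assms(9) by (auto simp: subquot_def)
    show "B' +>\<^bsub>G'\<^esub> \<alpha> (y \<oplus>\<^bsub>G\<^esub> z) = (B' +>\<^bsub>G'\<^esub> \<alpha> y) \<oplus>\<^bsub>subquot G' Z' B'\<^esub> (B' +>\<^bsub>G'\<^esub> \<alpha> z)"
      if "y \<in> Z" "z \<in> Z" for y z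
      using that B'.a_rcos_sum by (simp add: subquot_def)
    show "\<exists>z\<in>Z. B' +>\<^bsub>G'\<^esub> \<alpha> z = h" if "h \<in> carrier (subquot G' Z' B')" for h
    proof -
      obtain z where z: "z \<in> Z'" "h = B' +>\<^bsub>G'\<^esub> z" using \<open>h \<in> _\<close> by (auto simp: subquot_def)
      then have "B' +>\<^bsub>G'\<^esub> z = B' +>\<^bsub>G'\<^esub> \<alpha> (\<beta> z)"
        using coset_eq_iff[OF B'] inv2 by simp
      then show ?thesis using z assms(10) by (intro bexI[of _ "\<beta> z"]) auto
    qed
    show "B' +>\<^bsub>G'\<^esub> \<alpha> z = \<zero>\<^bsub>subquot G' Z' B'\<^esub> \<longleftrightarrow> z \<in> B" if z: "z \<in> Z" for z
    proof -
      have "B' +>\<^bsub>G'\<^esub> \<alpha> z = \<zero>\<^bsub>subquot G' Z' B'\<^esub> \<longleftrightarrow> \<alpha> z \<in> B'"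
        using coset_eq_iff[OF B', of "\<alpha> z" "\<zero>\<^bsub>G'\<^esub>"] z B'.a_subset
        by (simp add: subquot_def abelian_group_minus_zero[OF B'.abelian_group_axioms])
      also have "\<dots> \<longleftrightarrow> z \<in> B"
      proof
        assume "\<alpha> z \<in> B'"
        then have "\<beta> (\<alpha> z) \<in> B" using assms(12) by auto
        then have "(z \<ominus>\<^bsub>G\<^esub> \<beta> (\<alpha> z)) \<oplus>\<^bsub>G\<^esub> \<beta> (\<alpha> z) \<in> B" using inv1 z by blast
        then show "z \<in> B" using z by (simp add: a_minus_def B.a_assoc B.l_neg)
      qed (use assms(11) in auto)
      finally show ?thesis .
    qed
  qed fact+
qed

lemma left_moduleI:
  assumes "ring R" "abelian_group M"
    and "\<And>a x. \<lbrakk>a \<in> carrier R; x \<in> carrier M\<rbrakk> \<Longrightarrow> a \<odot>\<^bsub>M\<^esub> x \<in> carrier M"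
    and "\<And>a b x. \<lbrakk>a \<in> carrier R; b \<in> carrier R; x \<in> carrier M\<rbrakk> \<Longrightarrow>
        (a \<oplus>\<^bsub>R\<^esub> b) \<odot>\<^bsub>M\<^esub> x = a \<odot>\<^bsub>M\<^esub> x \<oplus>\<^bsub>M\<^esub> b \<odot>\<^bsub>M\<^esub> x"
    and "\<And>a x y. \<lbrakk>a \<in> carrier R; x \<in> carrier M; y \<in> carrier M\<rbrakk> \<Longrightarrow>
        a \<odot>\<^bsub>M\<^esub> (x \<oplus>\<^bsub>M\<^esub> y) = a \<odot>\<^bsub>M\<^esub> x \<oplus>\<^bsub>M\<^esub> a \<odot>\<^bsub>M\<^esub> y"
    and "\<And>a b x. \<lbrakk>a \<in> carrier R; b \<in> carrier R; x \<in> carrier M\<rbrakk> \<Longrightarrow>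
        (a \<otimes>\<^bsub>R\<^esub> b) \<odot>\<^bsub>M\<^esub> x = a \<odot>\<^bsub>M\<^esub> (b \<odot>\<^bsub>M\<^esub> x)"
    and "\<And>x. x \<in> carrier M \<Longrightarrow> \<one>\<^bsub>R\<^esub> \<odot>\<^bsub>M\<^esub> x = x"
  shows "left_module R M"
  using assms by (simp add: left_module_def left_module_axioms_def)

lemma (in left_module) smult_r_null:
  assumes "a \<in> carrier R" shows "a \<odot>\<^bsub>M\<^esub> \<zero>\<^bsub>M\<^esub> = \<zero>\<^bsub>M\<^esub>"
proof -
  have "a \<odot>\<^bsub>M\<^esub> \<zero>\<^bsub>M\<^esub> \<oplus>\<^bsub>M\<^esub> a \<odot>\<^bsub>M\<^esub> \<zero>\<^bsub>M\<^esub> = a \<odot>\<^bsub>M\<^esub> \<zero>\<^bsub>M\<^esub>"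
    using smult_r_distr[of a "\<zero>\<^bsub>M\<^esub>" "\<zero>\<^bsub>M\<^esub>"] assms by simp
  then show ?thesis using M.add.r_cancel_one[of "a \<odot>\<^bsub>M\<^esub> \<zero>\<^bsub>M\<^esub>"] assms by simp
qed

lemma (in left_module) smult_l_null:
  assumes "x \<in> carrier M" shows "\<zero> \<odot>\<^bsub>M\<^esub> x = \<zero>\<^bsub>M\<^esub>"
proof -
  have "\<zero> \<odot>\<^bsub>M\<^esub> x \<oplus>\<^bsub>M\<^esub> \<zero> \<odot>\<^bsub>M\<^esub> x = \<zero> \<odot>\<^bsub>M\<^esub> x"
    using smult_l_distr[of "\<zero>" "\<zero>" x] assms by simp
  then show ?thesis using M.add.r_cancel_one[of "\<zero> \<odot>\<^bsub>M\<^esub> x"] assms by simp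
qed

lemma (in left_module) smult_minus_one:
  assumes "x \<in> carrier M" shows "(\<ominus> \<one>) \<odot>\<^bsub>M\<^esub> x = \<ominus>\<^bsub>M\<^esub> x"
proof -
  have "(\<ominus> \<one>) \<odot>\<^bsub>M\<^esub> x \<oplus>\<^bsub>M\<^esub> x = \<zero>\<^bsub>M\<^esub>"
    using smult_l_distr[of "\<ominus> \<one>" "\<one>" x] assms by (simp add: smult_l_null R.l_neg)
  then show ?thesis using M.minus_equality[of "(\<ominus> \<one>) \<odot>\<^bsub>M\<^esub> x" x] assms by simp
qed

text \<open>Closure under negation is automatic, because \<open>- x = (- 1) x\<close>.\<close>

lemma (in left_module) submodule_intro:
  assumes "H \<subseteq> carrier M" "\<zero>\<^bsub>M\<^esub> \<in> H"
    and "\<And>x y. \<lbrakk>x \<in> H; y \<in> H\<rbrakk> \<Longrightarrow> x \<oplus>\<^bsub>M\<^esub> y \<in> H"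
    and "\<And>r x. \<lbrakk>r \<in> carrier R; x \<in> H\<rbrakk> \<Longrightarrow> r \<odot>\<^bsub>M\<^esub> x \<in> H"
  shows "submodule H R M"
proof -
  have "\<ominus>\<^bsub>M\<^esub> x \<in> H" if "x \<in> H" for x
    using assms(4)[of "\<ominus> \<one>" x] that assms(1) smult_minus_one[of x] by auto
  then show ?thesis
    using assms by (auto simp: submodule_def submodule_axioms_def subgroup_def a_inv_def[symmetric])
qed

lemma submodule_abelian_subgroup:
  assumes "left_module R M" "submodule H R M"
  shows "abelian_subgroup H M"
proof -
  interpret left_module R M by fact
  show ?thesis
    using assms(2) unfolding submodule_def
    by (intro abelian_subgroupI3 additive_subgroupI) (auto intro: M.abelian_group_axioms)
qed

lemma submodule_left_module:
  assumes "left_module R M" "submodule H R M"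
  shows "left_module R (M\<lparr>carrier := H\<rparr>)"
proof -
  interpret left_module R M by fact
  interpret abelian_subgroup H M by (rule submodule_abelian_subgroup) fact+
  show ?thesis
    using subgroup_abelian_group[OF abelian_subgroup_axioms] submodule.smult_closed[OF assms(2)]
    by (intro left_moduleI) (auto simp: smult_l_distr smult_r_distr smult_assoc1 R.ring_axioms)
qed

lemma subquot_mod_simps:
  "carrier (subquot_mod G Z B) = (\<lambda>z. B +>\<^bsub>G\<^esub> z) ` Z"
  "\<zero>\<^bsub>subquot_mod G Z B\<^esub> = B"
  "x \<oplus>\<^bsub>subquot_mod G Z B\<^esub> y = x <+>\<^bsub>G\<^esub> y"
  "s \<odot>\<^bsub>subquot_mod G Z B\<^esub> Y = (\<Union>x\<in>Y. B +>\<^bsub>G\<^esub> (s \<odot>\<^bsub>G\<^esub> x))"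
  by (simp_all add: subquot_mod_def subquot_def ring.defs module.defs)

lemma subquot_mod_smult:
  assumes "left_module S G" "submodule B S G" "s \<in> carrier S" "z \<in> carrier G"
  shows "s \<odot>\<^bsub>subquot_mod G Z B\<^esub> (B +>\<^bsub>G\<^esub> z) = B +>\<^bsub>G\<^esub> (s \<odot>\<^bsub>G\<^esub> z)"
proof -
  interpret left_module S G by fact
  interpret B: abelian_subgroup B G by (rule submodule_abelian_subgroup) fact+
  have "B +>\<^bsub>G\<^esub> (s \<odot>\<^bsub>G\<^esub> x) = B +>\<^bsub>G\<^esub> (s \<odot>\<^bsub>G\<^esub> z)" if x: "x \<in> B +>\<^bsub>G\<^esub> z" for x
  proof -
    obtain b where b: "b \<in> B" "x = b \<oplus>\<^bsub>G\<^esub> z" using x unfolding a_r_coset_def' by blast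
    have eq: "s \<odot>\<^bsub>G\<^esub> x = s \<odot>\<^bsub>G\<^esub> b \<oplus>\<^bsub>G\<^esub> s \<odot>\<^bsub>G\<^esub> z"
      unfolding b(2) using b(1) assms by (intro smult_r_distr) auto
    have "s \<odot>\<^bsub>G\<^esub> b \<in> B" using submodule.smult_closed[OF assms(2,3) b(1)] .
    then have "s \<odot>\<^bsub>G\<^esub> x \<in> B +>\<^bsub>G\<^esub> (s \<odot>\<^bsub>G\<^esub> z)"
      unfolding a_r_coset_def' eq by blast
    from B.a_repr_independence'[OF this smult_closed[OF assms(3,4)]] show ?thesis by simp
  qed
  moreover have "z \<in> B +>\<^bsub>G\<^esub> z" using B.a_rcos_self assms by blast
  ultimately show ?thesis unfolding subquot_mod_simps by blast
qed

text \<open>A quotient module is used only through the projection from \<open>Z\<close>, not through its cosets.\<close>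

lemma
  assumes "left_module S G" "submodule B S G" "submodule Z S G" "B \<subseteq> Z"
  shows subquot_mod_left_module: "left_module S (subquot_mod G Z B)"
    and subquot_mod_proj:
      "(\<lambda>z. B +>\<^bsub>G\<^esub> z) \<in> lmod_hom S (G\<lparr>carrier := Z\<rparr>) (subquot_mod G Z B)"
    and subquot_mod_proj_eq_zero:
      "z \<in> Z \<Longrightarrow> B +>\<^bsub>G\<^esub> z = \<zero>\<^bsub>subquot_mod G Z B\<^esub> \<longleftrightarrow> z \<in> B"
proof -
  interpret left_module S G by fact
  interpret B: abelian_subgroup B G by (rule submodule_abelian_subgroup) fact+
  interpret Z: abelian_subgroup Z G by (rule submodule_abelian_subgroup) fact+
  have sZ: "s \<odot>\<^bsub>G\<^esub> z \<in> Z" if "s \<in> carrier S" "z \<in> Z" for s z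
    using submodule.smult_closed[OF assms(3) that] .
  have smult: "s \<odot>\<^bsub>subquot_mod G Z B\<^esub> (B +>\<^bsub>G\<^esub> z) = B +>\<^bsub>G\<^esub> (s \<odot>\<^bsub>G\<^esub> z)"
    if "s \<in> carrier S" "z \<in> Z" for s z
    using subquot_mod_smult[OF assms(1,2)] that by simp
  have add: "(B +>\<^bsub>G\<^esub> y) <+>\<^bsub>G\<^esub> (B +>\<^bsub>G\<^esub> z) = B +>\<^bsub>G\<^esub> (y \<oplus>\<^bsub>G\<^esub> z)" if "y \<in> Z" "z \<in> Z" for y z
    using B.a_rcos_sum that by simp
  have zero: "B +>\<^bsub>G\<^esub> \<zero>\<^bsub>G\<^esub> = B" using B.a_subset by simp
  have ab: "abelian_group (subquot_mod G Z B)"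
    using add zero
    by (intro abelian_group_surj_image[OF subgroup_abelian_group[OF Z.abelian_subgroup_axioms],
          where f = "\<lambda>z. B +>\<^bsub>G\<^esub> z"])
       (auto simp: subquot_mod_simps)
  note simps = subquot_mod_simps(1-3) smult add sZ
  show "left_module S (subquot_mod G Z B)"
    by (rule left_moduleI[OF R.ring_axioms ab])
       (auto simp: simps smult_l_distr smult_r_distr smult_assoc1)
  show "(\<lambda>z. B +>\<^bsub>G\<^esub> z) \<in> lmod_hom S (G\<lparr>carrier := Z\<rparr>) (subquot_mod G Z B)"
    by (rule lmod_homI) (auto simp: simps)
  show "B +>\<^bsub>G\<^esub> z = \<zero>\<^bsub>subquot_mod G Z B\<^esub> \<longleftrightarrow> z \<in> B" if "z \<in> Z"
    using coset_eq_iff[OF B.abelian_subgroup_axioms, of z "\<zero>\<^bsub>G\<^esub>"] that zero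
    by (simp add: subquot_mod_simps(2) abelian_group_minus_zero[OF M.abelian_group_axioms])
qed

lemma lmod_hom_kernel_submodule:
  assumes "left_module R M" "left_module R N" "f \<in> lmod_hom R M N"
  shows "submodule {x \<in> carrier M. f x = \<zero>\<^bsub>N\<^esub>} R M"
proof -
  interpret M: left_module R M by fact
  interpret N: left_module R N by fact
  show ?thesis
    using lmod_hom_zero[OF assms]
    by (intro M.submodule_intro)
       (auto simp: lmod_hom_add[OF assms(3)] lmod_hom_smult[OF assms(3)] N.smult_r_null)
qed

lemma lmod_hom_image_submodule:
  assumes "left_module R M" "left_module R N" "f \<in> lmod_hom R M N"
  shows "submodule (f ` carrier M) R N"
proof -
  interpret M: left_module R M by fact
  interpret N: left_module R N by fact
  show ?thesis
  proof (rule N.submodule_intro)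
    show "\<zero>\<^bsub>N\<^esub> \<in> f ` carrier M"
      using lmod_hom_zero[OF assms] by (metis M.M.zero_closed imageI)
  next
    fix x y assume "x \<in> f ` carrier M" "y \<in> f ` carrier M"
    then show "x \<oplus>\<^bsub>N\<^esub> y \<in> f ` carrier M"
      using lmod_hom_add[OF assms(3)] by (metis (no_types, lifting) M.M.add.m_closed image_iff)
  next
    fix r x assume "r \<in> carrier R" "x \<in> f ` carrier M"
    then show "r \<odot>\<^bsub>N\<^esub> x \<in> f ` carrier M"
      using lmod_hom_smult[OF assms(3)] by (metis (no_types, lifting) M.smult_closed image_iff)
  qed (use lmod_hom_closed[OF assms(3)] in auto)
qed

lemma abelian_group_hom_kernel:
  assumes "abelian_group_hom G H f"
  shows "abelian_subgroup {x \<in> carrier G. f x = \<zero>\<^bsub>H\<^esub>} G"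
proof -
  interpret abelian_group_hom G H f by fact
  show ?thesis by (intro abelian_subgroup_intro) (auto intro: G.abelian_group_axioms)
qed

lemma abelian_group_hom_image:
  assumes "abelian_group_hom G H f"
  shows "abelian_subgroup (f ` carrier G) H"
proof -
  interpret abelian_group_hom G H f by fact
  show ?thesis
  proof (rule abelian_subgroup_intro)
    show "\<zero>\<^bsub>H\<^esub> \<in> f ` carrier G"
      using hom_zero by (metis G.zero_closed imageI)
  next
    fix x y assume "x \<in> f ` carrier G" "y \<in> f ` carrier G"
    then show "x \<oplus>\<^bsub>H\<^esub> y \<in> f ` carrier G"
      using hom_add by (metis (no_types, lifting) G.add.m_closed image_iff)
  next
    fix x assume "x \<in> f ` carrier G"
    then show "\<ominus>\<^bsub>H\<^esub> x \<in> f ` carrier G"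
      using hom_a_inv by (metis (no_types, lifting) G.a_inv_closed image_iff)
  qed (auto intro: H.abelian_group_axioms)
qed


section \<open>Complexes\<close>

lemma cycles_eq:
  "cycles C d n = {x \<in> carrier (C n). \<forall>k. n = Suc k \<longrightarrow> d k x = \<zero>\<^bsub>C k\<^esub>}"
  by (cases n) (auto simp: cycles_def a_kernel_def')

lemma cocycles_eq: "cocycles C d n = {x \<in> carrier (C n). d n x = \<zero>\<^bsub>C (Suc n)\<^esub>}"
  by (auto simp: cocycles_def a_kernel_def')

lemma chain_complex_subgroups:
  assumes "\<And>i. abelian_group_hom (C (Suc i)) (C i) (d i)"
    and "\<And>i x. x \<in> carrier (C (Suc (Suc i))) \<Longrightarrow> d i (d (Suc i) x) = \<zero>\<^bsub>C i\<^esub>"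
  shows "abelian_subgroup (cycles C d n) (C n)" "abelian_subgroup (boundaries C d n) (C n)"
    "boundaries C d n \<subseteq> cycles C d n"
proof -
  show "abelian_subgroup (boundaries C d n) (C n)"
    unfolding boundaries_def by (rule abelian_group_hom_image[OF assms(1)])
  show "boundaries C d n \<subseteq> cycles C d n"
    using assms(2) abelian_group_hom.hom_closed[OF assms(1)]
    by (auto simp: boundaries_def cycles_eq)
  show "abelian_subgroup (cycles C d n) (C n)"
  proof (cases n)
    case 0
    interpret abelian_group_hom "C (Suc 0)" "C 0" "d 0" by (rule assms(1))
    show ?thesis unfolding 0 cycles_def
      by (rule abelian_subgroup_intro) (auto intro: H.abelian_group_axioms)
  next
    case (Suc k)
    then show ?thesis using abelian_group_hom_kernel[OF assms(1), of k] by (simp add: cycles_eq)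
  qed
qed

lemma cochain_complex_subgroups:
  assumes "\<And>i. abelian_group_hom (C i) (C (Suc i)) (d i)"
    and "\<And>i x. x \<in> carrier (C i) \<Longrightarrow> d (Suc i) (d i x) = \<zero>\<^bsub>C (Suc (Suc i))\<^esub>"
  shows "abelian_subgroup (cocycles C d n) (C n)" "abelian_subgroup (coboundaries C d n) (C n)"
    "coboundaries C d n \<subseteq> cocycles C d n"
proof -
  show "abelian_subgroup (cocycles C d n) (C n)"
    unfolding cocycles_eq by (rule abelian_group_hom_kernel[OF assms(1)])
  interpret abelian_group_hom "C n" "C (Suc n)" "d n" by (rule assms(1))
  show "coboundaries C d n \<subseteq> cocycles C d n"
    using assms(2) abelian_group_hom.hom_closed[OF assms(1)] G.zero_closed hom_zero
    by (cases n) (auto simp: coboundaries_def cocycles_eq)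
  show "abelian_subgroup (coboundaries C d n) (C n)"
  proof (cases n)
    case 0
    interpret C0: abelian_group_hom "C 0" "C (Suc 0)" "d 0" by (rule assms(1))
    show ?thesis unfolding 0 coboundaries_def
      by (rule abelian_subgroup_intro)
         (auto simp: C0.G.minus_equality intro: C0.G.abelian_group_axioms)
  next
    case (Suc k)
    then show ?thesis using abelian_group_hom_image[OF assms(1), of k] by (simp add: coboundaries_def)
  qed
qed

lemma chain_complex_submodules:
  assumes mod: "\<And>i. left_module S (C i)" and d: "\<And>i. d i \<in> lmod_hom S (C (Suc i)) (C i)"
  shows "submodule (cycles C d n) S (C n)" "submodule (boundaries C d n) S (C n)"
proof -
  show "submodule (boundaries C d n) S (C n)"
    unfolding boundaries_def by (rule lmod_hom_image_submodule[OF mod mod d])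
  show "submodule (cycles C d n) S (C n)"
  proof (cases n)
    case 0
    interpret left_module S "C 0" by (rule mod)
    show ?thesis unfolding 0 cycles_def by (rule submodule_intro) auto
  next
    case (Suc k)
    then show ?thesis using lmod_hom_kernel_submodule[OF mod mod d, of k] by (simp add: cycles_eq)
  qed
qed

lemma cochain_complex_submodules:
  assumes mod: "\<And>i. left_module S (C i)" and d: "\<And>i. d i \<in> lmod_hom S (C i) (C (Suc i))"
  shows "submodule (cocycles C d n) S (C n)" "submodule (coboundaries C d n) S (C n)"
proof -
  show "submodule (cocycles C d n) S (C n)"
    unfolding cocycles_eq by (rule lmod_hom_kernel_submodule[OF mod mod d])
  show "submodule (coboundaries C d n) S (C n)"
  proof (cases n)
    case 0
    interpret left_module S "C 0" by (rule mod)
    show ?thesis unfolding 0 coboundaries_def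
      by (rule submodule_intro) (auto simp: smult_r_null)
  next
    case (Suc k)
    then show ?thesis
      using lmod_hom_image_submodule[OF mod mod d, of k] by (simp add: coboundaries_def)
  qed
qed


section \<open>Opposite rings and bimodules\<close>

lemma opp_simps [simp]:
  "carrier (opp R) = carrier R" "\<zero>\<^bsub>opp R\<^esub> = \<zero>\<^bsub>R\<^esub>" "\<one>\<^bsub>opp R\<^esub> = \<one>\<^bsub>R\<^esub>"
  "a \<oplus>\<^bsub>opp R\<^esub> b = a \<oplus>\<^bsub>R\<^esub> b" "a \<otimes>\<^bsub>opp R\<^esub> b = b \<otimes>\<^bsub>R\<^esub> a"
  by (simp_all add: opp_def)

lemma opp_opp [simp]: "opp (opp R) = R"
  by (simp add: opp_def)

lemma ring_opp:
  assumes "ring R" shows "ring (opp R)"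
proof -
  interpret ring R by fact
  show ?thesis
  proof (rule ringI)
    show "abelian_group (opp R)"
      by (rule abelian_groupI) (auto simp: a_ac intro!: bexI[of _ "\<ominus>\<^bsub>R\<^esub> _"] r_neg)
    show "monoid (opp R)" by unfold_locales (auto simp: m_assoc)
  qed (auto simp: l_distr r_distr)
qed

lemma lmod_hom_opp [simp]: "lmod_hom (opp R) M N = lmod_hom R M N"
  by (simp add: lmod_hom_def)

lemma hom_group_opp [simp]: "hom_group (opp R) M N = hom_group R M N"
  by (simp add: hom_group_def)

lemma flip_simps [simp]:
  "carrier (flip L) = carrier L" "\<zero>\<^bsub>flip L\<^esub> = \<zero>\<^bsub>L\<^esub>" "x \<oplus>\<^bsub>flip L\<^esub> y = x \<oplus>\<^bsub>L\<^esub> y"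
  "s \<odot>\<^bsub>flip L\<^esub> x = rsmult L x s" "rsmult (flip L) x r = r \<odot>\<^bsub>L\<^esub> x"
  by (simp_all add: flip_def)

lemma flip_flip [simp]: "flip (flip L) = (L :: ('r, 's, 'l) bimodule)"
  by (simp add: flip_def)

lemma bimodule_flip: "bimodule R S L \<Longrightarrow> bimodule (opp S) (opp R) (flip L)"
  unfolding bimodule_def by auto

lemma
  assumes "bimodule R S L"
  shows bimodule_left: "left_module R L"
    and bimodule_right: "right_module S (flip L)"
    and bimodule_comm: "\<And>r s x. \<lbrakk>r \<in> carrier R; s \<in> carrier S; x \<in> carrier L\<rbrakk> \<Longrightarrow>
        rsmult L (r \<odot>\<^bsub>L\<^esub> x) s = r \<odot>\<^bsub>L\<^esub> rsmult L x s"
  using assms by (auto simp: bimodule_def)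

lemma right_module_ring: "right_module R M \<Longrightarrow> ring R"
  using ring_opp[of "opp R"] by (simp add: left_module_def)


section \<open>Homomorphism groups\<close>

lemma hom_group_simps [simp]:
  "carrier (hom_group R M N) = lmod_hom R M N \<inter> extensional (carrier M)"
  "\<zero>\<^bsub>hom_group R M N\<^esub> = (\<lambda>x\<in>carrier M. \<zero>\<^bsub>N\<^esub>)"
  "f \<oplus>\<^bsub>hom_group R M N\<^esub> g = (\<lambda>x\<in>carrier M. f x \<oplus>\<^bsub>N\<^esub> g x)"
  by (simp_all add: hom_group_def)

lemma hom_mod_simps [simp]:
  "carrier (hom_mod R L N) = lmod_hom R L N \<inter> extensional (carrier L)"
  "\<zero>\<^bsub>hom_mod R L N\<^esub> = (\<lambda>x\<in>carrier L. \<zero>\<^bsub>N\<^esub>)"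
  "f \<oplus>\<^bsub>hom_mod R L N\<^esub> g = (\<lambda>x\<in>carrier L. f x \<oplus>\<^bsub>N\<^esub> g x)"
  "s \<odot>\<^bsub>hom_mod R L N\<^esub> f = (\<lambda>x\<in>carrier L. f (rsmult L x s))"
  by (simp_all add: hom_mod_def ring.defs module.defs hom_group_def)

lemma lmod_hom_pointwise_add:
  assumes "left_module R M" "left_module R N" "f \<in> lmod_hom R M N" "g \<in> lmod_hom R M N"
  shows "(\<lambda>x. f x \<oplus>\<^bsub>N\<^esub> g x) \<in> lmod_hom R M N"
proof -
  interpret M: left_module R M by fact
  interpret N: left_module R N by fact
  note f = lmod_hom_closed[OF assms(3)] and g = lmod_hom_closed[OF assms(4)]
  show ?thesis
    by (rule lmod_homI)
       (use f g in \<open>auto simp: lmod_hom_add[OF assms(3)] lmod_hom_add[OF assms(4)]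
         lmod_hom_smult[OF assms(3)] lmod_hom_smult[OF assms(4)] N.smult_r_distr N.M.a_ac\<close>)
qed

lemma lmod_hom_pointwise_inv:
  assumes "left_module R M" "left_module R N" "f \<in> lmod_hom R M N"
  shows "(\<lambda>x. \<ominus>\<^bsub>N\<^esub> f x) \<in> lmod_hom R M N"
proof -
  interpret M: left_module R M by fact
  interpret N: left_module R N by fact
  note f = lmod_hom_closed[OF assms(3)]
  have "\<ominus>\<^bsub>N\<^esub> (r \<odot>\<^bsub>N\<^esub> y) = r \<odot>\<^bsub>N\<^esub> (\<ominus>\<^bsub>N\<^esub> y)" if "r \<in> carrier R" "y \<in> carrier N" for r y
    using N.smult_r_distr[of r "\<ominus>\<^bsub>N\<^esub> y" y] that
    by (intro N.M.minus_equality) (auto simp: N.M.l_neg N.smult_r_null)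
  then show ?thesis
    by (intro lmod_homI)
       (use f in \<open>auto simp: lmod_hom_add[OF assms(3)] lmod_hom_smult[OF assms(3)] N.M.minus_add\<close>)
qed

lemma lmod_hom_pointwise_minus:
  assumes "left_module R M" "left_module R N" "f \<in> lmod_hom R M N" "g \<in> lmod_hom R M N"
  shows "(\<lambda>x. f x \<ominus>\<^bsub>N\<^esub> g x) \<in> lmod_hom R M N"
  unfolding a_minus_def
  by (rule lmod_hom_pointwise_add[OF assms(1,2,3) lmod_hom_pointwise_inv[OF assms(1,2,4)]])

lemma lmod_hom_const_zero:
  assumes "left_module R M" "left_module R N"
  shows "(\<lambda>x. \<zero>\<^bsub>N\<^esub>) \<in> lmod_hom R M N"
proof -
  interpret M: left_module R M by fact
  interpret N: left_module R N by fact
  show ?thesis by (rule lmod_homI) (auto simp: N.smult_r_null)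
qed

lemma hom_group_inv_ex:
  assumes "left_module R M" "left_module R N" "f \<in> lmod_hom R M N"
  shows "restrict (\<lambda>x. \<ominus>\<^bsub>N\<^esub> f x) (carrier M) \<in> lmod_hom R M N \<inter> extensional (carrier M)"
    and "(\<lambda>x\<in>carrier M. (\<lambda>x\<in>carrier M. \<ominus>\<^bsub>N\<^esub> f x) x \<oplus>\<^bsub>N\<^esub> f x) = (\<lambda>x\<in>carrier M. \<zero>\<^bsub>N\<^esub>)"
proof -
  interpret N: left_module R N by fact
  show "restrict (\<lambda>x. \<ominus>\<^bsub>N\<^esub> f x) (carrier M) \<in> lmod_hom R M N \<inter> extensional (carrier M)"
    using lmod_hom_restrict[OF assms(1) lmod_hom_pointwise_inv[OF assms]] by simp
  show "(\<lambda>x\<in>carrier M. (\<lambda>x\<in>carrier M. \<ominus>\<^bsub>N\<^esub> f x) x \<oplus>\<^bsub>N\<^esub> f x) = (\<lambda>x\<in>carrier M. \<zero>\<^bsub>N\<^esub>)"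
    using lmod_hom_closed[OF assms(3)] by (auto simp: N.M.l_neg intro: restrict_ext)
qed

lemma hom_group_abelian_group:
  assumes "left_module R M" "left_module R N"
  shows "abelian_group (hom_group R M N)"
proof -
  interpret M: left_module R M by fact
  interpret N: left_module R N by fact
  show ?thesis
  proof (rule abelian_groupI)
    fix f assume "f \<in> carrier (hom_group R M N)"
    then have f: "f \<in> lmod_hom R M N" by simp
    show "\<exists>g\<in>carrier (hom_group R M N). g \<oplus>\<^bsub>hom_group R M N\<^esub> f = \<zero>\<^bsub>hom_group R M N\<^esub>"
      using hom_group_inv_ex[OF assms f]
      by (intro bexI[of _ "restrict (\<lambda>x. \<ominus>\<^bsub>N\<^esub> f x) (carrier M)"])
         (simp_all only: hom_group_simps)
  qed (use lmod_hom_restrict[OF assms(1) lmod_hom_pointwise_add[OF assms]]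
      lmod_hom_restrict[OF assms(1) lmod_hom_const_zero[OF assms]] in
      \<open>auto simp: extensional_def fun_eq_iff N.M.a_ac lmod_hom_closed restrict_def\<close>)
qed

lemma hom_group_minus:
  assumes "left_module R M" "left_module R N"
    and "f \<in> carrier (hom_group R M N)" "g \<in> carrier (hom_group R M N)"
  shows "f \<ominus>\<^bsub>hom_group R M N\<^esub> g = (\<lambda>x\<in>carrier M. f x \<ominus>\<^bsub>N\<^esub> g x)"
proof -
  interpret H: abelian_group "hom_group R M N" by (rule hom_group_abelian_group) fact+
  have g: "g \<in> lmod_hom R M N" using assms(4) by simp
  have "\<ominus>\<^bsub>hom_group R M N\<^esub> g = (\<lambda>x\<in>carrier M. \<ominus>\<^bsub>N\<^esub> g x)"
    using hom_group_inv_ex[OF assms(1,2) g] assms(4) by (intro H.minus_equality) simp_all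
  then show ?thesis by (simp add: a_minus_def cong: restrict_cong)
qed

lemma hom_mod_left_module:
  assumes "bimodule R S L" "left_module R N"
  shows "left_module S (hom_mod R L N)"
proof -
  note L = bimodule_left[OF assms(1)]
  interpret L: left_module R L by fact
  interpret L': left_module "opp S" "flip L" by (rule bimodule_right[OF assms(1)])
  interpret N: left_module R N by fact
  interpret S: ring S using right_module_ring[OF bimodule_right[OF assms(1)]] .
  have rs: "rsmult L x s \<in> carrier L" if "x \<in> carrier L" "s \<in> carrier S" for x s
    using L'.smult_closed that by simp
  show ?thesis
  proof (rule left_moduleI)
    show "ring S" by (rule S.ring_axioms)
    have "abelian_group (hom_group R L N)" by (rule hom_group_abelian_group) fact+
    from abelian_group_surj_image[OF this, of "hom_mod R L N" "\<lambda>f. f"]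
    show "abelian_group (hom_mod R L N)" by simp
  next
    fix s f assume s: "s \<in> carrier S" and "f \<in> carrier (hom_mod R L N)"
    then have f: "f \<in> lmod_hom R L N" by simp
    have "(\<lambda>x. rsmult L x s) \<in> lmod_hom R L L"
      using L'.smult_r_distr[of s] s rs bimodule_comm[OF assms(1)] by (intro lmod_homI) auto
    from lmod_hom_restrict[OF L lmod_hom_comp[OF this f]]
    show "s \<odot>\<^bsub>hom_mod R L N\<^esub> f \<in> carrier (hom_mod R L N)" by simp
  next
    fix s t f assume st: "s \<in> carrier S" "t \<in> carrier S" and "f \<in> carrier (hom_mod R L N)"
    then have f: "f \<in> lmod_hom R L N" by simp
    show "(s \<oplus>\<^bsub>S\<^esub> t) \<odot>\<^bsub>hom_mod R L N\<^esub> f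
        = s \<odot>\<^bsub>hom_mod R L N\<^esub> f \<oplus>\<^bsub>hom_mod R L N\<^esub> t \<odot>\<^bsub>hom_mod R L N\<^esub> f"
      using L'.smult_l_distr[of s t] st rs lmod_hom_add[OF f] by (auto intro!: restrict_ext)
    show "(s \<otimes>\<^bsub>S\<^esub> t) \<odot>\<^bsub>hom_mod R L N\<^esub> f = s \<odot>\<^bsub>hom_mod R L N\<^esub> (t \<odot>\<^bsub>hom_mod R L N\<^esub> f)"
      using L'.smult_assoc1[of t s] st rs by (auto intro!: restrict_ext)
  next
    fix s f g assume s: "s \<in> carrier S"
    show "s \<odot>\<^bsub>hom_mod R L N\<^esub> (f \<oplus>\<^bsub>hom_mod R L N\<^esub> g)
        = s \<odot>\<^bsub>hom_mod R L N\<^esub> f \<oplus>\<^bsub>hom_mod R L N\<^esub> s \<odot>\<^bsub>hom_mod R L N\<^esub> g"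
      using s rs by (auto intro!: restrict_ext)
  next
    fix f assume "f \<in> carrier (hom_mod R L N)"
    then show "\<one>\<^bsub>S\<^esub> \<odot>\<^bsub>hom_mod R L N\<^esub> f = f"
      using L'.smult_one by (auto simp: fun_eq_iff extensional_def restrict_def)
  qed
qed

lemma hom_group_compose:
  assumes "left_module R M" "left_module R A" "left_module R B" "g \<in> lmod_hom R A B"
  shows "abelian_group_hom (hom_group R M A) (hom_group R M B) (compose (carrier M) g)"
proof (rule abelian_group_hom_intro)
  show "abelian_group (hom_group R M A)" "abelian_group (hom_group R M B)"
    by (rule hom_group_abelian_group; fact)+
  fix f assume f: "f \<in> carrier (hom_group R M A)"
  then show "compose (carrier M) g f \<in> carrier (hom_group R M B)"
    using lmod_hom_restrict[OF assms(1) lmod_hom_comp[OF _ assms(4)]] by (simp add: compose_def)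
  fix f' assume f': "f' \<in> carrier (hom_group R M A)"
  show "compose (carrier M) g (f \<oplus>\<^bsub>hom_group R M A\<^esub> f')
      = compose (carrier M) g f \<oplus>\<^bsub>hom_group R M B\<^esub> compose (carrier M) g f'"
    using f f' lmod_hom_closed[of _ R M A]
    by (auto simp: compose_def lmod_hom_add[OF assms(4)] intro!: restrict_ext)
qed

lemma hom_mod_compose:
  assumes "bimodule R S L" "left_module R A" "left_module R B" "g \<in> lmod_hom R A B"
  shows "compose (carrier L) g \<in> lmod_hom S (hom_mod R L A) (hom_mod R L B)"
proof -
  note L = bimodule_left[OF assms(1)]
  interpret L': left_module "opp S" "flip L" by (rule bimodule_right[OF assms(1)])
  interpret abelian_group_hom "hom_group R L A" "hom_group R L B" "compose (carrier L) g"
    by (rule hom_group_compose[OF L assms(2-4)])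
  show ?thesis
  proof (rule lmod_homI)
    fix s f assume "s \<in> carrier S" "f \<in> carrier (hom_mod R L A)"
    then show "compose (carrier L) g (s \<odot>\<^bsub>hom_mod R L A\<^esub> f)
        = s \<odot>\<^bsub>hom_mod R L B\<^esub> compose (carrier L) g f"
      using L'.smult_closed[of s] by (auto simp: compose_def intro!: restrict_ext)
  qed (use hom_closed hom_add in auto)
qed


section \<open>Comparison of left resolutions\<close>

abbreviation "hom_cycles R T W n \<equiv>
  cycles (\<lambda>i. hom_group R T (obj W i)) (\<lambda>i. compose (carrier T) (diff W i)) n"

abbreviation "hom_boundaries R T W n \<equiv>
  boundaries (\<lambda>i. hom_group R T (obj W i)) (\<lambda>i. compose (carrier T) (diff W i)) n"

lemma compose_eq_restrictD: "\<lbrakk>restrict f Y = compose Y a g; y \<in> Y\<rbrakk> \<Longrightarrow> a (g y) = f y"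
  by (metis compose_eq restrict_apply')

lemma exact_at_lift:
  assumes "exact_at (hom_group R Y A) (compose (carrier Y) a) (hom_group R Y B)
      (compose (carrier Y) b) (hom_group R Y C)"
    and Y: "left_module R Y" and f: "f \<in> lmod_hom R Y B"
    and bf: "\<And>y. y \<in> carrier Y \<Longrightarrow> b (f y) = \<zero>\<^bsub>C\<^esub>"
  obtains g where "g \<in> lmod_hom R Y A" "\<And>y. y \<in> carrier Y \<Longrightarrow> a (g y) = f y"
proof -
  have "restrict f (carrier Y) \<in> a_kernel (hom_group R Y B) (hom_group R Y C) (compose (carrier Y) b)"
    using lmod_hom_restrict[OF Y f] bf by (auto simp: a_kernel_def' compose_def intro!: restrict_ext)
  then have "restrict f (carrier Y) \<in> compose (carrier Y) a ` carrier (hom_group R Y A)"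
    using assms(1) by (simp only: exact_at_def)
  then obtain g where g: "g \<in> lmod_hom R Y A" "restrict f (carrier Y) = compose (carrier Y) a g"
    by auto
  show thesis
    using that[OF g(1)] compose_eq_restrictD[OF g(2)] by blast
qed

lemma exact_at_extend:
  assumes "exact_at (hom_group R C Y) (\<lambda>f. compose (carrier B) f c) (hom_group R B Y)
      (\<lambda>f. compose (carrier A) f a) (hom_group R A Y)"
    and B: "left_module R B" and f: "f \<in> lmod_hom R B Y"
    and a: "a \<in> lmod_hom R A B"
    and fa: "\<And>x. x \<in> carrier A \<Longrightarrow> f (a x) = \<zero>\<^bsub>Y\<^esub>"
  obtains g where "g \<in> lmod_hom R C Y" "\<And>x. x \<in> carrier B \<Longrightarrow> g (c x) = f x"
proof -
  have "restrict f (carrier B) \<in> a_kernel (hom_group R B Y) (hom_group R A Y) (\<lambda>f. compose (carrier A) f a)"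
    using lmod_hom_restrict[OF B f] fa lmod_hom_closed[OF a]
    by (auto simp: a_kernel_def' compose_def intro!: restrict_ext)
  then have "restrict f (carrier B) \<in> (\<lambda>f. compose (carrier B) f c) ` carrier (hom_group R C Y)"
    using assms(1) by (simp only: exact_at_def)
  then obtain g where g: "g \<in> lmod_hom R C Y" "restrict f (carrier B) = compose (carrier B) g c"
    by auto
  show thesis
    using that[OF g(1)] compose_eq_restrictD[OF g(2)] by blast
qed

text \<open>The class \<open>\<C>\<close> may be any class of modules: the exactness that defines a resolution is tested on
  modules of \<open>\<C>\<close>, and in a comparison it is applied to the terms of the other resolution.\<close>

locale left_res =
  fixes R :: "('r, 'x) ring_scheme" and \<C> :: "('r, 'u) module set"
    and N :: "('r, 'n) module" and W :: "('r, 'u, 'u \<Rightarrow> 'n) aug_complex"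
  assumes modules: "M \<in> \<C> \<Longrightarrow> left_module R M"
    and N: "left_module R N"
    and res: "left_resolution R \<C> N W"
begin

lemma in_class: "obj W n \<in> \<C>"
  and obj_module: "left_module R (obj W n)"
  and diff_hom: "diff W n \<in> lmod_hom R (obj W (Suc n)) (obj W n)"
  and aug_hom: "aug W \<in> lmod_hom R (obj W 0) N"
  and aug_diff: "x \<in> carrier (obj W (Suc 0)) \<Longrightarrow> aug W (diff W 0 x) = \<zero>\<^bsub>N\<^esub>"
  and diff_diff: "x \<in> carrier (obj W (Suc (Suc n))) \<Longrightarrow> diff W n (diff W (Suc n) x) = \<zero>\<^bsub>obj W n\<^esub>"
  using res modules unfolding left_resolution_def by auto

lemma lift_aug:
  assumes "Y \<in> \<C>" "f \<in> lmod_hom R Y N"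
  obtains g where "g \<in> lmod_hom R Y (obj W 0)" "\<And>y. y \<in> carrier Y \<Longrightarrow> aug W (g y) = f y"
proof -
  have "restrict f (carrier Y) \<in> carrier (hom_group R Y N)"
    using lmod_hom_restrict[OF modules[OF assms(1)] assms(2)] by simp
  then obtain g where g: "g \<in> lmod_hom R Y (obj W 0)"
      "restrict f (carrier Y) = compose (carrier Y) (aug W) g"
    using res assms(1) unfolding left_resolution_def
    by (metis (no_types, lifting) IntD1 hom_group_simps(1) imageE)
  show thesis
    using that[OF g(1)] compose_eq_restrictD[OF g(2)] by blast
qed

text \<open>The augmentation counts as the differential out of degree \<open>0\<close>; with this convention
  exactness has the same form in all degrees.\<close>

definition killed :: "nat \<Rightarrow> ('u \<Rightarrow> 'u) \<Rightarrow> 'u set \<Rightarrow> bool" where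
  "killed n f Y \<longleftrightarrow> (case n of 0 \<Rightarrow> \<forall>y\<in>Y. aug W (f y) = \<zero>\<^bsub>N\<^esub>
     | Suc k \<Rightarrow> \<forall>y\<in>Y. diff W k (f y) = \<zero>\<^bsub>obj W k\<^esub>)"

lemma lift_diff:
  assumes "Y \<in> \<C>" "f \<in> lmod_hom R Y (obj W n)" "killed n f (carrier Y)"
  obtains g where "g \<in> lmod_hom R Y (obj W (Suc n))" "\<And>y. y \<in> carrier Y \<Longrightarrow> diff W n (g y) = f y"
proof (cases n)
  case 0
  have "exact_at (hom_group R Y (obj W (Suc 0))) (compose (carrier Y) (diff W 0))
     (hom_group R Y (obj W 0)) (compose (carrier Y) (aug W)) (hom_group R Y N)"
    using res assms(1) unfolding left_resolution_def by auto
  from exact_at_lift[OF this modules[OF assms(1)]] show thesis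
    using assms that unfolding 0 killed_def by auto
next
  case (Suc k)
  have "exact_at (hom_group R Y (obj W (Suc (Suc k)))) (compose (carrier Y) (diff W (Suc k)))
     (hom_group R Y (obj W (Suc k))) (compose (carrier Y) (diff W k)) (hom_group R Y (obj W k))"
    using res assms(1) unfolding left_resolution_def by auto
  from exact_at_lift[OF this modules[OF assms(1)]] show thesis
    using assms that unfolding Suc killed_def by auto
qed

text \<open>A chain endomorphism over the zero map of \<open>N\<close> is null-homotopic. Its effect on homology depends
  on cycles only, and there the homotopy \<open>e = d h + h d\<close> reads \<open>e = d h\<close>. This weaker form is also
  what the induction needs: \<open>d (e - h d) = 0\<close>, because \<open>d x\<close> is a cycle.\<close>

lemma null_homotopic:
  assumes e: "\<And>n. e n \<in> lmod_hom R (obj W n) (obj W n)"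
    and aug_e: "\<And>x. x \<in> carrier (obj W 0) \<Longrightarrow> aug W (e 0 x) = \<zero>\<^bsub>N\<^esub>"
    and chain: "\<And>n x. x \<in> carrier (obj W (Suc n)) \<Longrightarrow> diff W n (e (Suc n) x) = e n (diff W n x)"
  shows "\<exists>h\<in>lmod_hom R (obj W n) (obj W (Suc n)). \<forall>x\<in>cycles (obj W) (diff W) n. diff W n (h x) = e n x"
proof (induction n)
  case 0
  have "killed 0 (e 0) (carrier (obj W 0))" using aug_e by (simp add: killed_def)
  from lift_diff[OF in_class e this] show ?case by (metis cycles_def old.nat.simps(4))
next
  case (Suc n)
  then obtain h where h: "h \<in> lmod_hom R (obj W n) (obj W (Suc n))"
    and he: "\<And>x. x \<in> cycles (obj W) (diff W) n \<Longrightarrow> diff W n (h x) = e n x" by auto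
  interpret d: abelian_group_hom "obj W (Suc n)" "obj W n" "diff W n"
    by (rule lmod_hom_abelian_group_hom[OF obj_module obj_module diff_hom])
  let ?f = "\<lambda>x. e (Suc n) x \<ominus>\<^bsub>obj W (Suc n)\<^esub> h (diff W n x)"
  have hd: "(\<lambda>x. h (diff W n x)) \<in> lmod_hom R (obj W (Suc n)) (obj W (Suc n))"
    by (rule lmod_hom_comp[OF diff_hom h])
  have f: "?f \<in> lmod_hom R (obj W (Suc n)) (obj W (Suc n))"
    by (rule lmod_hom_pointwise_minus[OF obj_module obj_module e hd])
  have "diff W n (?f x) = \<zero>\<^bsub>obj W n\<^esub>" if x: "x \<in> carrier (obj W (Suc n))" for x
  proof -
    have "diff W n x \<in> cycles (obj W) (diff W) n"
      using x diff_diff by (auto simp: cycles_eq)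
    then have "diff W n (h (diff W n x)) = diff W n (e (Suc n) x)"
      using he chain[OF x] by simp
    then show ?thesis
      using abelian_group_hom_minus[OF d.abelian_group_hom_axioms lmod_hom_closed[OF e x]
          lmod_hom_closed[OF hd x]] lmod_hom_closed[OF e x]
      by (simp add: a_minus_def d.H.r_neg)
  qed
  then have "killed (Suc n) ?f (carrier (obj W (Suc n)))" by (simp add: killed_def)
  from lift_diff[OF in_class f this] obtain g
    where g: "g \<in> lmod_hom R (obj W (Suc n)) (obj W (Suc (Suc n)))"
      and dg: "\<And>x. x \<in> carrier (obj W (Suc n)) \<Longrightarrow> diff W (Suc n) (g x) = ?f x" by blast
  have "diff W (Suc n) (g x) = e (Suc n) x" if "x \<in> cycles (obj W) (diff W) (Suc n)" for x
    using dg[of x] that lmod_hom_closed[OF e, of x "Suc n"]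
    by (simp add: cycles_eq lmod_hom_zero[OF obj_module obj_module h]
        abelian_group_minus_zero[OF d.G.abelian_group_axioms])
  then show ?case using g by blast
qed

end

text \<open>The recursion carries along that \<open>u\<^sub>n d\<close> is killed by the next differential, since this is the
  condition for lifting it to \<open>u\<^sub>n\<^sub>+\<^sub>1\<close>.\<close>

lemma left_resolution_chain_map:
  assumes W: "left_res R \<C> N W" and W': "left_res R \<C> N W'"
  obtains u where "\<And>n. u n \<in> lmod_hom R (obj W n) (obj W' n)"
    "\<And>x. x \<in> carrier (obj W 0) \<Longrightarrow> aug W' (u 0 x) = aug W x"
    "\<And>n x. x \<in> carrier (obj W (Suc n)) \<Longrightarrow> diff W' n (u (Suc n) x) = u n (diff W n x)"
proof -
  interpret W: left_res R \<C> N W by fact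
  interpret W': left_res R \<C> N W' by fact
  define good where "good n f \<longleftrightarrow> f \<in> lmod_hom R (obj W n) (obj W' n) \<and>
    (n = 0 \<longrightarrow> (\<forall>x\<in>carrier (obj W 0). aug W' (f x) = aug W x)) \<and>
    W'.killed n (\<lambda>x. f (diff W n x)) (carrier (obj W (Suc n)))" for n f
  have "\<exists>u. \<forall>n. good n (u n) \<and>
      (\<forall>x\<in>carrier (obj W (Suc n)). diff W' n (u (Suc n) x) = u n (diff W n x))"
  proof (rule dependent_nat_choice)
    obtain g where "g \<in> lmod_hom R (obj W 0) (obj W' 0)"
      "\<And>y. y \<in> carrier (obj W 0) \<Longrightarrow> aug W' (g y) = aug W y"
      using W'.lift_aug[OF W.in_class W.aug_hom] by blast
    then show "\<exists>f. good 0 f"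
      using W.aug_diff lmod_hom_closed[OF W.diff_hom] by (auto simp: good_def W'.killed_def)
  next
    fix f n assume f: "good n f"
    then have fh: "f \<in> lmod_hom R (obj W n) (obj W' n)" by (simp add: good_def)
    have "W'.killed n (\<lambda>x. f (diff W n x)) (carrier (obj W (Suc n)))" using f by (simp add: good_def)
    from W'.lift_diff[OF W.in_class lmod_hom_comp[OF W.diff_hom fh] this]
    obtain g where g: "g \<in> lmod_hom R (obj W (Suc n)) (obj W' (Suc n))"
      and dg: "\<And>y. y \<in> carrier (obj W (Suc n)) \<Longrightarrow> diff W' n (g y) = f (diff W n y)" by blast
    have "good (Suc n) g"
      using g dg lmod_hom_closed[OF W.diff_hom] W.diff_diff
        lmod_hom_zero[OF W.obj_module W'.obj_module fh]
      by (auto simp: good_def W'.killed_def)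
    then show "\<exists>g. good (Suc n) g \<and> (\<forall>x\<in>carrier (obj W (Suc n)). diff W' n (g x) = f (diff W n x))"
      using dg by blast
  qed
  then show thesis using that by (auto simp: good_def)
qed

context left_res
begin

lemma hom_complex:
  assumes "left_module R T"
  shows "abelian_group_hom (hom_group R T (obj W (Suc i))) (hom_group R T (obj W i))
      (compose (carrier T) (diff W i))"
    and "f \<in> carrier (hom_group R T (obj W (Suc (Suc i)))) \<Longrightarrow>
      compose (carrier T) (diff W i) (compose (carrier T) (diff W (Suc i)) f) = \<zero>\<^bsub>hom_group R T (obj W i)\<^esub>"
proof -
  show "abelian_group_hom (hom_group R T (obj W (Suc i))) (hom_group R T (obj W i))
      (compose (carrier T) (diff W i))"
    by (rule hom_group_compose[OF assms obj_module obj_module diff_hom])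
  assume "f \<in> carrier (hom_group R T (obj W (Suc (Suc i))))"
  then have "f \<in> lmod_hom R T (obj W (Suc (Suc i)))" by simp
  from lmod_hom_closed[OF this]
  show "compose (carrier T) (diff W i) (compose (carrier T) (diff W (Suc i)) f)
      = \<zero>\<^bsub>hom_group R T (obj W i)\<^esub>"
    by (auto simp: compose_def diff_diff intro!: restrict_ext)
qed

lemma hom_cycles_iff:
  "f \<in> hom_cycles R T W n \<longleftrightarrow>
     f \<in> lmod_hom R T (obj W n) \<and> f \<in> extensional (carrier T) \<and>
     (\<forall>t\<in>carrier T. f t \<in> cycles (obj W) (diff W) n)"
proof -
  have "compose (carrier T) (diff W k) f = (\<lambda>t\<in>carrier T. \<zero>\<^bsub>obj W k\<^esub>) \<longleftrightarrow>
      (\<forall>t\<in>carrier T. diff W k (f t) = \<zero>\<^bsub>obj W k\<^esub>)" for k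
    by (auto simp: compose_def restrict_def fun_eq_iff)
  then show ?thesis by (auto simp: cycles_eq lmod_hom_closed)
qed

lemma hom_boundaries_iff:
  assumes "left_module R T"
  shows "f \<in> hom_boundaries R T W n \<longleftrightarrow>
     f \<in> extensional (carrier T) \<and>
     (\<exists>g\<in>lmod_hom R T (obj W (Suc n)). \<forall>t\<in>carrier T. f t = diff W n (g t))"
proof
  assume "f \<in> extensional (carrier T) \<and>
     (\<exists>g\<in>lmod_hom R T (obj W (Suc n)). \<forall>t\<in>carrier T. f t = diff W n (g t))"
  then obtain g where f: "f \<in> extensional (carrier T)" and g: "g \<in> lmod_hom R T (obj W (Suc n))"
    and fg: "\<And>t. t \<in> carrier T \<Longrightarrow> f t = diff W n (g t)" by auto
  have "f = compose (carrier T) (diff W n) (restrict g (carrier T))"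
    using f fg by (auto simp: compose_def extensional_def fun_eq_iff)
  then show "f \<in> hom_boundaries R T W n"
    using lmod_hom_restrict[OF assms g] by (auto simp: boundaries_def)
qed (auto simp: boundaries_def compose_def)

end

text \<open>Chain maps over the identity of \<open>N\<close> in both directions compose to endomorphisms that differ
  from the identity by a null-homotopic one.\<close>

lemma rel_Ext_resolution_independent:
  fixes W W' :: "('r, 'u, 'u \<Rightarrow> 'n) aug_complex"
  assumes W: "left_res R \<C> N W" and W': "left_res R \<C> N W'" and T: "left_module R T"
  shows "add_monoid (rel_Ext R T W n) \<cong> add_monoid (rel_Ext R T W' n)"
proof -
  have half: "f \<ominus>\<^bsub>hom_group R T (obj A n)\<^esub> compose (carrier T) (v n) (compose (carrier T) (u n) f)
      \<in> hom_boundaries R T A n"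
    if A: "left_res R \<C> N A" and B: "left_res R \<C> N B"
      and u: "\<And>n. u n \<in> lmod_hom R (obj A n) (obj B n)"
      and au: "\<And>x. x \<in> carrier (obj A 0) \<Longrightarrow> aug B (u 0 x) = aug A x"
      and du: "\<And>n x. x \<in> carrier (obj A (Suc n)) \<Longrightarrow> diff B n (u (Suc n) x) = u n (diff A n x)"
      and v: "\<And>n. v n \<in> lmod_hom R (obj B n) (obj A n)"
      and av: "\<And>x. x \<in> carrier (obj B 0) \<Longrightarrow> aug A (v 0 x) = aug B x"
      and dv: "\<And>n x. x \<in> carrier (obj B (Suc n)) \<Longrightarrow> diff A n (v (Suc n) x) = v n (diff B n x)"
      and f: "f \<in> hom_cycles R T A n"
    for A B :: "('r, 'u, 'u \<Rightarrow> 'n) aug_complex" and u v f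
  proof -
    interpret A: left_res R \<C> N A by fact
    interpret B: left_res R \<C> N B by fact
    interpret N: left_module R N by (rule A.N)
    define e where "e k x = x \<ominus>\<^bsub>obj A k\<^esub> v k (u k x)" for k x
    note vu = lmod_hom_comp[OF u v]
    have e: "e k \<in> lmod_hom R (obj A k) (obj A k)" for k
      unfolding e_def[abs_def]
      by (rule lmod_hom_pointwise_minus[OF A.obj_module A.obj_module lmod_hom_id vu])
    have "aug A (e 0 x) = \<zero>\<^bsub>N\<^esub>" if x: "x \<in> carrier (obj A 0)" for x
      using abelian_group_hom_minus[OF lmod_hom_abelian_group_hom[OF A.obj_module A.N A.aug_hom]
          x lmod_hom_closed[OF vu x]] lmod_hom_closed[OF u x] lmod_hom_closed[OF A.aug_hom x]
      by (simp add: e_def au x av a_minus_def N.M.r_neg)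
    moreover have "diff A k (e (Suc k) x) = e k (diff A k x)" if x: "x \<in> carrier (obj A (Suc k))" for k x
      using abelian_group_hom_minus[OF lmod_hom_abelian_group_hom[OF A.obj_module A.obj_module A.diff_hom]
          x lmod_hom_closed[OF vu x]] lmod_hom_closed[OF u x]
      by (simp add: e_def dv du x)
    ultimately obtain h where h: "h \<in> lmod_hom R (obj A n) (obj A (Suc n))"
        "\<And>x. x \<in> cycles (obj A) (diff A) n \<Longrightarrow> diff A n (h x) = e n x"
      using A.null_homotopic[OF e] by metis
    have f': "f \<in> lmod_hom R T (obj A n)" "f \<in> extensional (carrier T)"
        "\<And>t. t \<in> carrier T \<Longrightarrow> f t \<in> cycles (obj A) (diff A) n"
      using f unfolding A.hom_cycles_iff by auto
    have vuf: "compose (carrier T) (v n) (compose (carrier T) (u n) f) \<in> carrier (hom_group R T (obj A n))"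
      using lmod_hom_restrict[OF T lmod_hom_comp[OF f'(1) vu]]
      by (simp add: compose_def cong: restrict_cong)
    show ?thesis
      unfolding A.hom_boundaries_iff[OF T]
    proof (intro conjI bexI[of _ "\<lambda>t. h (f t)"] ballI)
      show "(\<lambda>t. h (f t)) \<in> lmod_hom R T (obj A (Suc n))" by (rule lmod_hom_comp[OF f'(1) h(1)])
    qed (use f' vuf in \<open>simp_all add: hom_group_minus[OF T A.obj_module] compose_def h(2) e_def\<close>)
  qed
  interpret W: left_res R \<C> N W by fact
  interpret W': left_res R \<C> N W' by fact
  obtain u where u: "\<And>n. u n \<in> lmod_hom R (obj W n) (obj W' n)"
    "\<And>x. x \<in> carrier (obj W 0) \<Longrightarrow> aug W' (u 0 x) = aug W x"
    "\<And>n x. x \<in> carrier (obj W (Suc n)) \<Longrightarrow> diff W' n (u (Suc n) x) = u n (diff W n x)"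
    using left_resolution_chain_map[OF W W'] by blast
  obtain v where v: "\<And>n. v n \<in> lmod_hom R (obj W' n) (obj W n)"
    "\<And>x. x \<in> carrier (obj W' 0) \<Longrightarrow> aug W (v 0 x) = aug W' x"
    "\<And>n x. x \<in> carrier (obj W' (Suc n)) \<Longrightarrow> diff W n (v (Suc n) x) = v n (diff W' n x)"
    using left_resolution_chain_map[OF W' W] by blast
  have maps: "compose (carrier T) (u n) ` hom_cycles R T A n
        \<subseteq> hom_cycles R T B n"
      "compose (carrier T) (u n) ` hom_boundaries R T A n
        \<subseteq> hom_boundaries R T B n"
    if A: "left_res R \<C> N A" and B: "left_res R \<C> N B"
      and u: "\<And>n. u n \<in> lmod_hom R (obj A n) (obj B n)"
      and du: "\<And>n x. x \<in> carrier (obj A (Suc n)) \<Longrightarrow> diff B n (u (Suc n) x) = u n (diff A n x)"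
    for A B :: "('r, 'u, 'u \<Rightarrow> 'n) aug_complex" and u
  proof -
    interpret A: left_res R \<C> N A by fact
    interpret B: left_res R \<C> N B by fact
    have cyc: "u n x \<in> cycles (obj B) (diff B) n" if "x \<in> cycles (obj A) (diff A) n" for x
      using that du lmod_hom_closed[OF u] lmod_hom_zero[OF A.obj_module B.obj_module u]
      by (auto simp: cycles_eq)
    show "compose (carrier T) (u n) ` hom_cycles R T A n
        \<subseteq> hom_cycles R T B n"
    proof (rule image_subsetI)
      fix f assume "f \<in> hom_cycles R T A n"
      then have f: "f \<in> lmod_hom R T (obj A n)" "\<And>t. t \<in> carrier T \<Longrightarrow> f t \<in> cycles (obj A) (diff A) n"
        unfolding A.hom_cycles_iff by auto
      show "compose (carrier T) (u n) f \<in> hom_cycles R T B n"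
        unfolding B.hom_cycles_iff
        using lmod_hom_restrict[OF T lmod_hom_comp[OF f(1) u]] cyc[OF f(2)] by (simp add: compose_def)
    qed
    show "compose (carrier T) (u n) ` hom_boundaries R T A n
        \<subseteq> hom_boundaries R T B n"
    proof (rule image_subsetI)
      fix f assume "f \<in> hom_boundaries R T A n"
      then obtain g where g: "g \<in> lmod_hom R T (obj A (Suc n))" "\<And>t. t \<in> carrier T \<Longrightarrow> f t = diff A n (g t)"
        unfolding A.hom_boundaries_iff[OF T] by auto
      show "compose (carrier T) (u n) f \<in> hom_boundaries R T B n"
        unfolding B.hom_boundaries_iff[OF T]
        using lmod_hom_comp[OF g(1) u] g lmod_hom_closed[OF g(1)]
        by (intro conjI bexI[of _ "\<lambda>t. u (Suc n) (g t)"]) (simp_all add: compose_def du)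
    qed
  qed
  show ?thesis
    unfolding rel_Ext_def homology_def
    by (rule subquot_iso_mutual[where \<alpha> = "compose (carrier T) (u n)" and \<beta> = "compose (carrier T) (v n)"])
       (rule chain_complex_subgroups W.hom_complex[OF T] W'.hom_complex[OF T]
         hom_group_compose[OF T W.obj_module W'.obj_module u(1)]
         hom_group_compose[OF T W'.obj_module W.obj_module v(1)]
         maps[OF W W' u(1,3)] maps[OF W' W v(1,3)]
         half[OF W W' u v] half[OF W' W v u] | assumption)+
qed


section \<open>Tensor products\<close>

definition tensor_class :: "('s, 'x) ring_scheme \<Rightarrow> ('s, 'a, 'y) module_scheme \<Rightarrow>
    ('s, 'b, 'z) module_scheme \<Rightarrow> ('a \<times> 'b \<Rightarrow>\<^sub>0 int) \<Rightarrow> ('a \<times> 'b \<Rightarrow>\<^sub>0 int) set" where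
  "tensor_class S A B c =
     r_coset (free_Abelian_group (carrier A \<times> carrier B)) (tensor_null S A B) c"

definition pure_tensor :: "('s, 'x) ring_scheme \<Rightarrow> ('s, 'a, 'y) module_scheme \<Rightarrow>
    ('s, 'b, 'z) module_scheme \<Rightarrow> 'a \<Rightarrow> 'b \<Rightarrow> ('a \<times> 'b \<Rightarrow>\<^sub>0 int) set" where
  "pure_tensor S A B a b = tensor_class S A B (frag_of (a, b))"

lemma tensor_relationsE:
  assumes "c \<in> tensor_relations S A B"
  obtains a a' b where "c = frag_of (a \<oplus>\<^bsub>A\<^esub> a', b) - frag_of (a, b) - frag_of (a', b)"
      "a \<in> carrier A" "a' \<in> carrier A" "b \<in> carrier B"
    | a b b' where "c = frag_of (a, b \<oplus>\<^bsub>B\<^esub> b') - frag_of (a, b) - frag_of (a, b')"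
      "a \<in> carrier A" "b \<in> carrier B" "b' \<in> carrier B"
    | s a b where "c = frag_of (s \<odot>\<^bsub>A\<^esub> a, b) - frag_of (a, s \<odot>\<^bsub>B\<^esub> b)"
      "s \<in> carrier S" "a \<in> carrier A" "b \<in> carrier B"
  using assms unfolding tensor_relations_def by blast

lemma tensor_relationsI:
  "\<lbrakk>a \<in> carrier A; a' \<in> carrier A; b \<in> carrier B\<rbrakk> \<Longrightarrow>
     frag_of (a \<oplus>\<^bsub>A\<^esub> a', b) - frag_of (a, b) - frag_of (a', b) \<in> tensor_relations S A B"
  "\<lbrakk>a \<in> carrier A; b \<in> carrier B; b' \<in> carrier B\<rbrakk> \<Longrightarrow>
     frag_of (a, b \<oplus>\<^bsub>B\<^esub> b') - frag_of (a, b) - frag_of (a, b') \<in> tensor_relations S A B"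
  "\<lbrakk>s \<in> carrier S; a \<in> carrier A; b \<in> carrier B\<rbrakk> \<Longrightarrow>
     frag_of (s \<odot>\<^bsub>A\<^esub> a, b) - frag_of (a, s \<odot>\<^bsub>B\<^esub> b) \<in> tensor_relations S A B"
  unfolding tensor_relations_def by blast+

lemma keys_diff_subset: "\<lbrakk>Poly_Mapping.keys x \<subseteq> K; Poly_Mapping.keys y \<subseteq> K\<rbrakk> \<Longrightarrow> Poly_Mapping.keys (x - y) \<subseteq> K"
  using keys_diff[of x y] by blast

lemma keys_add_subset: "\<lbrakk>Poly_Mapping.keys x \<subseteq> K; Poly_Mapping.keys y \<subseteq> K\<rbrakk> \<Longrightarrow> Poly_Mapping.keys (x + y) \<subseteq> K"
  using keys_add[of x y] by blast

locale tensor_factors =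
  fixes S :: "('s, 'x) ring_scheme" and A :: "('s, 'a, 'y) module_scheme"
    and B :: "('s, 'b, 'z) module_scheme"
  assumes right: "right_module S A" and left: "left_module S B"
begin

sublocale A: left_module "opp S" A by (rule right)
sublocale B: left_module S B by (rule left)

abbreviation "free \<equiv> free_Abelian_group (carrier A \<times> carrier B)"
abbreviation "T \<equiv> tensor S A B"
abbreviation "cls \<equiv> tensor_class S A B"
abbreviation pt (infixl "\<diamondop>" 70) where "pt \<equiv> pure_tensor S A B"

lemma relations_keys:
  assumes "c \<in> tensor_relations S A B" shows "Poly_Mapping.keys c \<subseteq> carrier A \<times> carrier B"
  using assms A.smult_closed B.smult_closed
  by (cases rule: tensor_relationsE) (simp_all add: keys_diff_subset)

lemma relations_subset: "tensor_relations S A B \<subseteq> carrier free"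
  by (rule subsetI) (simp add: relations_keys)

lemma null_subgroup: "subgroup (tensor_null S A B) free"
  unfolding tensor_null_def by (rule group.generate_is_subgroup[OF group_free_Abelian_group relations_subset])

lemma null_normal: "tensor_null S A B \<lhd> free"
  using comm_group.subgroup_imp_normal[OF abelian_free_Abelian_group null_subgroup] .

lemma null_minus_closed:
  assumes "c \<in> tensor_null S A B" "c' \<in> tensor_null S A B"
  shows "c - c' \<in> tensor_null S A B"
proof -
  have "Poly_Mapping.keys c' \<subseteq> carrier A \<times> carrier B"
    using subgroup.mem_carrier[OF null_subgroup assms(2)] by simp
  then show ?thesis
    using subgroup.m_closed[OF null_subgroup assms(1) subgroup.m_inv_closed[OF null_subgroup assms(2)]]
    by simp
qed

lemma cls_eq_iff:
  assumes "Poly_Mapping.keys c \<subseteq> carrier A \<times> carrier B" "Poly_Mapping.keys c' \<subseteq> carrier A \<times> carrier B"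
  shows "cls c = cls c' \<longleftrightarrow> c - c' \<in> tensor_null S A B"
proof -
  interpret F: group free by simp
  have "cls c = cls c' \<longleftrightarrow> c \<in> cls c'"
    using F.repr_independence[OF _ _ null_subgroup, of c c'] F.rcos_self[OF _ null_subgroup, of c] assms
    unfolding tensor_class_def by auto
  also have "\<dots> \<longleftrightarrow> c - c' \<in> tensor_null S A B"
    unfolding tensor_class_def r_coset_def by (force intro: bexI[of _ "c - c'"])
  finally show ?thesis .
qed

lemma carrier_T: "carrier T = cls ` {c. Poly_Mapping.keys c \<subseteq> carrier A \<times> carrier B}"
  by (simp add: tensor_def Let_def carrier_FactGroup tensor_class_def free_Abelian_group_def)

lemma zero_T: "\<zero>\<^bsub>T\<^esub> = cls 0"
proof -
  interpret F: group free by simp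
  show ?thesis
    using F.coset_join2[OF _ null_subgroup, of 0] subgroup.one_closed[OF null_subgroup]
    by (simp add: tensor_def Let_def tensor_class_def)
qed

lemma add_cls:
  assumes "Poly_Mapping.keys c \<subseteq> carrier A \<times> carrier B" "Poly_Mapping.keys c' \<subseteq> carrier A \<times> carrier B"
  shows "cls c \<oplus>\<^bsub>T\<^esub> cls c' = cls (c + c')"
  using normal.rcos_sum[OF null_normal, of c c'] assms
  by (simp add: tensor_def Let_def tensor_class_def FactGroup_def)

lemma abelian_group_T: "abelian_group T"
proof (rule abelian_groupI)
  fix t assume "t \<in> carrier T"
  then obtain c where c: "Poly_Mapping.keys c \<subseteq> carrier A \<times> carrier B" "t = cls c"
    by (auto simp: carrier_T)
  then show "\<exists>y\<in>carrier T. y \<oplus>\<^bsub>T\<^esub> t = \<zero>\<^bsub>T\<^esub>"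
    by (intro bexI[of _ "cls (- c)"]) (auto simp: carrier_T add_cls zero_T)
next
  show "\<zero>\<^bsub>T\<^esub> \<in> carrier T" by (auto simp: carrier_T zero_T)
qed (auto simp: carrier_T add_cls zero_T keys_add_subset add_ac)

sublocale T: abelian_group T by (rule abelian_group_T)

lemma pure_closed [simp, intro]: "\<lbrakk>a \<in> carrier A; b \<in> carrier B\<rbrakk> \<Longrightarrow> a \<diamondop> b \<in> carrier T"
  by (auto simp: carrier_T pure_tensor_def)

lemma null_relation: "c \<in> tensor_relations S A B \<Longrightarrow> c \<in> tensor_null S A B"
  unfolding tensor_null_def by (rule generate.incl)

lemma pure_add_left:
  assumes "a \<in> carrier A" "a' \<in> carrier A" "b \<in> carrier B"
  shows "(a \<oplus>\<^bsub>A\<^esub> a') \<diamondop> b = a \<diamondop> b \<oplus>\<^bsub>T\<^esub> a' \<diamondop> b"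
proof -
  have "(a \<oplus>\<^bsub>A\<^esub> a') \<diamondop> b = cls (frag_of (a, b) + frag_of (a', b))"
    unfolding pure_tensor_def using assms null_relation[OF tensor_relationsI(1)[OF assms]]
    by (subst cls_eq_iff) (simp_all add: keys_add_subset diff_diff_eq)
  then show ?thesis using assms by (simp add: pure_tensor_def add_cls)
qed

lemma pure_add_right:
  assumes "a \<in> carrier A" "b \<in> carrier B" "b' \<in> carrier B"
  shows "a \<diamondop> (b \<oplus>\<^bsub>B\<^esub> b') = a \<diamondop> b \<oplus>\<^bsub>T\<^esub> a \<diamondop> b'"
proof -
  have "a \<diamondop> (b \<oplus>\<^bsub>B\<^esub> b') = cls (frag_of (a, b) + frag_of (a, b'))"
    unfolding pure_tensor_def using assms null_relation[OF tensor_relationsI(2)[OF assms]]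
    by (subst cls_eq_iff) (simp_all add: keys_add_subset diff_diff_eq)
  then show ?thesis using assms by (simp add: pure_tensor_def add_cls)
qed

lemma pure_balanced:
  assumes "s \<in> carrier S" "a \<in> carrier A" "b \<in> carrier B"
  shows "(s \<odot>\<^bsub>A\<^esub> a) \<diamondop> b = a \<diamondop> (s \<odot>\<^bsub>B\<^esub> b)"
  unfolding pure_tensor_def using assms null_relation[OF tensor_relationsI(3)[OF assms]] A.smult_closed
  by (subst cls_eq_iff) auto

lemma pure_zero_right:
  assumes "a \<in> carrier A" shows "a \<diamondop> \<zero>\<^bsub>B\<^esub> = \<zero>\<^bsub>T\<^esub>"
proof -
  have "a \<diamondop> \<zero>\<^bsub>B\<^esub> \<oplus>\<^bsub>T\<^esub> a \<diamondop> \<zero>\<^bsub>B\<^esub> = a \<diamondop> \<zero>\<^bsub>B\<^esub>"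
    using pure_add_right[of a "\<zero>\<^bsub>B\<^esub>" "\<zero>\<^bsub>B\<^esub>"] assms by simp
  then show ?thesis using T.add.r_cancel_one[of "a \<diamondop> \<zero>\<^bsub>B\<^esub>" "a \<diamondop> \<zero>\<^bsub>B\<^esub>"] assms by simp
qed

lemma pure_zero_left:
  assumes "b \<in> carrier B" shows "\<zero>\<^bsub>A\<^esub> \<diamondop> b = \<zero>\<^bsub>T\<^esub>"
proof -
  have "\<zero>\<^bsub>A\<^esub> \<diamondop> b \<oplus>\<^bsub>T\<^esub> \<zero>\<^bsub>A\<^esub> \<diamondop> b = \<zero>\<^bsub>A\<^esub> \<diamondop> b"
    using pure_add_left[of "\<zero>\<^bsub>A\<^esub>" "\<zero>\<^bsub>A\<^esub>" b] assms by simp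
  then show ?thesis using T.add.r_cancel_one[of "\<zero>\<^bsub>A\<^esub> \<diamondop> b" "\<zero>\<^bsub>A\<^esub> \<diamondop> b"] assms by simp
qed

text \<open>The rule has no case for negatives, because \<open>- (a \<otimes> b) = (- a) \<otimes> b\<close>.\<close>

lemma tensor_induct [consumes 1, case_names pure add]:
  assumes "t \<in> carrier T"
    and pure: "\<And>a b. \<lbrakk>a \<in> carrier A; b \<in> carrier B\<rbrakk> \<Longrightarrow> P (a \<diamondop> b)"
    and add: "\<And>x y. \<lbrakk>x \<in> carrier T; y \<in> carrier T; P x; P y\<rbrakk> \<Longrightarrow> P (x \<oplus>\<^bsub>T\<^esub> y)"
  shows "P t"
proof -
  obtain c where c: "Poly_Mapping.keys c \<subseteq> carrier A \<times> carrier B" "t = cls c"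
    using assms(1) by (auto simp: carrier_T)
  have P0: "P (cls 0)"
    using pure[of "\<zero>\<^bsub>A\<^esub>" "\<zero>\<^bsub>B\<^esub>"] pure_zero_left[of "\<zero>\<^bsub>B\<^esub>"] by (simp add: zero_T)
  have "P (cls c) \<and> P (cls (- c))"
  proof (rule free_Abelian_group_induct[OF c(1)])
    show "P (cls 0) \<and> P (cls (- 0))" using P0 by simp
  next
    fix x y
    assume 2: "Poly_Mapping.keys x \<subseteq> carrier A \<times> carrier B" "Poly_Mapping.keys y \<subseteq> carrier A \<times> carrier B"
      "P (cls x) \<and> P (cls (- x))" "P (cls y) \<and> P (cls (- y))"
    have cl: "cls x \<in> carrier T" "cls y \<in> carrier T" "cls (- x) \<in> carrier T" "cls (- y) \<in> carrier T"
      using 2 by (auto simp: carrier_T)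
    show "P (cls (x - y)) \<and> P (cls (- (x - y)))"
      using add[OF cl(1,4)] add[OF cl(2,3)] 2 by (simp add: add_cls)
  next
    fix ab assume "ab \<in> carrier A \<times> carrier B"
    then obtain a b where ab: "ab = (a, b)" "a \<in> carrier A" "b \<in> carrier B" by auto
    have inv: "\<ominus>\<^bsub>A\<^esub> a \<in> carrier A" using ab by simp
    have "(\<ominus>\<^bsub>A\<^esub> a) \<diamondop> b \<oplus>\<^bsub>T\<^esub> cls (frag_of (a, b)) = cls 0"
      using pure_add_left[of "\<ominus>\<^bsub>A\<^esub> a" a b] ab
      by (simp add: A.M.l_neg pure_zero_left zero_T) (simp add: pure_tensor_def)
    moreover have "cls (- frag_of (a, b)) \<oplus>\<^bsub>T\<^esub> cls (frag_of (a, b)) = cls 0"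
      using ab by (simp add: add_cls)
    moreover have "cls (- frag_of (a, b)) \<in> carrier T" "cls (frag_of (a, b)) \<in> carrier T"
      using ab by (auto simp: carrier_T)
    ultimately have "cls (- frag_of (a, b)) = (\<ominus>\<^bsub>A\<^esub> a) \<diamondop> b"
      using T.add.right_cancel pure_closed[OF inv ab(3)] by metis
    then show "P (cls (frag_of ab)) \<and> P (cls (- frag_of ab))"
      using pure ab inv by (metis pure_tensor_def)
  qed
  then show ?thesis using c(2) by simp
qed

lemma tensor_hom_eqI:
  assumes "abelian_group_hom T G f" "abelian_group_hom T G g"
    and "\<And>a b. \<lbrakk>a \<in> carrier A; b \<in> carrier B\<rbrakk> \<Longrightarrow> f (a \<diamondop> b) = g (a \<diamondop> b)" and "t \<in> carrier T"
  shows "f t = g t"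
proof -
  interpret f: abelian_group_hom T G f by fact
  interpret g: abelian_group_hom T G g by fact
  show ?thesis using assms(4) by (induction rule: tensor_induct) (simp_all add: assms(3))
qed

text \<open>The homomorphism on formal sums that extends \<open>\<beta>\<close> vanishes on the relations, which express
  additivity in each argument and balancedness, and so factors through the quotient.\<close>

lemma tensor_universal:
  assumes G: "abelian_group G"
    and cl: "\<And>a b. \<lbrakk>a \<in> carrier A; b \<in> carrier B\<rbrakk> \<Longrightarrow> \<beta> a b \<in> carrier G"
    and addl: "\<And>a a' b. \<lbrakk>a \<in> carrier A; a' \<in> carrier A; b \<in> carrier B\<rbrakk> \<Longrightarrow>
        \<beta> (a \<oplus>\<^bsub>A\<^esub> a') b = \<beta> a b \<oplus>\<^bsub>G\<^esub> \<beta> a' b"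
    and addr: "\<And>a b b'. \<lbrakk>a \<in> carrier A; b \<in> carrier B; b' \<in> carrier B\<rbrakk> \<Longrightarrow>
        \<beta> a (b \<oplus>\<^bsub>B\<^esub> b') = \<beta> a b \<oplus>\<^bsub>G\<^esub> \<beta> a b'"
    and bal: "\<And>s a b. \<lbrakk>s \<in> carrier S; a \<in> carrier A; b \<in> carrier B\<rbrakk> \<Longrightarrow>
        \<beta> (s \<odot>\<^bsub>A\<^esub> a) b = \<beta> a (s \<odot>\<^bsub>B\<^esub> b)"
  obtains h where "abelian_group_hom T G h"
    "\<And>a b. \<lbrakk>a \<in> carrier A; b \<in> carrier B\<rbrakk> \<Longrightarrow> h (a \<diamondop> b) = \<beta> a b"
proof -
  interpret G: abelian_group G by fact
  have "(\<lambda>(a, b). \<beta> a b) ` (carrier A \<times> carrier B) \<subseteq> carrier (add_monoid G)" using cl by auto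
  from comm_group.free_Abelian_group_universal[OF G.a_comm_group this]
  obtain k where k: "k \<in> hom free (add_monoid G)"
    and k_frag: "\<And>x. x \<in> carrier A \<times> carrier B \<Longrightarrow> k (frag_of x) = (\<lambda>(a, b). \<beta> a b) x" by blast
  interpret k: group_hom free "add_monoid G" k
    using k G.a_group by (simp add: group_hom_def group_hom_axioms_def)
  have k_diff: "k (x - y) = k x \<ominus>\<^bsub>G\<^esub> k y"
    if "Poly_Mapping.keys x \<subseteq> carrier A \<times> carrier B" "Poly_Mapping.keys y \<subseteq> carrier A \<times> carrier B" for x y
    using k.hom_mult[of x "- y"] k.hom_inv[of y] that by (simp add: a_minus_def a_inv_def)
  have "k c = \<zero>\<^bsub>G\<^esub>" if "c \<in> tensor_relations S A B" for c
    using that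
  proof (cases rule: tensor_relationsE)
    case (1 a a' b)
    then show ?thesis
      using cl by (simp add: k_diff k_frag keys_diff_subset addl a_minus_def G.a_ac G.r_neg G.r_neg2)
  next
    case (2 a b b')
    then show ?thesis
      using cl by (simp add: k_diff k_frag keys_diff_subset addr a_minus_def G.a_ac G.r_neg G.r_neg2)
  next
    case (3 s a b)
    then show ?thesis
      using cl A.smult_closed by (simp add: k_diff k_frag keys_diff_subset bal a_minus_def G.r_neg)
  qed
  then have "tensor_relations S A B \<subseteq> kernel free (add_monoid G) k"
    by (intro subsetI) (simp add: kernel_def relations_keys)
  then have "tensor_null S A B \<subseteq> kernel free (add_monoid G) k"
    unfolding tensor_null_def
    by (rule group.generate_subgroup_incl[OF group_free_Abelian_group _ k.subgroup_kernel])
  from k.FactGroup_universal_kernel[OF null_normal this] obtain h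
    where h: "h \<in> hom (free Mod tensor_null S A B) (add_monoid G)"
      "\<And>x. x \<in> carrier free \<Longrightarrow> h (cls x) = k x"
    unfolding tensor_class_def by blast
  show thesis
  proof (rule that)
    have "h x \<in> carrier G" "h (x \<oplus>\<^bsub>T\<^esub> y) = h x \<oplus>\<^bsub>G\<^esub> h y"
      if "x \<in> carrier T" "y \<in> carrier T" for x y
      using h(1) that by (auto simp: hom_def tensor_def Let_def)
    then show "abelian_group_hom T G h" by (intro abelian_group_hom_intro T.abelian_group_axioms G)
    show "h (a \<diamondop> b) = \<beta> a b" if "a \<in> carrier A" "b \<in> carrier B" for a b
      using that by (simp add: pure_tensor_def h(2) k_frag)
  qed
qed

end

section \<open>Functoriality of the tensor product\<close>

abbreviation frag_map2 :: "('c \<Rightarrow> 'a) \<Rightarrow> ('d \<Rightarrow> 'b) \<Rightarrow> ('c \<times> 'd \<Rightarrow>\<^sub>0 int) \<Rightarrow> ('a \<times> 'b \<Rightarrow>\<^sub>0 int)" where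
  "frag_map2 f g \<equiv> frag_extend (\<lambda>(x, y). frag_of (f x, g y))"

lemma keys_frag_map2:
  assumes "Poly_Mapping.keys c \<subseteq> C \<times> D" "\<And>x. x \<in> C \<Longrightarrow> f x \<in> A" "\<And>y. y \<in> D \<Longrightarrow> g y \<in> B"
  shows "Poly_Mapping.keys (frag_map2 f g c) \<subseteq> A \<times> B"
  using keys_frag_extend[of "\<lambda>(x, y). frag_of (f x, g y)" c] assms by (fastforce split: prod.splits)

text \<open>Homomorphisms in the two factors map every relation to a relation of the same kind.\<close>

lemma tensor_null_map:
  assumes "tensor_factors S C D" "f \<in> lmod_hom S C A" "g \<in> lmod_hom S D B"
    and "tensor_factors S A B" "c \<in> tensor_null S C D"
  shows "frag_map2 f g c \<in> tensor_null S A B"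
proof -
  interpret CD: tensor_factors S C D by fact
  interpret AB: tensor_factors S A B by fact
  have rel: "frag_map2 f g c \<in> tensor_relations S A B" if "c \<in> tensor_relations S C D" for c
    using that
    by (cases rule: tensor_relationsE)
       (auto simp: frag_extend_diff lmod_hom_add[OF assms(2)] lmod_hom_add[OF assms(3)]
         lmod_hom_smult[OF assms(2)] lmod_hom_smult[OF assms(3)]
         intro!: tensor_relationsI lmod_hom_closed[OF assms(2)] lmod_hom_closed[OF assms(3)])
  show ?thesis
    using assms(5) unfolding tensor_null_def[of S C D]
  proof (induction rule: generate.induct)
    case one
    then show ?case using subgroup.one_closed[OF AB.null_subgroup] by simp
  next
    case (incl h)
    then show ?case using rel AB.null_relation by blast
  next
    case (inv h)
    have "0 - frag_map2 f g h \<in> tensor_null S A B"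
      using subgroup.one_closed[OF AB.null_subgroup] AB.null_relation[OF rel[OF inv]]
      by (intro AB.null_minus_closed) simp_all
    then show ?case using inv CD.relations_keys by (simp add: frag_extend_minus)
  next
    case (eng h1 h2)
    then show ?case
      using subgroup.m_closed[OF AB.null_subgroup] by (simp add: frag_extend_add)
  qed
qed

text \<open>The union that defines \<open>tensor_map\<close> is over representatives that all give the same coset.\<close>

lemma tensor_map_cls:
  assumes CD: "tensor_factors S C D" and f: "f \<in> lmod_hom S C A" and g: "g \<in> lmod_hom S D B"
    and AB: "tensor_factors S A B" and c: "Poly_Mapping.keys c \<subseteq> carrier C \<times> carrier D"
  shows "tensor_map S A B f g (tensor_class S C D c) = tensor_class S A B (frag_map2 f g c)"
proof -
  interpret CD: tensor_factors S C D by fact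
  interpret AB: tensor_factors S A B by fact
  interpret F: group "free_Abelian_group (carrier C \<times> carrier D)" by simp
  have keys: "Poly_Mapping.keys (frag_map2 f g c) \<subseteq> carrier A \<times> carrier B"
    if "Poly_Mapping.keys c \<subseteq> carrier C \<times> carrier D" for c
    by (rule keys_frag_map2[OF that lmod_hom_closed[OF f] lmod_hom_closed[OF g]])
  have "tensor_class S A B (frag_map2 f g c') = tensor_class S A B (frag_map2 f g c)"
    if c': "c' \<in> tensor_class S C D c" for c'
  proof -
    obtain m where m: "m \<in> tensor_null S C D" "c' = m + c"
      using c' by (auto simp: tensor_class_def r_coset_def)
    have "Poly_Mapping.keys m \<subseteq> carrier C \<times> carrier D"
      using subgroup.mem_carrier[OF CD.null_subgroup m(1)] by simp
    then show ?thesis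
      using tensor_null_map[OF CD f g AB m(1)] m(2) keys[of m] keys[OF c]
      by (subst AB.cls_eq_iff) (simp_all add: frag_extend_add keys_add_subset)
  qed
  moreover have "c \<in> tensor_class S C D c"
    unfolding tensor_class_def by (rule F.rcos_self[OF _ CD.null_subgroup]) (use c in simp)
  ultimately show ?thesis
    unfolding tensor_map_def tensor_class_def[of S A B, symmetric] by blast
qed

lemma tensor_map_pure:
  assumes "tensor_factors S C D" "f \<in> lmod_hom S C A" "g \<in> lmod_hom S D B" "tensor_factors S A B"
    and "x \<in> carrier C" "y \<in> carrier D"
  shows "tensor_map S A B f g (pure_tensor S C D x y) = pure_tensor S A B (f x) (g y)"
  using tensor_map_cls[OF assms(1-4), of "frag_of (x, y)"] assms(5,6) by (simp add: pure_tensor_def)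

lemma tensor_map_hom:
  assumes CD: "tensor_factors S C D" and f: "f \<in> lmod_hom S C A" and g: "g \<in> lmod_hom S D B"
    and AB: "tensor_factors S A B"
  shows "abelian_group_hom (tensor S C D) (tensor S A B) (tensor_map S A B f g)"
proof -
  interpret CD: tensor_factors S C D by fact
  interpret AB: tensor_factors S A B by fact
  have keys: "Poly_Mapping.keys (frag_map2 f g c) \<subseteq> carrier A \<times> carrier B"
    if "Poly_Mapping.keys c \<subseteq> carrier C \<times> carrier D" for c
    by (rule keys_frag_map2[OF that lmod_hom_closed[OF f] lmod_hom_closed[OF g]])
  show ?thesis
    by (rule abelian_group_hom_intro[OF CD.abelian_group_T AB.abelian_group_T])
       (auto simp: CD.carrier_T AB.carrier_T tensor_map_cls[OF CD f g AB] keys CD.add_cls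
         AB.add_cls frag_extend_add keys_add_subset)
qed

lemma tensor_map_id:
  assumes "tensor_factors S A B" "t \<in> carrier (tensor S A B)"
  shows "tensor_map S A B (\<lambda>x. x) (\<lambda>y. y) t = t"
proof -
  interpret tensor_factors S A B by fact
  have "abelian_group_hom T T (\<lambda>t. t)" by (rule abelian_group_hom_intro) (auto intro: abelian_group_T)
  from tensor_hom_eqI[OF tensor_map_hom[OF assms(1) lmod_hom_id lmod_hom_id assms(1)] this _ assms(2)]
  show ?thesis by (simp add: tensor_map_pure[OF assms(1) lmod_hom_id lmod_hom_id assms(1)])
qed

lemma abelian_group_hom_compose:
  assumes "abelian_group_hom G H f" "abelian_group_hom H K g"
  shows "abelian_group_hom G K (\<lambda>x. g (f x))"
proof -
  interpret f: abelian_group_hom G H f by fact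
  interpret g: abelian_group_hom H K g by fact
  show ?thesis
    by (rule abelian_group_hom_intro[OF f.G.abelian_group_axioms g.H.abelian_group_axioms]) auto
qed

lemma tensor_map_comp:
  assumes "tensor_factors S A B" "tensor_factors S A' B'" "tensor_factors S A'' B''"
    and f: "f \<in> lmod_hom S A A'" and g: "g \<in> lmod_hom S B B'"
    and f': "f' \<in> lmod_hom S A' A''" and g': "g' \<in> lmod_hom S B' B''"
    and t: "t \<in> carrier (tensor S A B)"
  shows "tensor_map S A'' B'' f' g' (tensor_map S A' B' f g t)
    = tensor_map S A'' B'' (\<lambda>x. f' (f x)) (\<lambda>y. g' (g y)) t"
proof -
  interpret tensor_factors S A B by fact
  note ff = lmod_hom_comp[OF f f'] and gg = lmod_hom_comp[OF g g']
  show ?thesis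
    by (rule tensor_hom_eqI[OF abelian_group_hom_compose[OF tensor_map_hom[OF assms(1) f g assms(2)]
          tensor_map_hom[OF assms(2) f' g' assms(3)]] tensor_map_hom[OF assms(1) ff gg assms(3)] _ t])
       (simp add: tensor_map_pure[OF assms(1) f g assms(2)] tensor_map_pure[OF assms(2) f' g' assms(3)]
         tensor_map_pure[OF assms(1) ff gg assms(3)] lmod_hom_closed[OF f] lmod_hom_closed[OF g])
qed

lemma tensor_map_cong:
  assumes "tensor_factors S A B" "tensor_factors S A' B'"
    and f: "f \<in> lmod_hom S A A'" and g: "g \<in> lmod_hom S B B'" and g': "g' \<in> lmod_hom S B B'"
    and "\<And>y. y \<in> carrier B \<Longrightarrow> g y = g' y" and t: "t \<in> carrier (tensor S A B)"
  shows "tensor_map S A' B' f g t = tensor_map S A' B' f g' t"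
proof -
  interpret tensor_factors S A B by fact
  show ?thesis
    by (rule tensor_hom_eqI[OF tensor_map_hom[OF assms(1) f g assms(2)] tensor_map_hom[OF assms(1) f g' assms(2)] _ t])
       (simp add: tensor_map_pure[OF assms(1) f g assms(2)] tensor_map_pure[OF assms(1) f g' assms(2)] assms(6))
qed

lemma tensor_map_add:
  assumes AB: "tensor_factors S A B" and AB': "tensor_factors S A B'"
    and g: "g \<in> lmod_hom S B B'" and g': "g' \<in> lmod_hom S B B'"
    and t: "t \<in> carrier (tensor S A B)"
  shows "tensor_map S A B' (\<lambda>x. x) (\<lambda>y. g y \<oplus>\<^bsub>B'\<^esub> g' y) t
    = tensor_map S A B' (\<lambda>x. x) g t \<oplus>\<^bsub>tensor S A B'\<^esub> tensor_map S A B' (\<lambda>x. x) g' t"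
proof -
  interpret tensor_factors S A B by fact
  interpret T': tensor_factors S A B' by fact
  note gg = lmod_hom_pointwise_add[OF left T'.left g g']
  interpret m: abelian_group_hom T "tensor S A B'" "tensor_map S A B' (\<lambda>x. x) g"
    by (rule tensor_map_hom[OF AB lmod_hom_id g AB'])
  interpret m': abelian_group_hom T "tensor S A B'" "tensor_map S A B' (\<lambda>x. x) g'"
    by (rule tensor_map_hom[OF AB lmod_hom_id g' AB'])
  have "abelian_group_hom T (tensor S A B')
      (\<lambda>t. tensor_map S A B' (\<lambda>x. x) g t \<oplus>\<^bsub>tensor S A B'\<^esub> tensor_map S A B' (\<lambda>x. x) g' t)"
    by (rule abelian_group_hom_intro[OF abelian_group_T T'.abelian_group_T]) (auto simp: T'.T.a_ac)
  from tensor_hom_eqI[OF tensor_map_hom[OF AB lmod_hom_id gg AB'] this _ t] show ?thesis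
    by (simp add: tensor_map_pure[OF AB lmod_hom_id g AB'] tensor_map_pure[OF AB lmod_hom_id g' AB']
        tensor_map_pure[OF AB lmod_hom_id gg AB'] T'.pure_add_right lmod_hom_closed[OF g] lmod_hom_closed[OF g'])
qed

lemma tensor_map_zero:
  assumes AB: "tensor_factors S A B" and AB': "tensor_factors S A B'"
    and g: "g \<in> lmod_hom S B B'" and z: "\<And>y. y \<in> carrier B \<Longrightarrow> g y = \<zero>\<^bsub>B'\<^esub>"
    and t: "t \<in> carrier (tensor S A B)"
  shows "tensor_map S A B' (\<lambda>x. x) g t = \<zero>\<^bsub>tensor S A B'\<^esub>"
proof -
  interpret tensor_factors S A B by fact
  interpret T': tensor_factors S A B' by fact
  have "abelian_group_hom T (tensor S A B') (\<lambda>t. \<zero>\<^bsub>tensor S A B'\<^esub>)"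
    by (rule abelian_group_hom_intro[OF abelian_group_T T'.abelian_group_T]) auto
  from tensor_hom_eqI[OF tensor_map_hom[OF AB lmod_hom_id g AB'] this _ t] show ?thesis
    by (simp add: tensor_map_pure[OF AB lmod_hom_id g AB'] z T'.pure_zero_right)
qed


section \<open>Module structures on tensor products\<close>

lemma tensor_left_simps:
  "carrier (tensor_left S L B) = carrier (tensor S (flip L) B)"
  "\<zero>\<^bsub>tensor_left S L B\<^esub> = \<zero>\<^bsub>tensor S (flip L) B\<^esub>"
  "x \<oplus>\<^bsub>tensor_left S L B\<^esub> y = x \<oplus>\<^bsub>tensor S (flip L) B\<^esub> y"
  "r \<odot>\<^bsub>tensor_left S L B\<^esub> x = tensor_map S (flip L) B (\<lambda>x. r \<odot>\<^bsub>L\<^esub> x) (\<lambda>y. y) x"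
  by (simp_all add: tensor_left_def ring.defs module.defs)

lemma tensor_right_simps:
  "carrier (tensor_right S A L) = carrier (tensor S A L)"
  "\<zero>\<^bsub>tensor_right S A L\<^esub> = \<zero>\<^bsub>tensor S A L\<^esub>"
  "x \<oplus>\<^bsub>tensor_right S A L\<^esub> y = x \<oplus>\<^bsub>tensor S A L\<^esub> y"
  "r \<odot>\<^bsub>tensor_right S A L\<^esub> x = tensor_map S A L (\<lambda>x. x) (\<lambda>y. rsmult L y r) x"
  by (simp_all add: tensor_right_def ring.defs module.defs)

text \<open>The module axioms for an action by group endomorphisms can be checked on pure tensors.\<close>

lemma (in tensor_factors) tensor_module:
  fixes R :: "('r, 'q) ring_scheme" and Y :: "('r, ('a \<times> 'b \<Rightarrow>\<^sub>0 int) set) module"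
  assumes R: "ring R"
    and Y: "carrier Y = carrier T" "\<zero>\<^bsub>Y\<^esub> = \<zero>\<^bsub>T\<^esub>" "\<And>x y. x \<oplus>\<^bsub>Y\<^esub> y = x \<oplus>\<^bsub>T\<^esub> y"
    and hom: "\<And>r. r \<in> carrier R \<Longrightarrow> abelian_group_hom T T (\<lambda>t. r \<odot>\<^bsub>Y\<^esub> t)"
    and addr: "\<And>r r' a b. \<lbrakk>r \<in> carrier R; r' \<in> carrier R; a \<in> carrier A; b \<in> carrier B\<rbrakk> \<Longrightarrow>
        (r \<oplus>\<^bsub>R\<^esub> r') \<odot>\<^bsub>Y\<^esub> (a \<diamondop> b) = r \<odot>\<^bsub>Y\<^esub> (a \<diamondop> b) \<oplus>\<^bsub>T\<^esub> r' \<odot>\<^bsub>Y\<^esub> (a \<diamondop> b)"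
    and mult: "\<And>r r' a b. \<lbrakk>r \<in> carrier R; r' \<in> carrier R; a \<in> carrier A; b \<in> carrier B\<rbrakk> \<Longrightarrow>
        (r \<otimes>\<^bsub>R\<^esub> r') \<odot>\<^bsub>Y\<^esub> (a \<diamondop> b) = r \<odot>\<^bsub>Y\<^esub> (r' \<odot>\<^bsub>Y\<^esub> (a \<diamondop> b))"
    and one: "\<And>a b. \<lbrakk>a \<in> carrier A; b \<in> carrier B\<rbrakk> \<Longrightarrow> \<one>\<^bsub>R\<^esub> \<odot>\<^bsub>Y\<^esub> (a \<diamondop> b) = a \<diamondop> b"
  shows "left_module R Y"
proof -
  interpret R: ring R by fact
  note cl = abelian_group_hom.hom_closed[OF hom] and ad = abelian_group_hom.hom_add[OF hom]
  show ?thesis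
  proof (rule left_moduleI[OF R])
    show "abelian_group Y"
      using abelian_group_surj_image[OF abelian_group_T, of Y "\<lambda>t. t"] Y by simp
  next
    fix r r' t assume r: "r \<in> carrier R" "r' \<in> carrier R" and "t \<in> carrier Y"
    then have t: "t \<in> carrier T" by (simp add: Y)
    show "(r \<oplus>\<^bsub>R\<^esub> r') \<odot>\<^bsub>Y\<^esub> t = r \<odot>\<^bsub>Y\<^esub> t \<oplus>\<^bsub>Y\<^esub> r' \<odot>\<^bsub>Y\<^esub> t"
      using t
    proof (induction rule: tensor_induct)
      case (add x y)
      then show ?case using r by (simp add: Y ad cl T.a_ac)
    qed (simp add: addr r Y)
    show "(r \<otimes>\<^bsub>R\<^esub> r') \<odot>\<^bsub>Y\<^esub> t = r \<odot>\<^bsub>Y\<^esub> (r' \<odot>\<^bsub>Y\<^esub> t)"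
      using t by (induction rule: tensor_induct) (use r in \<open>simp_all add: mult ad cl\<close>)
  next
    fix t assume "t \<in> carrier Y"
    then have "t \<in> carrier T" by (simp add: Y)
    then show "\<one>\<^bsub>R\<^esub> \<odot>\<^bsub>Y\<^esub> t = t"
      by (induction rule: tensor_induct) (simp_all add: one ad)
  qed (use cl ad Y in auto)
qed

lemma tensor_factors_left: "\<lbrakk>bimodule R S L; left_module S B\<rbrakk> \<Longrightarrow> tensor_factors S (flip L) B"
  by (simp add: tensor_factors_def bimodule_right)

lemma tensor_factors_right: "\<lbrakk>right_module S A; bimodule S R L\<rbrakk> \<Longrightarrow> tensor_factors S A L"
  by (simp add: tensor_factors_def bimodule_left)

lemma bimodule_smult_hom:
  assumes "bimodule R S L" "r \<in> carrier R"
  shows "(\<lambda>x. r \<odot>\<^bsub>L\<^esub> x) \<in> lmod_hom S (flip L) (flip L)"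
proof -
  interpret L: left_module R L by (rule bimodule_left[OF assms(1)])
  show ?thesis
    using bimodule_comm[OF assms(1)] L.smult_r_distr assms(2) by (intro lmod_homI) auto
qed

lemma bimodule_rsmult_hom:
  assumes "bimodule S R L" "r \<in> carrier R"
  shows "(\<lambda>x. rsmult L x r) \<in> lmod_hom S L L"
  using bimodule_smult_hom[OF bimodule_flip[OF assms(1)], of r] assms(2) by simp

lemma
  assumes L: "bimodule R S L" and B: "left_module S B"
  shows tensor_left_smult_pure: "\<lbrakk>r \<in> carrier R; l \<in> carrier L; b \<in> carrier B\<rbrakk> \<Longrightarrow>
      r \<odot>\<^bsub>tensor_left S L B\<^esub> pure_tensor S (flip L) B l b = pure_tensor S (flip L) B (r \<odot>\<^bsub>L\<^esub> l) b"
    and tensor_left_module: "left_module R (tensor_left S L B)"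
proof -
  note LB = tensor_factors_left[OF L B]
  interpret tensor_factors S "flip L" B by (rule LB)
  interpret L: left_module R L by (rule bimodule_left[OF L])
  have pure: "r \<odot>\<^bsub>tensor_left S L B\<^esub> pure_tensor S (flip L) B l b = pure_tensor S (flip L) B (r \<odot>\<^bsub>L\<^esub> l) b"
    if "r \<in> carrier R" "l \<in> carrier L" "b \<in> carrier B" for r l b
    using tensor_map_pure[OF LB bimodule_smult_hom[OF L] lmod_hom_id LB] that
    by (simp add: tensor_left_simps)
  then show "\<lbrakk>r \<in> carrier R; l \<in> carrier L; b \<in> carrier B\<rbrakk> \<Longrightarrow>
      r \<odot>\<^bsub>tensor_left S L B\<^esub> pure_tensor S (flip L) B l b = pure_tensor S (flip L) B (r \<odot>\<^bsub>L\<^esub> l) b" .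
  have "(\<lambda>t. r \<odot>\<^bsub>tensor_left S L B\<^esub> t) = tensor_map S (flip L) B (\<lambda>x. r \<odot>\<^bsub>L\<^esub> x) (\<lambda>y. y)" for r
    by (simp add: fun_eq_iff tensor_left_simps)
  then have "abelian_group_hom T T (\<lambda>t. r \<odot>\<^bsub>tensor_left S L B\<^esub> t)" if "r \<in> carrier R" for r
    using tensor_map_hom[OF LB bimodule_smult_hom[OF L that] lmod_hom_id LB] by simp
  then show "left_module R (tensor_left S L B)"
    using pure_add_left
    by (intro tensor_module[OF L.R.ring_axioms])
       (simp_all add: tensor_left_simps(1-3) pure L.smult_l_distr L.smult_assoc1)
qed

lemma
  assumes A: "right_module S A" and L: "bimodule S R L"
  shows tensor_right_smult_pure: "\<lbrakk>r \<in> carrier R; a \<in> carrier A; l \<in> carrier L\<rbrakk> \<Longrightarrow>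
      r \<odot>\<^bsub>tensor_right S A L\<^esub> pure_tensor S A L a l = pure_tensor S A L a (rsmult L l r)"
    and tensor_right_module: "right_module R (tensor_right S A L)"
proof -
  note AL = tensor_factors_right[OF A L]
  interpret tensor_factors S A L by (rule AL)
  interpret L: left_module "opp R" "flip L" by (rule bimodule_right[OF L])
  interpret R: ring R by (rule right_module_ring[OF bimodule_right[OF L]])
  have pure: "r \<odot>\<^bsub>tensor_right S A L\<^esub> pure_tensor S A L a l = pure_tensor S A L a (rsmult L l r)"
    if "r \<in> carrier R" "a \<in> carrier A" "l \<in> carrier L" for r a l
    using tensor_map_pure[OF AL lmod_hom_id bimodule_rsmult_hom[OF L] AL] that
    by (simp add: tensor_right_simps)
  then show "\<lbrakk>r \<in> carrier R; a \<in> carrier A; l \<in> carrier L\<rbrakk> \<Longrightarrow>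
      r \<odot>\<^bsub>tensor_right S A L\<^esub> pure_tensor S A L a l = pure_tensor S A L a (rsmult L l r)" .
  have "(\<lambda>t. r \<odot>\<^bsub>tensor_right S A L\<^esub> t) = tensor_map S A L (\<lambda>x. x) (\<lambda>y. rsmult L y r)" for r
    by (simp add: fun_eq_iff tensor_right_simps)
  then have "abelian_group_hom T T (\<lambda>t. r \<odot>\<^bsub>tensor_right S A L\<^esub> t)" if "r \<in> carrier R" for r
    using tensor_map_hom[OF AL lmod_hom_id bimodule_rsmult_hom[OF L that] AL] by simp
  then show "right_module R (tensor_right S A L)"
    using pure_add_right L.smult_l_distr L.smult_assoc1 L.smult_one L.smult_closed
    by (intro tensor_module[OF L.R.ring_axioms]) (simp_all add: tensor_right_simps(1-3) pure)
qed

lemma tensor_left_map: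
  assumes M: "bimodule R S M" and g: "g \<in> lmod_hom S B B'"
    and B: "left_module S B" and B': "left_module S B'"
  shows "tensor_map S (flip M) B' (\<lambda>x. x) g \<in> lmod_hom R (tensor_left S M B) (tensor_left S M B')"
proof -
  note MB = tensor_factors_left[OF M B] and MB' = tensor_factors_left[OF M B']
  interpret abelian_group_hom "tensor S (flip M) B" "tensor S (flip M) B'" "tensor_map S (flip M) B' (\<lambda>x. x) g"
    by (rule tensor_map_hom[OF MB lmod_hom_id g MB'])
  show ?thesis
  proof (rule lmod_homI)
    fix r x assume r: "r \<in> carrier R" and x: "x \<in> carrier (tensor_left S M B)"
    show "tensor_map S (flip M) B' (\<lambda>x. x) g (r \<odot>\<^bsub>tensor_left S M B\<^esub> x)
        = r \<odot>\<^bsub>tensor_left S M B'\<^esub> tensor_map S (flip M) B' (\<lambda>x. x) g x"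
      using x tensor_map_comp[OF MB MB MB' bimodule_smult_hom[OF M r] lmod_hom_id lmod_hom_id g, of x]
        tensor_map_comp[OF MB MB' MB' lmod_hom_id g bimodule_smult_hom[OF M r] lmod_hom_id, of x]
      by (simp add: tensor_left_simps)
  qed (auto simp: tensor_left_simps)
qed


section \<open>Comparison of right resolutions\<close>

locale right_res =
  fixes R :: "('r, 'x) ring_scheme" and \<C> :: "('r, 'u) module set"
    and N :: "('r, 'n) module" and V :: "('r, 'u, 'n \<Rightarrow> 'u) aug_complex"
  assumes modules: "M \<in> \<C> \<Longrightarrow> left_module R M"
    and N: "left_module R N"
    and res: "right_resolution R \<C> N V"
begin

lemma in_class: "obj V n \<in> \<C>"
  and obj_module: "left_module R (obj V n)"
  and diff_hom: "diff V n \<in> lmod_hom R (obj V n) (obj V (Suc n))"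
  and aug_hom: "aug V \<in> lmod_hom R N (obj V 0)"
  and diff_aug: "y \<in> carrier N \<Longrightarrow> diff V 0 (aug V y) = \<zero>\<^bsub>obj V (Suc 0)\<^esub>"
  and diff_diff: "x \<in> carrier (obj V n) \<Longrightarrow> diff V (Suc n) (diff V n x) = \<zero>\<^bsub>obj V (Suc (Suc n))\<^esub>"
  using res modules unfolding right_resolution_def by auto

lemma extend_aug:
  assumes "Y \<in> \<C>" "f \<in> lmod_hom R N Y"
  obtains g where "g \<in> lmod_hom R (obj V 0) Y" "\<And>x. x \<in> carrier N \<Longrightarrow> g (aug V x) = f x"
proof -
  have "restrict f (carrier N) \<in> carrier (hom_group R N Y)"
    using lmod_hom_restrict[OF N assms(2)] by simp
  then obtain g where g: "g \<in> lmod_hom R (obj V 0) Y"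
      "restrict f (carrier N) = compose (carrier N) g (aug V)"
    using res assms(1) unfolding right_resolution_def
    by (metis (no_types, lifting) IntD1 hom_group_simps(1) imageE)
  show thesis using that[OF g(1)] compose_eq_restrictD[OF g(2)] by blast
qed

text \<open>Here the augmentation counts as the differential into degree \<open>0\<close>.\<close>

definition kills :: "nat \<Rightarrow> ('u \<Rightarrow> 'u) \<Rightarrow> 'u \<Rightarrow> bool" where
  "kills n f z \<longleftrightarrow> (case n of 0 \<Rightarrow> \<forall>x\<in>carrier N. f (aug V x) = z
     | Suc k \<Rightarrow> \<forall>x\<in>carrier (obj V k). f (diff V k x) = z)"

lemma extend_diff:
  assumes "Y \<in> \<C>" "f \<in> lmod_hom R (obj V n) Y" "kills n f \<zero>\<^bsub>Y\<^esub>"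
  obtains g where "g \<in> lmod_hom R (obj V (Suc n)) Y"
    "\<And>x. x \<in> carrier (obj V n) \<Longrightarrow> g (diff V n x) = f x"
proof (cases n)
  case 0
  have "exact_at (hom_group R (obj V (Suc 0)) Y) (\<lambda>f. compose (carrier (obj V 0)) f (diff V 0))
     (hom_group R (obj V 0) Y) (\<lambda>f. compose (carrier N) f (aug V)) (hom_group R N Y)"
    using res assms(1) unfolding right_resolution_def by auto
  from exact_at_extend[OF this obj_module _ aug_hom, of f] show thesis
    using assms that unfolding 0 kills_def by auto
next
  case (Suc k)
  have "exact_at (hom_group R (obj V (Suc (Suc k))) Y)
     (\<lambda>f. compose (carrier (obj V (Suc k))) f (diff V (Suc k)))
     (hom_group R (obj V (Suc k)) Y) (\<lambda>f. compose (carrier (obj V k)) f (diff V k)) (hom_group R (obj V k) Y)"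
    using res assms(1) unfolding right_resolution_def by auto
  from exact_at_extend[OF this obj_module _ diff_hom, of f] show thesis
    using assms that unfolding Suc kills_def by auto
qed

text \<open>In contrast to the case of left resolutions the full homotopy \<open>e\<^sub>n = h d + g\<close> with \<open>g = d k\<close> is
  recorded, because it has to survive a tensor product, whose cocycles need not come from
  those of \<open>V\<close>. In degree \<open>0\<close> there is no \<open>k\<close>, and \<open>g\<close> is zero.\<close>

lemma null_homotopic:
  assumes e: "\<And>n. e n \<in> lmod_hom R (obj V n) (obj V n)"
    and e_aug: "\<And>x. x \<in> carrier N \<Longrightarrow> e 0 (aug V x) = \<zero>\<^bsub>obj V 0\<^esub>"
    and chain: "\<And>n x. x \<in> carrier (obj V n) \<Longrightarrow> e (Suc n) (diff V n x) = diff V n (e n x)"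
  shows "\<exists>h\<in>lmod_hom R (obj V (Suc n)) (obj V n). \<exists>g\<in>lmod_hom R (obj V n) (obj V n).
    (\<forall>x\<in>carrier (obj V n). e n x = h (diff V n x) \<oplus>\<^bsub>obj V n\<^esub> g x) \<and>
    (case n of 0 \<Rightarrow> (\<forall>x\<in>carrier (obj V 0). g x = \<zero>\<^bsub>obj V 0\<^esub>)
      | Suc m \<Rightarrow> (\<exists>k\<in>lmod_hom R (obj V (Suc m)) (obj V m). \<forall>x\<in>carrier (obj V (Suc m)). g x = diff V m (k x)))"
proof (induction n)
  case 0
  interpret V0: left_module R "obj V 0" by (rule obj_module)
  have "kills 0 (e 0) \<zero>\<^bsub>obj V 0\<^esub>" using e_aug by (simp add: kills_def)
  from extend_diff[OF in_class e this] obtain h where "h \<in> lmod_hom R (obj V (Suc 0)) (obj V 0)"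
    "\<And>x. x \<in> carrier (obj V 0) \<Longrightarrow> h (diff V 0 x) = e 0 x" by blast
  then show ?case
    using lmod_hom_const_zero[OF obj_module obj_module] lmod_hom_closed[OF e]
    by (intro bexI[of _ h] bexI[of _ "\<lambda>x. \<zero>\<^bsub>obj V 0\<^esub>"]) simp_all
next
  case (Suc n)
  then obtain h g where h: "h \<in> lmod_hom R (obj V (Suc n)) (obj V n)"
    and g: "g \<in> lmod_hom R (obj V n) (obj V n)"
    and ehg: "\<And>x. x \<in> carrier (obj V n) \<Longrightarrow> e n x = h (diff V n x) \<oplus>\<^bsub>obj V n\<^esub> g x"
    and gk: "(case n of 0 \<Rightarrow> (\<forall>x\<in>carrier (obj V 0). g x = \<zero>\<^bsub>obj V 0\<^esub>)
      | Suc m \<Rightarrow> (\<exists>k\<in>lmod_hom R (obj V (Suc m)) (obj V m). \<forall>x\<in>carrier (obj V (Suc m)). g x = diff V m (k x)))"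
    by blast
  interpret d: abelian_group_hom "obj V n" "obj V (Suc n)" "diff V n"
    by (rule lmod_hom_abelian_group_hom[OF obj_module obj_module diff_hom])
  have dg: "diff V n (g x) = \<zero>\<^bsub>obj V (Suc n)\<^esub>" if "x \<in> carrier (obj V n)" for x
  proof (cases n)
    case 0
    then show ?thesis using gk that d.hom_zero by simp
  next
    case (Suc m)
    then show ?thesis using gk that diff_diff by (auto dest: lmod_hom_closed)
  qed
  have dh: "(\<lambda>x. diff V n (h x)) \<in> lmod_hom R (obj V (Suc n)) (obj V (Suc n))"
    by (rule lmod_hom_comp[OF h diff_hom])
  let ?f = "\<lambda>x. e (Suc n) x \<ominus>\<^bsub>obj V (Suc n)\<^esub> diff V n (h x)"
  have f: "?f \<in> lmod_hom R (obj V (Suc n)) (obj V (Suc n))"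
    by (rule lmod_hom_pointwise_minus[OF obj_module obj_module e dh])
  have "?f (diff V n x) = \<zero>\<^bsub>obj V (Suc n)\<^esub>" if x: "x \<in> carrier (obj V n)" for x
    using x lmod_hom_closed[OF h] lmod_hom_closed[OF g]
    by (simp add: chain ehg dg a_minus_def d.H.r_neg)
  then have "kills (Suc n) ?f \<zero>\<^bsub>obj V (Suc n)\<^esub>" by (simp add: kills_def)
  from extend_diff[OF in_class f this] obtain h'
    where h': "h' \<in> lmod_hom R (obj V (Suc (Suc n))) (obj V (Suc n))"
      and h'd: "\<And>x. x \<in> carrier (obj V (Suc n)) \<Longrightarrow> h' (diff V (Suc n) x) = ?f x" by blast
  have "e (Suc n) x = h' (diff V (Suc n) x) \<oplus>\<^bsub>obj V (Suc n)\<^esub> diff V n (h x)"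
    if x: "x \<in> carrier (obj V (Suc n))" for x
    unfolding h'd[OF x] using x lmod_hom_closed[OF h] lmod_hom_closed[OF e]
    by (simp add: a_minus_def d.H.a_assoc d.H.l_neg)
  then show ?case using h' dh h by (intro bexI[of _ h'] bexI[of _ "\<lambda>x. diff V n (h x)"]) auto
qed

end

lemma right_resolution_chain_map:
  assumes V: "right_res R \<C> N V" and V': "right_res R \<C> N V'"
  obtains u where "\<And>n. u n \<in> lmod_hom R (obj V n) (obj V' n)"
    "\<And>x. x \<in> carrier N \<Longrightarrow> u 0 (aug V x) = aug V' x"
    "\<And>n x. x \<in> carrier (obj V n) \<Longrightarrow> u (Suc n) (diff V n x) = diff V' n (u n x)"
proof -
  interpret V: right_res R \<C> N V by fact
  interpret V': right_res R \<C> N V' by fact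
  define good where "good n f \<longleftrightarrow> f \<in> lmod_hom R (obj V n) (obj V' n) \<and>
    (n = 0 \<longrightarrow> (\<forall>x\<in>carrier N. f (aug V x) = aug V' x)) \<and>
    V.kills n (\<lambda>x. diff V' n (f x)) \<zero>\<^bsub>obj V' (Suc n)\<^esub>" for n f
  have "\<exists>u. \<forall>n. good n (u n) \<and>
      (\<forall>x\<in>carrier (obj V n). u (Suc n) (diff V n x) = diff V' n (u n x))"
  proof (rule dependent_nat_choice)
    obtain g where "g \<in> lmod_hom R (obj V 0) (obj V' 0)"
      "\<And>x. x \<in> carrier N \<Longrightarrow> g (aug V x) = aug V' x"
      using V.extend_aug[OF V'.in_class V'.aug_hom] by blast
    then show "\<exists>f. good 0 f"
      using V'.diff_aug by (auto simp: good_def V.kills_def)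
  next
    fix f n assume f: "good n f"
    then have fh: "f \<in> lmod_hom R (obj V n) (obj V' n)" by (simp add: good_def)
    have "V.kills n (\<lambda>x. diff V' n (f x)) \<zero>\<^bsub>obj V' (Suc n)\<^esub>" using f by (simp add: good_def)
    from V.extend_diff[OF V'.in_class lmod_hom_comp[OF fh V'.diff_hom] this]
    obtain g where g: "g \<in> lmod_hom R (obj V (Suc n)) (obj V' (Suc n))"
      and gd: "\<And>y. y \<in> carrier (obj V n) \<Longrightarrow> g (diff V n y) = diff V' n (f y)" by blast
    have "good (Suc n) g"
      using g gd lmod_hom_closed[OF fh] V'.diff_diff by (auto simp: good_def V.kills_def)
    then show "\<exists>g. good (Suc n) g \<and> (\<forall>x\<in>carrier (obj V n). g (diff V n x) = diff V' n (f x))"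
      using gd by blast
  qed
  then show thesis using that by (auto simp: good_def)
qed

lemma (in right_res) tensor_complex:
  assumes "right_module R M"
  shows "abelian_group_hom (tensor R M (obj V i)) (tensor R M (obj V (Suc i)))
      (tensor_map R M (obj V (Suc i)) (\<lambda>x. x) (diff V i))"
    and "t \<in> carrier (tensor R M (obj V i)) \<Longrightarrow>
      tensor_map R M (obj V (Suc (Suc i))) (\<lambda>x. x) (diff V (Suc i))
        (tensor_map R M (obj V (Suc i)) (\<lambda>x. x) (diff V i) t) = \<zero>\<^bsub>tensor R M (obj V (Suc (Suc i)))\<^esub>"
proof -
  have tf: "tensor_factors R M (obj V i)" for i
    using assms obj_module by (simp add: tensor_factors_def)
  show "abelian_group_hom (tensor R M (obj V i)) (tensor R M (obj V (Suc i)))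
      (tensor_map R M (obj V (Suc i)) (\<lambda>x. x) (diff V i))"
    by (rule tensor_map_hom[OF tf lmod_hom_id diff_hom tf])
  assume t: "t \<in> carrier (tensor R M (obj V i))"
  show "tensor_map R M (obj V (Suc (Suc i))) (\<lambda>x. x) (diff V (Suc i))
        (tensor_map R M (obj V (Suc i)) (\<lambda>x. x) (diff V i) t) = \<zero>\<^bsub>tensor R M (obj V (Suc (Suc i)))\<^esub>"
    by (subst tensor_map_comp[OF tf tf tf lmod_hom_id diff_hom lmod_hom_id diff_hom t],
        rule tensor_map_zero[OF tf tf lmod_hom_comp[OF diff_hom diff_hom] diff_diff t])
qed

text \<open>The functor \<open>M \<otimes> -\<close> is additive and so turns homotopies into homotopies.\<close>

lemma rel_Tor_resolution_independent:
  fixes V V' :: "('r, 'u, 'n \<Rightarrow> 'u) aug_complex"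
  assumes V: "right_res R \<C> N V" and V': "right_res R \<C> N V'" and M: "right_module R M"
  shows "add_monoid (rel_Tor R M V n) \<cong> add_monoid (rel_Tor R M V' n)"
proof -
  let ?C = "\<lambda>A i. tensor R M (obj A i)" and ?d = "\<lambda>A i. tensor_map R M (obj A (Suc i)) (\<lambda>x. x) (diff A i)"
  have half: "t \<ominus>\<^bsub>?C A n\<^esub> tensor_map R M (obj A n) (\<lambda>x. x) (v n) (tensor_map R M (obj B n) (\<lambda>x. x) (u n) t)
      \<in> coboundaries (?C A) (?d A) n"
    if A: "right_res R \<C> N A" and B: "right_res R \<C> N B"
      and u: "\<And>n. u n \<in> lmod_hom R (obj A n) (obj B n)"
      and ua: "\<And>x. x \<in> carrier N \<Longrightarrow> u 0 (aug A x) = aug B x"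
      and ud: "\<And>n x. x \<in> carrier (obj A n) \<Longrightarrow> u (Suc n) (diff A n x) = diff B n (u n x)"
      and v: "\<And>n. v n \<in> lmod_hom R (obj B n) (obj A n)"
      and va: "\<And>x. x \<in> carrier N \<Longrightarrow> v 0 (aug B x) = aug A x"
      and vd: "\<And>n x. x \<in> carrier (obj B n) \<Longrightarrow> v (Suc n) (diff B n x) = diff A n (v n x)"
      and t: "t \<in> cocycles (?C A) (?d A) n"
    for A B :: "('r, 'u, 'n \<Rightarrow> 'u) aug_complex" and u v t
  proof -
    interpret A: right_res R \<C> N A by fact
    interpret B: right_res R \<C> N B by fact
    interpret An: left_module R "obj A n" by (rule A.obj_module)
    have tA: "tensor_factors R M (obj A i)" for i using M A.obj_module by (simp add: tensor_factors_def)
    have tB: "tensor_factors R M (obj B i)" for i using M B.obj_module by (simp add: tensor_factors_def)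
    interpret TA: tensor_factors R M "obj A n" by (rule tA)
    define e where "e k x = x \<ominus>\<^bsub>obj A k\<^esub> v k (u k x)" for k x
    note vu = lmod_hom_comp[OF u v]
    have e: "e k \<in> lmod_hom R (obj A k) (obj A k)" for k
      unfolding e_def[abs_def]
      by (rule lmod_hom_pointwise_minus[OF A.obj_module A.obj_module lmod_hom_id vu])
    have "e 0 (aug A x) = \<zero>\<^bsub>obj A 0\<^esub>" if x: "x \<in> carrier N" for x
      using abelian_group_minus_eq_zero_iff[OF left_module.axioms(2)[OF A.obj_module]
          lmod_hom_closed[OF A.aug_hom x] lmod_hom_closed[OF A.aug_hom x]] x
      by (simp add: e_def ua va)
    moreover have "e (Suc k) (diff A k x) = diff A k (e k x)" if x: "x \<in> carrier (obj A k)" for k x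
      using abelian_group_hom_minus[OF lmod_hom_abelian_group_hom[OF A.obj_module A.obj_module A.diff_hom]
          x lmod_hom_closed[OF vu x]] lmod_hom_closed[OF u x]
      by (simp add: e_def ud vd x)
    ultimately obtain h g where h: "h \<in> lmod_hom R (obj A (Suc n)) (obj A n)"
      and g: "g \<in> lmod_hom R (obj A n) (obj A n)"
      and ehg: "\<And>x. x \<in> carrier (obj A n) \<Longrightarrow> e n x = h (diff A n x) \<oplus>\<^bsub>obj A n\<^esub> g x"
      and gk: "(case n of 0 \<Rightarrow> (\<forall>x\<in>carrier (obj A 0). g x = \<zero>\<^bsub>obj A 0\<^esub>)
        | Suc m \<Rightarrow> (\<exists>k\<in>lmod_hom R (obj A (Suc m)) (obj A m). \<forall>x\<in>carrier (obj A (Suc m)). g x = diff A m (k x)))"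
      using A.null_homotopic[OF e, of n] by blast
    have t': "t \<in> carrier (?C A n)" and dt: "?d A n t = \<zero>\<^bsub>?C A (Suc n)\<^esub>"
      using t by (auto simp: cocycles_eq)
    let ?m = "tensor_map R M (obj A n) (\<lambda>x. x)"
    have closed: "?m f t \<in> carrier (?C A n)" if "f \<in> lmod_hom R (obj A n) (obj A n)" for f
      using abelian_group_hom.hom_closed[OF tensor_map_hom[OF tA lmod_hom_id that tA] t'] .
    have "?m (\<lambda>x. e n x \<oplus>\<^bsub>obj A n\<^esub> v n (u n x)) t = ?m (\<lambda>x. x) t"
    proof (rule tensor_map_cong[OF tA tA lmod_hom_id
          lmod_hom_pointwise_add[OF A.obj_module A.obj_module e vu] lmod_hom_id _ t'])
      show "e n x \<oplus>\<^bsub>obj A n\<^esub> v n (u n x) = x" if "x \<in> carrier (obj A n)" for x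
        using lmod_hom_closed[OF vu that] that
        by (simp add: e_def a_minus_def An.M.a_assoc An.M.l_neg)
    qed
    also have "\<dots> = t" by (rule tensor_map_id[OF tA t'])
    finally have "?m (\<lambda>x. e n x \<oplus>\<^bsub>obj A n\<^esub> v n (u n x)) t = t" .
    then have sum: "?m (e n) t \<oplus>\<^bsub>?C A n\<^esub> ?m (\<lambda>x. v n (u n x)) t = t"
      unfolding tensor_map_add[OF tA tA e vu t'] .
    have "(?m (e n) t \<oplus>\<^bsub>?C A n\<^esub> ?m (\<lambda>x. v n (u n x)) t) \<ominus>\<^bsub>?C A n\<^esub> ?m (\<lambda>x. v n (u n x)) t = ?m (e n) t"
      using closed[OF e] closed[OF vu] by (simp add: a_minus_def TA.T.a_assoc TA.T.r_neg)
    then have "t \<ominus>\<^bsub>?C A n\<^esub> ?m (\<lambda>x. v n (u n x)) t = ?m (e n) t"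
      unfolding sum .
    also have "\<dots> = ?m (\<lambda>x. h (diff A n x) \<oplus>\<^bsub>obj A n\<^esub> g x) t"
      by (rule tensor_map_cong[OF tA tA lmod_hom_id e
            lmod_hom_pointwise_add[OF A.obj_module A.obj_module lmod_hom_comp[OF A.diff_hom h] g] ehg t'])
    also have "\<dots> = ?m (\<lambda>x. h (diff A n x)) t \<oplus>\<^bsub>?C A n\<^esub> ?m g t"
      by (rule tensor_map_add[OF tA tA lmod_hom_comp[OF A.diff_hom h] g t'])
    also have "?m (\<lambda>x. h (diff A n x)) t = ?m h (?d A n t)"
      using tensor_map_comp[OF tA tA tA lmod_hom_id A.diff_hom lmod_hom_id h t'] by simp
    also have "\<dots> = \<zero>\<^bsub>?C A n\<^esub>"
      unfolding dt by (rule abelian_group_hom.hom_zero[OF tensor_map_hom[OF tA lmod_hom_id h tA]])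
    also have "\<zero>\<^bsub>?C A n\<^esub> \<oplus>\<^bsub>?C A n\<^esub> ?m g t = ?m g t" using closed[OF g] by simp
    finally have eq: "t \<ominus>\<^bsub>?C A n\<^esub> ?m (v n) (tensor_map R M (obj B n) (\<lambda>x. x) (u n) t) = ?m g t"
      unfolding tensor_map_comp[OF tA tB tA lmod_hom_id u lmod_hom_id v t'] .
    show ?thesis
    proof (cases n)
      case 0
      then show ?thesis
        unfolding eq using gk tensor_map_zero[OF tA tA g _ t'] by (simp add: coboundaries_def)
    next
      case (Suc m)
      then obtain k where k: "k \<in> lmod_hom R (obj A (Suc m)) (obj A m)"
        "\<And>x. x \<in> carrier (obj A (Suc m)) \<Longrightarrow> g x = diff A m (k x)" using gk by auto
      have "?m g t = ?m (\<lambda>x. diff A m (k x)) t"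
        by (rule tensor_map_cong[OF tA tA lmod_hom_id g _ _ t'])
           (use k(2) lmod_hom_comp[OF k(1) A.diff_hom] in \<open>simp_all only: Suc\<close>)
      also have "\<dots> = ?d A m (tensor_map R M (obj A m) (\<lambda>x. x) k t)"
        using tensor_map_comp[OF tA tA tA lmod_hom_id k(1) lmod_hom_id A.diff_hom, of t] t' Suc by simp
      finally show ?thesis
        unfolding eq
        using abelian_group_hom.hom_closed[OF tensor_map_hom[OF tA lmod_hom_id k(1) tA], of t] t' Suc
        by (simp add: coboundaries_def)
    qed
  qed
  have maps: "tensor_map R M (obj B n) (\<lambda>x. x) (u n) ` cocycles (?C A) (?d A) n \<subseteq> cocycles (?C B) (?d B) n"
      "tensor_map R M (obj B n) (\<lambda>x. x) (u n) ` coboundaries (?C A) (?d A) n \<subseteq> coboundaries (?C B) (?d B) n"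
      "abelian_group_hom (?C A n) (?C B n) (tensor_map R M (obj B n) (\<lambda>x. x) (u n))"
    if A: "right_res R \<C> N A" and B: "right_res R \<C> N B"
      and u: "\<And>n. u n \<in> lmod_hom R (obj A n) (obj B n)"
      and ud: "\<And>n x. x \<in> carrier (obj A n) \<Longrightarrow> u (Suc n) (diff A n x) = diff B n (u n x)"
    for A B :: "('r, 'u, 'n \<Rightarrow> 'u) aug_complex" and u
  proof -
    interpret A: right_res R \<C> N A by fact
    interpret B: right_res R \<C> N B by fact
    have tA: "tensor_factors R M (obj A i)" for i using M A.obj_module by (simp add: tensor_factors_def)
    have tB: "tensor_factors R M (obj B i)" for i using M B.obj_module by (simp add: tensor_factors_def)
    let ?u = "\<lambda>n. tensor_map R M (obj B n) (\<lambda>x. x) (u n)"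
    have hom: "abelian_group_hom (?C A n) (?C B n) (?u n)" for n
      by (rule tensor_map_hom[OF tA lmod_hom_id u tB])
    then show "abelian_group_hom (?C A n) (?C B n) (?u n)" .
    have comm: "?u (Suc n) (?d A n t) = ?d B n (?u n t)" if t: "t \<in> carrier (?C A n)" for n t
      using tensor_map_comp[OF tA tA tB lmod_hom_id A.diff_hom lmod_hom_id u t]
        tensor_map_comp[OF tA tB tB lmod_hom_id u lmod_hom_id B.diff_hom t]
        tensor_map_cong[OF tA tB lmod_hom_id lmod_hom_comp[OF A.diff_hom u] lmod_hom_comp[OF u B.diff_hom] ud t]
      by simp
    show "?u n ` cocycles (?C A) (?d A) n \<subseteq> cocycles (?C B) (?d B) n"
      using abelian_group_hom.hom_closed[OF hom] abelian_group_hom.hom_zero[OF hom]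
      by (auto simp: cocycles_eq comm[symmetric])
    show "?u n ` coboundaries (?C A) (?d A) n \<subseteq> coboundaries (?C B) (?d B) n"
    proof (cases n)
      case 0
      then show ?thesis using abelian_group_hom.hom_zero[OF hom, of 0] by (simp add: coboundaries_def)
    next
      case (Suc m)
      then show ?thesis
        using abelian_group_hom.hom_closed[OF hom, of _ m] comm[of _ m] by (auto simp: coboundaries_def)
    qed
  qed
  interpret V: right_res R \<C> N V by fact
  interpret V': right_res R \<C> N V' by fact
  obtain u where u: "\<And>n. u n \<in> lmod_hom R (obj V n) (obj V' n)"
    "\<And>x. x \<in> carrier N \<Longrightarrow> u 0 (aug V x) = aug V' x"
    "\<And>n x. x \<in> carrier (obj V n) \<Longrightarrow> u (Suc n) (diff V n x) = diff V' n (u n x)"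
    using right_resolution_chain_map[OF V V'] by blast
  obtain v where v: "\<And>n. v n \<in> lmod_hom R (obj V' n) (obj V n)"
    "\<And>x. x \<in> carrier N \<Longrightarrow> v 0 (aug V' x) = aug V x"
    "\<And>n x. x \<in> carrier (obj V' n) \<Longrightarrow> v (Suc n) (diff V' n x) = diff V n (v n x)"
    using right_resolution_chain_map[OF V' V] by blast
  show ?thesis
    unfolding rel_Tor_def cohomology_def
    by (rule subquot_iso_mutual[where \<alpha> = "tensor_map R M (obj V' n) (\<lambda>x. x) (u n)"
          and \<beta> = "tensor_map R M (obj V n) (\<lambda>x. x) (v n)"])
       (rule cochain_complex_subgroups V.tensor_complex[OF M] V'.tensor_complex[OF M]
         maps[OF V V' u(1,3)] maps[OF V' V v(1,3)]
         half[OF V V' u v] half[OF V' V v u] | assumption)+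
qed


section \<open>Free modules and the lifting property of projective modules\<close>

text \<open>Families with finite support. They vanish outside \<open>I\<close>, so that equality of functions is equality
  of families.\<close>

definition free_module :: "('s, 'x) ring_scheme \<Rightarrow> 'i set \<Rightarrow> ('s, 'i \<Rightarrow> 's) module" where
  "free_module S I = \<lparr>carrier = {c. c ` I \<subseteq> carrier S \<and> {i. c i \<noteq> \<zero>\<^bsub>S\<^esub>} \<subseteq> I \<and> finite {i. c i \<noteq> \<zero>\<^bsub>S\<^esub>}},
     monoid.mult = undefined, one = undefined, ring.zero = (\<lambda>i. \<zero>\<^bsub>S\<^esub>),
     ring.add = (\<lambda>c d i. c i \<oplus>\<^bsub>S\<^esub> d i), smult = (\<lambda>s c i. s \<otimes>\<^bsub>S\<^esub> c i)\<rparr>"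

text \<open>As a function of \<open>c\<close> this is the homomorphism from the free module that maps the basis to the
  family \<open>a\<close>.\<close>

definition lin_comb :: "('s, 'x) ring_scheme \<Rightarrow> ('s, 'm, 'z) module_scheme \<Rightarrow> ('i \<Rightarrow> 'm) \<Rightarrow> ('i \<Rightarrow> 's) \<Rightarrow> 'm" where
  "lin_comb S M a c = finsum M (\<lambda>i. c i \<odot>\<^bsub>M\<^esub> a i) {i. c i \<noteq> \<zero>\<^bsub>S\<^esub>}"

lemma hom_finsum:
  assumes "abelian_group_hom G H f" "finite J" "u \<in> J \<rightarrow> carrier G"
  shows "f (finsum G u J) = finsum H (\<lambda>j. f (u j)) J"
proof -
  interpret abelian_group_hom G H f by fact
  show ?thesis
    using assms(2,3)
  proof (induction J rule: finite_induct)
    case (insert j J)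
    then have u: "u \<in> J \<rightarrow> carrier G" "u j \<in> carrier G" by auto
    then have fu: "(\<lambda>j. f (u j)) \<in> J \<rightarrow> carrier H" by (auto simp: Pi_iff)
    show ?case using insert u fu by (simp add: G.finsum_insert H.finsum_insert)
  qed simp
qed

context left_module
begin

lemma free_module_simps:
  "carrier (free_module R I) =
     {c. c ` I \<subseteq> carrier R \<and> {i. c i \<noteq> \<zero>\<^bsub>R\<^esub>} \<subseteq> I \<and> finite {i. c i \<noteq> \<zero>\<^bsub>R\<^esub>}}"
  "\<zero>\<^bsub>free_module R I\<^esub> = (\<lambda>i. \<zero>\<^bsub>R\<^esub>)" "c \<oplus>\<^bsub>free_module R I\<^esub> d = (\<lambda>i. c i \<oplus>\<^bsub>R\<^esub> d i)"
  "s \<odot>\<^bsub>free_module R I\<^esub> c = (\<lambda>i. s \<otimes>\<^bsub>R\<^esub> c i)"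
  by (simp_all add: free_module_def)

lemma free_module_coeff: "c \<in> carrier (free_module R I) \<Longrightarrow> c i \<in> carrier R"
  by (cases "i \<in> I"; cases "c i = \<zero>\<^bsub>R\<^esub>") (auto simp: free_module_simps)

lemma free_module_carrierI:
  assumes "\<And>i. i \<in> I \<Longrightarrow> c i \<in> carrier R" "finite J" "J \<subseteq> I" "\<And>i. i \<notin> J \<Longrightarrow> c i = \<zero>\<^bsub>R\<^esub>"
  shows "c \<in> carrier (free_module R I)"
proof -
  have "{i. c i \<noteq> \<zero>\<^bsub>R\<^esub>} \<subseteq> J" using assms(4) by auto
  then show ?thesis using assms finite_subset by (auto simp: free_module_simps)
qed

lemma free_module_support:
  "c \<in> carrier (free_module R I) \<Longrightarrow> finite {i. c i \<noteq> \<zero>\<^bsub>R\<^esub>} \<and> {i. c i \<noteq> \<zero>\<^bsub>R\<^esub>} \<subseteq> I"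
  by (simp add: free_module_simps)

lemma free_module_add_closed:
  assumes "c \<in> carrier (free_module R I)" "d \<in> carrier (free_module R I)"
  shows "(\<lambda>i. c i \<oplus>\<^bsub>R\<^esub> d i) \<in> carrier (free_module R I)"
  using free_module_coeff[OF assms(1)] free_module_coeff[OF assms(2)]
    free_module_support[OF assms(1)] free_module_support[OF assms(2)]
  by (intro free_module_carrierI[of _ _ "{i. c i \<noteq> \<zero>\<^bsub>R\<^esub>} \<union> {i. d i \<noteq> \<zero>\<^bsub>R\<^esub>}"]) auto

lemma free_module_smult_closed:
  assumes "c \<in> carrier (free_module R I)" "s \<in> carrier R"
  shows "(\<lambda>i. s \<otimes>\<^bsub>R\<^esub> c i) \<in> carrier (free_module R I)"
  using free_module_coeff[OF assms(1)] free_module_support[OF assms(1)] assms(2)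
  by (intro free_module_carrierI[of _ _ "{i. c i \<noteq> \<zero>\<^bsub>R\<^esub>}"]) auto

lemma free_module_left_module: "left_module R (free_module R I)"
proof (rule left_moduleI)
  show "abelian_group (free_module R I)"
  proof (rule abelian_groupI)
    fix c assume c: "c \<in> carrier (free_module R I)"
    have "(\<lambda>i. \<ominus>\<^bsub>R\<^esub> c i) \<in> carrier (free_module R I)"
      using free_module_coeff[OF c] free_module_support[OF c]
      by (intro free_module_carrierI[of _ _ "{i. c i \<noteq> \<zero>\<^bsub>R\<^esub>}"]) auto
    then show "\<exists>d\<in>carrier (free_module R I). d \<oplus>\<^bsub>free_module R I\<^esub> c = \<zero>\<^bsub>free_module R I\<^esub>"
      using free_module_coeff[OF c]
      by (intro bexI[of _ "\<lambda>i. \<ominus>\<^bsub>R\<^esub> c i"]) (simp_all add: free_module_simps(2-4) R.l_neg)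
  next
    show "\<zero>\<^bsub>free_module R I\<^esub> \<in> carrier (free_module R I)" by (auto simp: free_module_simps)
  qed (simp_all add: free_module_simps(2-4) free_module_add_closed free_module_coeff R.a_ac)
qed (simp_all add: free_module_simps(2-4) free_module_smult_closed free_module_coeff R.ring_axioms
    R.l_distr R.r_distr R.m_assoc)

lemma lin_comb_eq_finsum:
  assumes "a \<in> I \<rightarrow> carrier M" "c \<in> carrier (free_module R I)"
    and "finite J" "J \<subseteq> I" "{i. c i \<noteq> \<zero>\<^bsub>R\<^esub>} \<subseteq> J"
  shows "lin_comb R M a c = finsum M (\<lambda>i. c i \<odot>\<^bsub>M\<^esub> a i) J"
  unfolding lin_comb_def
proof (rule M.add.finprod_mono_neutral_cong_left[OF assms(3,5)])
  show "\<And>i. i \<in> J - {i. c i \<noteq> \<zero>\<^bsub>R\<^esub>} \<Longrightarrow> c i \<odot>\<^bsub>M\<^esub> a i = \<zero>\<^bsub>M\<^esub>"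
    using assms(1,4) smult_l_null by auto
  show "(\<lambda>i. c i \<odot>\<^bsub>M\<^esub> a i) \<in> J \<rightarrow> carrier M"
    using assms(1,4) free_module_coeff[OF assms(2)] by auto
qed simp

lemma lin_comb_hom:
  assumes a: "a \<in> I \<rightarrow> carrier M"
  shows "lin_comb R M a \<in> lmod_hom R (free_module R I) M"
proof (rule lmod_homI)
  fix c assume c: "c \<in> carrier (free_module R I)"
  have cJ: "finite {i. c i \<noteq> \<zero>\<^bsub>R\<^esub>}" "{i. c i \<noteq> \<zero>\<^bsub>R\<^esub>} \<subseteq> I" using c by (auto simp: free_module_simps)
  have trm: "c i \<odot>\<^bsub>M\<^esub> a i \<in> carrier M" if "i \<in> I" for i
    using that a free_module_coeff[OF c] by auto
  then have terms: "(\<lambda>i. c i \<odot>\<^bsub>M\<^esub> a i) \<in> {i. c i \<noteq> \<zero>\<^bsub>R\<^esub>} \<rightarrow> carrier M" using cJ(2) by auto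
  then show "lin_comb R M a c \<in> carrier M" unfolding lin_comb_def by (rule M.finsum_closed)
  show "lin_comb R M a (s \<odot>\<^bsub>free_module R I\<^esub> c) = s \<odot>\<^bsub>M\<^esub> lin_comb R M a c" if s: "s \<in> carrier R" for s
  proof -
    have smult: "abelian_group_hom M M (\<lambda>x. s \<odot>\<^bsub>M\<^esub> x)"
      using s by (intro abelian_group_hom_intro M.abelian_group_axioms) (auto simp: smult_r_distr)
    have "lin_comb R M a (\<lambda>i. s \<otimes>\<^bsub>R\<^esub> c i)
        = finsum M (\<lambda>i. (s \<otimes>\<^bsub>R\<^esub> c i) \<odot>\<^bsub>M\<^esub> a i) {i. c i \<noteq> \<zero>\<^bsub>R\<^esub>}"
      by (rule lin_comb_eq_finsum[OF a free_module_smult_closed[OF c s] cJ]) (use s in auto)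
    also have "\<dots> = finsum M (\<lambda>i. s \<odot>\<^bsub>M\<^esub> (c i \<odot>\<^bsub>M\<^esub> a i)) {i. c i \<noteq> \<zero>\<^bsub>R\<^esub>}"
      using a cJ(2) s free_module_coeff[OF c] trm
      by (intro M.finsum_cong') (auto simp: smult_assoc1 subset_iff Pi_iff)
    also have "\<dots> = s \<odot>\<^bsub>M\<^esub> lin_comb R M a c"
      unfolding lin_comb_def by (rule hom_finsum[OF smult cJ(1) terms, symmetric])
    finally show ?thesis by (simp add: free_module_simps)
  qed
  fix d assume d: "d \<in> carrier (free_module R I)"
  let ?J = "{i. c i \<noteq> \<zero>\<^bsub>R\<^esub>} \<union> {i. d i \<noteq> \<zero>\<^bsub>R\<^esub>}"
  have J: "finite ?J" "?J \<subseteq> I" using c d by (auto simp: free_module_simps)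
  have termd: "d i \<odot>\<^bsub>M\<^esub> a i \<in> carrier M" if "i \<in> I" for i
    using that a free_module_coeff[OF d] by auto
  have "lin_comb R M a (\<lambda>i. c i \<oplus>\<^bsub>R\<^esub> d i) = finsum M (\<lambda>i. (c i \<oplus>\<^bsub>R\<^esub> d i) \<odot>\<^bsub>M\<^esub> a i) ?J"
    by (rule lin_comb_eq_finsum[OF a free_module_add_closed[OF c d] J]) auto
  also have "\<dots> = finsum M (\<lambda>i. c i \<odot>\<^bsub>M\<^esub> a i \<oplus>\<^bsub>M\<^esub> d i \<odot>\<^bsub>M\<^esub> a i) ?J"
    using a J(2) free_module_coeff[OF c] free_module_coeff[OF d] trm termd
    by (intro M.finsum_cong') (auto simp: smult_l_distr subset_iff Pi_iff)
  also have "\<dots> = finsum M (\<lambda>i. c i \<odot>\<^bsub>M\<^esub> a i) ?J \<oplus>\<^bsub>M\<^esub> finsum M (\<lambda>i. d i \<odot>\<^bsub>M\<^esub> a i) ?J"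
    using trm termd J(2) by (intro M.finsum_addf) auto
  also have "\<dots> = lin_comb R M a c \<oplus>\<^bsub>M\<^esub> lin_comb R M a d"
    by (subst (1 2) lin_comb_eq_finsum[OF a _ J, symmetric]) (use c d in auto)
  finally show "lin_comb R M a (c \<oplus>\<^bsub>free_module R I\<^esub> d) = lin_comb R M a c \<oplus>\<^bsub>M\<^esub> lin_comb R M a d"
    by (simp add: free_module_simps)
qed

lemma lin_comb_basis:
  assumes "a \<in> I \<rightarrow> carrier M" "i \<in> I"
  obtains c where "c \<in> carrier (free_module R I)" "lin_comb R M a c = a i"
proof -
  let ?c = "\<lambda>j. if j = i then \<one>\<^bsub>R\<^esub> else \<zero>\<^bsub>R\<^esub>"
  have c: "?c \<in> carrier (free_module R I)"
    by (rule free_module_carrierI[of _ _ "{i}"]) (use assms(2) in auto)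
  \<comment> \<open>The sum is over \<open>{i}\<close> and not over the support of \<open>?c\<close>, which is empty in the zero ring.\<close>
  have "lin_comb R M a ?c = finsum M (\<lambda>j. ?c j \<odot>\<^bsub>M\<^esub> a j) {i}"
    by (rule lin_comb_eq_finsum[OF assms(1) c]) (use assms(2) in auto)
  also have "\<dots> = a i"
    using assms by (subst M.finsum_insert) (auto simp: Pi_iff)
  finally show thesis using that[OF c] by blast
qed

lemma lin_comb_submodule:
  assumes "submodule K R M" "a ` I \<subseteq> K" "c \<in> carrier (free_module R I)"
  shows "lin_comb R M a c \<in> K"
proof -
  interpret K: abelian_subgroup K M by (rule submodule_abelian_subgroup[OF left_module_axioms assms(1)])
  have "finsum M (\<lambda>i. c i \<odot>\<^bsub>M\<^esub> a i) J \<in> K" if "finite J" "J \<subseteq> I" for J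
    using that
  proof (induction J rule: finite_induct)
    case (insert j J)
    have K: "c i \<odot>\<^bsub>M\<^esub> a i \<in> K" if "i \<in> I" for i
      using submodule.smult_closed[OF assms(1) free_module_coeff[OF assms(3)]] assms(2) that by auto
    then have "(\<lambda>i. c i \<odot>\<^bsub>M\<^esub> a i) \<in> J \<rightarrow> carrier M" "c j \<odot>\<^bsub>M\<^esub> a j \<in> carrier M"
      using insert.prems K.a_Hcarr by auto
    then show ?case using insert K by (simp add: M.finsum_insert)
  qed simp
  then show ?thesis using assms(3) by (auto simp: lin_comb_def free_module_simps)
qed

end

lemma hom_lin_comb:
  assumes M: "left_module S M" and N: "left_module S N" and g: "g \<in> lmod_hom S M N"
    and a: "a \<in> I \<rightarrow> carrier M" and c: "c \<in> carrier (free_module S I)"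
  shows "g (lin_comb S M a c) = lin_comb S N (\<lambda>i. g (a i)) c"
proof -
  interpret M: left_module S M by fact
  interpret N: left_module S N by fact
  have cJ: "finite {i. c i \<noteq> \<zero>\<^bsub>S\<^esub>}" "{i. c i \<noteq> \<zero>\<^bsub>S\<^esub>} \<subseteq> I" using c by (auto simp: M.free_module_simps)
  have "g (lin_comb S M a c) = finsum N (\<lambda>i. g (c i \<odot>\<^bsub>M\<^esub> a i)) {i. c i \<noteq> \<zero>\<^bsub>S\<^esub>}"
    unfolding lin_comb_def using a cJ M.free_module_coeff[OF c]
    by (intro hom_finsum[OF lmod_hom_abelian_group_hom[OF M N g]]) auto
  also have "\<dots> = lin_comb S N (\<lambda>i. g (a i)) c"
    unfolding lin_comb_def using a cJ M.free_module_coeff[OF c] lmod_hom_closed[OF g]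
    by (intro N.M.finsum_cong') (auto simp: lmod_hom_smult[OF g] subset_iff Pi_iff)
  finally show ?thesis .
qed

text \<open>The given instance of the lifting property splits the epimorphism onto \<open>P\<close> from the free
  module on \<open>carrier P\<close>, and a map out of a free module is lifted by lifting the images of a basis.
  The modules \<open>A\<close> and \<open>B\<close> may thus live in arbitrary types.\<close>

lemma projective_lift:
  assumes P: "projective S P" and A: "left_module S A" and B: "left_module S B"
    and g: "g \<in> lmod_hom S A B" and surj: "g ` carrier A = carrier B" and f: "f \<in> lmod_hom S P B"
  obtains h where "h \<in> lmod_hom S P A" "\<And>x. x \<in> carrier P \<Longrightarrow> g (h x) = f x"
proof -
  have Pm: "left_module S P" using P by (simp add: projective_def)
  interpret P: left_module S P by (rule Pm)
  interpret A: left_module S A by (rule A)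
  let ?F = "free_module S (carrier P)"
  have id: "(\<lambda>x. x) \<in> carrier P \<rightarrow> carrier P" by simp
  have e: "lin_comb S P (\<lambda>x. x) \<in> lmod_hom S ?F P" by (rule P.lin_comb_hom[OF id])
  have "lin_comb S P (\<lambda>x. x) ` carrier ?F = carrier P"
  proof
    show "carrier P \<subseteq> lin_comb S P (\<lambda>x. x) ` carrier ?F"
      using P.lin_comb_basis[OF id] by (metis image_eqI subsetI)
  qed (use lmod_hom_closed[OF e] in auto)
  then obtain s where s: "s \<in> lmod_hom S P ?F"
    and es: "\<And>x. x \<in> carrier P \<Longrightarrow> lin_comb S P (\<lambda>x. x) (s x) = x"
    using P e P.free_module_left_module Pm lmod_hom_id[of S P] unfolding projective_def by metis
  define a where "a x = (SOME y. y \<in> carrier A \<and> g y = f x)" for x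
  have a: "a x \<in> carrier A \<and> g (a x) = f x" if "x \<in> carrier P" for x
  proof -
    have "\<exists>y. y \<in> carrier A \<and> g y = f x" using lmod_hom_closed[OF f that] surj by (metis imageE)
    then show ?thesis unfolding a_def by (rule someI_ex)
  qed
  then have aP: "a \<in> carrier P \<rightarrow> carrier A" by auto
  show thesis
  proof (rule that)
    show "(\<lambda>x. lin_comb S A a (s x)) \<in> lmod_hom S P A"
      by (rule lmod_hom_comp[OF s A.lin_comb_hom[OF aP]])
    fix x assume x: "x \<in> carrier P"
    note sx = lmod_hom_closed[OF s x]
    have "g (lin_comb S A a (s x)) = lin_comb S B (\<lambda>i. g (a i)) (s x)"
      by (rule hom_lin_comb[OF A B g aP sx])
    also have "\<dots> = lin_comb S B f (s x)"
    proof -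
      have "{i. s x i \<noteq> \<zero>\<^bsub>S\<^esub>} \<subseteq> carrier P" using sx by (auto simp: P.free_module_simps)
      then show ?thesis
        unfolding lin_comb_def using a lmod_hom_closed[OF f] P.free_module_coeff[OF sx]
        by (intro abelian_monoid.finsum_cong')
           (use B in \<open>auto simp: left_module_def abelian_group_def subset_iff
             intro!: left_module.smult_closed[OF B]\<close>)
    qed
    also have "\<dots> = f (lin_comb S P (\<lambda>x. x) (s x))"
      using hom_lin_comb[OF Pm B f id sx] by simp
    also have "\<dots> = f x" using es[OF x] by simp
    finally show "g (lin_comb S A a (s x)) = f x" .
  qed
qed


section \<open>Right exactness of the tensor product\<close>

lemma tensor_map_surj:
  assumes LB: "tensor_factors S L B" and LC: "tensor_factors S L C"
    and g: "g \<in> lmod_hom S B C" and surj: "g ` carrier B = carrier C"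
  shows "tensor_map S L C (\<lambda>x. x) g ` carrier (tensor S L B) = carrier (tensor S L C)"
proof
  interpret LB: tensor_factors S L B by fact
  interpret LC: tensor_factors S L C by fact
  interpret m: abelian_group_hom "tensor S L B" "tensor S L C" "tensor_map S L C (\<lambda>x. x) g"
    by (rule tensor_map_hom[OF LB lmod_hom_id g LC])
  show "tensor_map S L C (\<lambda>x. x) g ` carrier (tensor S L B) \<subseteq> carrier (tensor S L C)" by auto
  show "carrier (tensor S L C) \<subseteq> tensor_map S L C (\<lambda>x. x) g ` carrier (tensor S L B)"
  proof
    fix t assume "t \<in> carrier (tensor S L C)"
    then show "t \<in> tensor_map S L C (\<lambda>x. x) g ` carrier (tensor S L B)"
    proof (induction rule: LC.tensor_induct)
      case (pure l c)
      then obtain b where b: "b \<in> carrier B" "c = g b" using surj by auto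
      then show ?case
        using pure tensor_map_pure[OF LB lmod_hom_id g LC pure(1) b(1)] LB.pure_closed[OF pure(1) b(1)]
        by (metis imageI)
    next
      case (add x y)
      then obtain u v where "u \<in> carrier (tensor S L B)" "v \<in> carrier (tensor S L B)"
        "x = tensor_map S L C (\<lambda>x. x) g u" "y = tensor_map S L C (\<lambda>x. x) g v" by auto
      then show ?case using m.hom_add LB.T.add.m_closed by (metis imageI)
    qed
  qed
qed

lemma (in tensor_factors) pure_minus_right:
  assumes "a \<in> carrier A" "b \<in> carrier B" "b' \<in> carrier B"
  shows "a \<diamondop> (b \<ominus>\<^bsub>B\<^esub> b') = a \<diamondop> b \<ominus>\<^bsub>T\<^esub> a \<diamondop> b'"
proof -
  have "abelian_group_hom B T (\<lambda>b. a \<diamondop> b)"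
    by (rule abelian_group_hom_intro[OF B.M.abelian_group_axioms abelian_group_T])
       (use assms(1) pure_add_right in auto)
  from abelian_group_hom_minus[OF this assms(2,3)] show ?thesis .
qed

text \<open>The inverse of the map that \<open>L \<otimes> B \<rightarrow> L \<otimes> C\<close> induces on the quotient by the image \<open>K\<close> of
  \<open>L \<otimes> A\<close> sends \<open>l \<otimes> g b\<close> to the class of \<open>l \<otimes> b\<close>.\<close>

lemma tensor_right_exact:
  assumes LA: "tensor_factors S L A" and LB: "tensor_factors S L B" and LC: "tensor_factors S L C"
    and i: "i \<in> lmod_hom S A B" and g: "g \<in> lmod_hom S B C" and surj: "g ` carrier B = carrier C"
    and ker: "\<And>b. \<lbrakk>b \<in> carrier B; g b = \<zero>\<^bsub>C\<^esub>\<rbrakk> \<Longrightarrow> b \<in> i ` carrier A"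
    and t: "t \<in> carrier (tensor S L B)" and zero: "tensor_map S L C (\<lambda>x. x) g t = \<zero>\<^bsub>tensor S L C\<^esub>"
  shows "t \<in> tensor_map S L B (\<lambda>x. x) i ` carrier (tensor S L A)"
proof -
  interpret LA: tensor_factors S L A by fact
  interpret LB: tensor_factors S L B by fact
  interpret LC: tensor_factors S L C by fact
  define K where "K = tensor_map S L B (\<lambda>x. x) i ` carrier (tensor S L A)"
  have K: "abelian_subgroup K (tensor S L B)"
    unfolding K_def by (rule abelian_group_hom_image[OF tensor_map_hom[OF LA lmod_hom_id i LB]])
  interpret K: abelian_subgroup K "tensor S L B" by (rule K)
  define Q where "Q = subquot (tensor S L B) (carrier (tensor S L B)) K"
  have whole: "abelian_subgroup (carrier (tensor S L B)) (tensor S L B)"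
    by (rule abelian_subgroup_intro[OF LB.abelian_group_T]) auto
  have Q: "abelian_group Q" unfolding Q_def by (rule subquot_abelian_group[OF K whole])
  interpret Q: abelian_group Q by (rule Q)
  let ?q = "\<lambda>t. K +>\<^bsub>tensor S L B\<^esub> t"
  have q: "abelian_group_hom (tensor S L B) Q ?q"
    by (rule abelian_group_hom_intro[OF LB.abelian_group_T Q])
       (auto simp: Q_def subquot_def K.a_rcos_sum)
  define \<sigma> where "\<sigma> c = (SOME b. b \<in> carrier B \<and> g b = c)" for c
  have \<sigma>: "\<sigma> c \<in> carrier B \<and> g (\<sigma> c) = c" if "c \<in> carrier C" for c
  proof -
    have "\<exists>b. b \<in> carrier B \<and> g b = c" using that surj by (metis imageE)
    then show ?thesis unfolding \<sigma>_def by (rule someI_ex)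
  qed
  have wd: "?q (pure_tensor S L B l b) = ?q (pure_tensor S L B l b')"
    if l: "l \<in> carrier L" and b: "b \<in> carrier B" "b' \<in> carrier B" and eq: "g b = g b'" for l b b'
  proof -
    have "g (b \<ominus>\<^bsub>B\<^esub> b') = \<zero>\<^bsub>C\<^esub>"
      using abelian_group_hom_minus[OF lmod_hom_abelian_group_hom[OF LB.left LC.left g] b] eq
        lmod_hom_closed[OF g b(2)] by (simp add: a_minus_def LC.B.M.r_neg)
    then obtain a where a: "a \<in> carrier A" "b \<ominus>\<^bsub>B\<^esub> b' = i a"
      using ker[of "b \<ominus>\<^bsub>B\<^esub> b'"] b by (auto simp: a_minus_def)
    have "pure_tensor S L B l (b \<ominus>\<^bsub>B\<^esub> b') \<in> K"
      unfolding K_def a(2) tensor_map_pure[OF LA lmod_hom_id i LB l a(1), symmetric]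
      by (rule imageI[OF LA.pure_closed[OF l a(1)]])
    then show ?thesis
      using coset_eq_iff[OF K] LB.pure_minus_right[OF l b] l b by simp
  qed
  have q\<sigma>: "?q (pure_tensor S L B l (\<sigma> (g b))) = ?q (pure_tensor S L B l b)"
    if "l \<in> carrier L" "b \<in> carrier B" for l b
    using wd[OF that(1) _ that(2)] \<sigma>[OF lmod_hom_closed[OF g that(2)]] by blast
  obtain h where h: "abelian_group_hom (tensor S L C) Q h"
    and h_pure: "\<And>l c. \<lbrakk>l \<in> carrier L; c \<in> carrier C\<rbrakk> \<Longrightarrow> h (pure_tensor S L C l c) = ?q (pure_tensor S L B l (\<sigma> c))"
  proof (rule LC.tensor_universal[OF Q, where \<beta> = "\<lambda>l c. ?q (pure_tensor S L B l (\<sigma> c))"])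
    fix l c assume l: "l \<in> carrier L" and c: "c \<in> carrier C"
    show "?q (pure_tensor S L B l (\<sigma> c)) \<in> carrier Q"
      using abelian_group_hom.hom_closed[OF q] l \<sigma>[OF c] by blast
    show "?q (pure_tensor S L B (l \<oplus>\<^bsub>L\<^esub> l') (\<sigma> c))
        = ?q (pure_tensor S L B l (\<sigma> c)) \<oplus>\<^bsub>Q\<^esub> ?q (pure_tensor S L B l' (\<sigma> c))"
      if "l' \<in> carrier L" for l'
      using abelian_group_hom.hom_add[OF q] l that \<sigma>[OF c] by (simp add: LB.pure_add_left)
    show "?q (pure_tensor S L B l (\<sigma> (c \<oplus>\<^bsub>C\<^esub> c')))
        = ?q (pure_tensor S L B l (\<sigma> c)) \<oplus>\<^bsub>Q\<^esub> ?q (pure_tensor S L B l (\<sigma> c'))"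
      if c': "c' \<in> carrier C" for c'
    proof -
      have "c \<oplus>\<^bsub>C\<^esub> c' = g (\<sigma> c \<oplus>\<^bsub>B\<^esub> \<sigma> c')"
        using \<sigma>[OF c] \<sigma>[OF c'] by (simp add: lmod_hom_add[OF g])
      then have "?q (pure_tensor S L B l (\<sigma> (c \<oplus>\<^bsub>C\<^esub> c'))) = ?q (pure_tensor S L B l (\<sigma> c \<oplus>\<^bsub>B\<^esub> \<sigma> c'))"
        using q\<sigma>[OF l, of "\<sigma> c \<oplus>\<^bsub>B\<^esub> \<sigma> c'"] \<sigma>[OF c] \<sigma>[OF c'] by simp
      then show ?thesis
        using abelian_group_hom.hom_add[OF q] l \<sigma>[OF c] \<sigma>[OF c'] by (simp add: LB.pure_add_right)
    qed
    show "?q (pure_tensor S L B (s \<odot>\<^bsub>L\<^esub> l) (\<sigma> c)) = ?q (pure_tensor S L B l (\<sigma> (s \<odot>\<^bsub>C\<^esub> c)))"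
      if s: "s \<in> carrier S" for s
    proof -
      have "s \<odot>\<^bsub>C\<^esub> c = g (s \<odot>\<^bsub>B\<^esub> \<sigma> c)"
        using \<sigma>[OF c] s by (simp add: lmod_hom_smult[OF g])
      then have "?q (pure_tensor S L B l (\<sigma> (s \<odot>\<^bsub>C\<^esub> c))) = ?q (pure_tensor S L B l (s \<odot>\<^bsub>B\<^esub> \<sigma> c))"
        using q\<sigma>[OF l, of "s \<odot>\<^bsub>B\<^esub> \<sigma> c"] \<sigma>[OF c] s by simp
      then show ?thesis using LB.pure_balanced[OF s l] \<sigma>[OF c] by simp
    qed
  qed blast
  have "h (tensor_map S L C (\<lambda>x. x) g t) = ?q t"
    by (rule LB.tensor_hom_eqI[OF abelian_group_hom_compose[OF tensor_map_hom[OF LB lmod_hom_id g LC] h] q _ t])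
       (simp add: tensor_map_pure[OF LB lmod_hom_id g LC] h_pure lmod_hom_closed[OF g] q\<sigma>)
  then have "?q t = K"
    using zero abelian_group_hom.hom_zero[OF h] by (simp add: Q_def subquot_def)
  then have "t \<in> K" using K.a_rcos_self[OF t] by simp
  then show ?thesis by (simp add: K_def)
qed


section \<open>Flat modules\<close>

lemma tensor_factors_submodule:
  assumes "tensor_factors S A B" "submodule H S B"
  shows "tensor_factors S A (B\<lparr>carrier := H\<rparr>)"
  using assms submodule_left_module[of S B H] by (simp add: tensor_factors_def)

lemma submodule_inclusion: "H \<subseteq> carrier B \<Longrightarrow> (\<lambda>x. x) \<in> lmod_hom S (B\<lparr>carrier := H\<rparr>) B"
  by (rule lmod_homI) auto

lemma submodule_subset: "\<lbrakk>left_module S B; submodule H S B\<rbrakk> \<Longrightarrow> H \<subseteq> carrier B"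
  using submodule_abelian_subgroup[THEN abelian_subgroup.axioms(1), THEN additive_subgroup.a_subset] .

text \<open>The vanishing of a tensor involves only finitely many elements of the second factor.\<close>

lemma tensor_null_finite:
  assumes AB: "tensor_factors S A B" and c: "c \<in> tensor_null S A B"
  shows "\<exists>F. finite F \<and> F \<subseteq> carrier B \<and>
    (\<forall>H. submodule H S B \<and> F \<subseteq> H \<longrightarrow> c \<in> tensor_null S A (B\<lparr>carrier := H\<rparr>))"
proof -
  interpret tensor_factors S A B by fact
  note sub = tensor_factors_submodule[OF AB]
  have rel: "\<exists>F. finite F \<and> F \<subseteq> carrier B \<and>
      (\<forall>H. submodule H S B \<and> F \<subseteq> H \<longrightarrow> c \<in> tensor_relations S A (B\<lparr>carrier := H\<rparr>))"
    if "c \<in> tensor_relations S A B" for c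
    using that
  proof (cases rule: tensor_relationsE)
    case (1 a a' b)
    have "c \<in> tensor_relations S A (B\<lparr>carrier := H\<rparr>)" if "{b} \<subseteq> H" for H
      using tensor_relationsI(1)[OF 1(2,3), of b "B\<lparr>carrier := H\<rparr>" S] that unfolding 1(1) by simp
    then show ?thesis using 1(4) by (intro exI[of _ "{b}"]) simp
  next
    case (2 a b b')
    have "c \<in> tensor_relations S A (B\<lparr>carrier := H\<rparr>)" if "{b, b'} \<subseteq> H" for H
      using tensor_relationsI(2)[OF 2(2), of b "B\<lparr>carrier := H\<rparr>" b' S] that unfolding 2(1) by simp
    then show ?thesis using 2(3,4) by (intro exI[of _ "{b, b'}"]) simp
  next
    case (3 s a b)
    have "c \<in> tensor_relations S A (B\<lparr>carrier := H\<rparr>)" if "{b} \<subseteq> H" for H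
      using tensor_relationsI(3)[OF 3(2,3), of b "B\<lparr>carrier := H\<rparr>"] that unfolding 3(1) by simp
    then show ?thesis using 3(4) by (intro exI[of _ "{b}"]) simp
  qed
  show ?thesis
    using c unfolding tensor_null_def[of S A B]
  proof (induction rule: generate.induct)
    case one
    have "0 \<in> tensor_null S A (B\<lparr>carrier := H\<rparr>)" if "submodule H S B" for H
      using subgroup.one_closed[OF tensor_factors.null_subgroup[OF sub[OF that]]] by simp
    then show ?case by (intro exI[of _ "{}"]) simp
  next
    case (incl h)
    from rel[OF incl] obtain F where F: "finite F" "F \<subseteq> carrier B"
      "\<And>H. submodule H S B \<Longrightarrow> F \<subseteq> H \<Longrightarrow> h \<in> tensor_relations S A (B\<lparr>carrier := H\<rparr>)"
      by blast
    have "h \<in> tensor_null S A (B\<lparr>carrier := H\<rparr>)" if "submodule H S B" "F \<subseteq> H" for H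
      by (rule tensor_factors.null_relation[OF sub[OF that(1)] F(3)[OF that]])
    then show ?case using F(1,2) by blast
  next
    case (inv h)
    then obtain F where F: "finite F" "F \<subseteq> carrier B"
      "\<And>H. submodule H S B \<Longrightarrow> F \<subseteq> H \<Longrightarrow> h \<in> tensor_relations S A (B\<lparr>carrier := H\<rparr>)"
      using rel[OF inv] by blast
    have "- h \<in> tensor_null S A (B\<lparr>carrier := H\<rparr>)" if H: "submodule H S B" "F \<subseteq> H" for H
    proof -
      interpret H: tensor_factors S A "B\<lparr>carrier := H\<rparr>" by (rule sub[OF H(1)])
      have "0 - h \<in> tensor_null S A (B\<lparr>carrier := H\<rparr>)"
        using subgroup.one_closed[OF H.null_subgroup] H.null_relation[OF F(3)[OF H]]
        by (intro H.null_minus_closed) simp_all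
      then show ?thesis by simp
    qed
    moreover have "inv\<^bsub>free\<^esub> h = - h" using relations_keys[OF inv] by simp
    ultimately show ?case using F(1,2) by (intro exI[of _ F]) simp
  next
    case (eng h1 h2)
    from eng.IH(1) obtain F1 where F1: "finite F1" "F1 \<subseteq> carrier B"
      "\<And>H. submodule H S B \<Longrightarrow> F1 \<subseteq> H \<Longrightarrow> h1 \<in> tensor_null S A (B\<lparr>carrier := H\<rparr>)"
      by blast
    from eng.IH(2) obtain F2 where F2: "finite F2" "F2 \<subseteq> carrier B"
      "\<And>H. submodule H S B \<Longrightarrow> F2 \<subseteq> H \<Longrightarrow> h2 \<in> tensor_null S A (B\<lparr>carrier := H\<rparr>)"
      by blast
    have "h1 + h2 \<in> tensor_null S A (B\<lparr>carrier := H\<rparr>)" if H: "submodule H S B" "F1 \<union> F2 \<subseteq> H" for H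
      using subgroup.m_closed[OF tensor_factors.null_subgroup[OF sub[OF H(1)]]
          F1(3)[OF H(1)] F2(3)[OF H(1)]] H(2) by simp
    then show ?case using F1(1,2) F2(1,2) by (intro exI[of _ "F1 \<union> F2"]) simp
  qed
qed

lemma left_module_surj_image:
  assumes M: "left_module S M"
    and c: "carrier H = f ` carrier M" and z: "\<zero>\<^bsub>H\<^esub> = f \<zero>\<^bsub>M\<^esub>"
    and a: "\<And>x y. \<lbrakk>x \<in> carrier M; y \<in> carrier M\<rbrakk> \<Longrightarrow> f x \<oplus>\<^bsub>H\<^esub> f y = f (x \<oplus>\<^bsub>M\<^esub> y)"
    and s: "\<And>s x. \<lbrakk>s \<in> carrier S; x \<in> carrier M\<rbrakk> \<Longrightarrow> s \<odot>\<^bsub>H\<^esub> f x = f (s \<odot>\<^bsub>M\<^esub> x)"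
  shows "left_module S H"
proof -
  interpret M: left_module S M by fact
  show ?thesis
    by (rule left_moduleI[OF M.R.ring_axioms abelian_group_surj_image[OF M.M.abelian_group_axioms c z a]])
       (auto simp: c a s M.smult_l_distr M.smult_r_distr M.smult_assoc1)
qed

definition transport :: "('a \<Rightarrow> 'b) \<Rightarrow> ('s, 'a, 'z) module_scheme \<Rightarrow> ('s, 'b) module" where
  "transport \<rho> M = \<lparr>carrier = \<rho> ` carrier M, monoid.mult = undefined, one = undefined,
     ring.zero = \<rho> \<zero>\<^bsub>M\<^esub>,
     ring.add = (\<lambda>x y. \<rho> (inv_into (carrier M) \<rho> x \<oplus>\<^bsub>M\<^esub> inv_into (carrier M) \<rho> y)),
     smult = (\<lambda>s x. \<rho> (s \<odot>\<^bsub>M\<^esub> inv_into (carrier M) \<rho> x))\<rparr>"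

lemma
  assumes M: "left_module S M" and \<rho>: "inj_on \<rho> (carrier M)"
  shows transport_left_module: "left_module S (transport \<rho> M)"
    and transport_hom: "\<rho> \<in> lmod_hom S M (transport \<rho> M)"
    and transport_inv_hom: "inv_into (carrier M) \<rho> \<in> lmod_hom S (transport \<rho> M) M"
proof -
  interpret M: left_module S M by fact
  note inv = inv_into_f_f[OF \<rho>]
  show "left_module S (transport \<rho> M)"
    by (rule left_module_surj_image[OF M, where f = \<rho>]) (auto simp: transport_def inv)
  show "\<rho> \<in> lmod_hom S M (transport \<rho> M)"
    by (rule lmod_homI) (auto simp: transport_def inv)
  show "inv_into (carrier M) \<rho> \<in> lmod_hom S (transport \<rho> M) M"
    by (rule lmod_homI) (auto simp: transport_def inv)
qed

text \<open>By the choice of coefficients the submodule generated by \<open>k\<close> elements embeds as a set into \<open>S\<^sup>k\<close>,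
  and so has a copy with carrier in \<open>nat \<Rightarrow> 's\<close>.\<close>

lemma finitely_generated_submodule:
  fixes S :: "('s, 'x) ring_scheme" and B :: "('s, 'b, 'z) module_scheme"
  assumes B: "left_module S B" and F: "finite F" "F \<subseteq> carrier B"
  obtains H and \<rho> :: "'b \<Rightarrow> nat \<Rightarrow> 's" where "submodule H S B" "F \<subseteq> H" "inj_on \<rho> H"
    "\<And>K. submodule K S B \<Longrightarrow> F \<subseteq> K \<Longrightarrow> H \<subseteq> K"
proof -
  interpret B: left_module S B by fact
  obtain k :: nat and b where b: "F = b ` {i. i < k}"
    using F(1) by (metis finite_imp_nat_seg_image_inj_on)
  let ?E = "free_module S {i. i < k}"
  have bB: "b \<in> {i. i < k} \<rightarrow> carrier B" using b F(2) by auto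
  note hom = B.lin_comb_hom[OF bB]
  let ?H = "lin_comb S B b ` carrier ?E"
  show thesis
  proof (rule that)
    show "submodule ?H S B"
      by (rule lmod_hom_image_submodule[OF B.free_module_left_module B hom])
    show "F \<subseteq> ?H"
    proof
      fix x assume "x \<in> F"
      then obtain i where "i \<in> {i. i < k}" "x = b i" using b by auto
      then show "x \<in> ?H" using B.lin_comb_basis[OF bB] by (metis imageI)
    qed
    show "inj_on (inv_into (carrier ?E) (lin_comb S B b)) ?H" by (rule inj_on_inv_into) simp
    show "?H \<subseteq> K" if "submodule K S B" "F \<subseteq> K" for K
      using B.lin_comb_submodule[OF that(1)] that(2) b by blast
  qed
qed

lemma frag_map2_comp:
  "frag_map2 f' g' (frag_map2 f g c) = frag_map2 (\<lambda>x. f' (f x)) (\<lambda>y. g' (g y)) c"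
proof -
  have "(\<lambda>(x, y). frag_of (f x, g y)) = frag_of \<circ> (\<lambda>(x, y). (f x, g y))" by auto
  then have "frag_map2 f' g' (frag_map2 f g c)
      = frag_extend ((\<lambda>(x, y). frag_of (f' x, g' y)) \<circ> (\<lambda>(x, y). (f x, g y))) c"
    by (simp add: frag_extend_compose)
  also have "(\<lambda>(x, y). frag_of (f' x, g' y)) \<circ> (\<lambda>(x, y). (f x, g y))
      = (\<lambda>(x, y). frag_of (f' (f x), g' (g y)))" by auto
  finally show ?thesis .
qed

lemma frag_map2_cong:
  assumes "\<And>x y. (x, y) \<in> Poly_Mapping.keys c \<Longrightarrow> f x = f' x \<and> g y = g' y"
  shows "frag_map2 f g c = frag_map2 f' g' c"
  by (rule frag_extend_eq) (use assms in auto)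

lemma frag_map2_id: "frag_map2 (\<lambda>x. x) (\<lambda>y. y) c = c"
proof -
  have "frag_map2 (\<lambda>x. x) (\<lambda>y. y) c = frag_extend frag_of c"
    by (rule frag_extend_eq) auto
  then show ?thesis using frag_expansion[of c] by argo
qed

text \<open>A tensor over \<open>A\<close> that vanishes over \<open>B\<close> already comes from a finitely generated submodule of
  \<open>A\<close> and vanishes over a finitely generated submodule of \<open>B\<close>; both have copies in the type that
  the definition of flatness tests.\<close>

lemma flat_inj:
  fixes S :: "('s, 'x) ring_scheme"
    and A :: "('s, 'd, 'y) module_scheme" and B :: "('s, 'e, 'z) module_scheme"
  assumes flat: "flat_right S L" and A: "left_module S A" and B: "left_module S B"
    and f: "f \<in> lmod_hom S A B" and inj: "inj_on f (carrier A)"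
  shows "inj_on (tensor_map S L B (\<lambda>x. x) f) (carrier (tensor S L A))"
proof -
  have L: "right_module S L" using flat by (simp add: flat_right_def)
  have LA: "tensor_factors S L A" and LB: "tensor_factors S L B"
    using L A B by (simp_all add: tensor_factors_def)
  interpret LA: tensor_factors S L A by (rule LA)
  interpret LB: tensor_factors S L B by (rule LB)
  interpret m: abelian_group_hom "tensor S L A" "tensor S L B" "tensor_map S L B (\<lambda>x. x) f"
    by (rule tensor_map_hom[OF LA lmod_hom_id f LB])
  have "t = \<zero>\<^bsub>tensor S L A\<^esub>"
    if t: "t \<in> carrier (tensor S L A)" and ft: "tensor_map S L B (\<lambda>x. x) f t = \<zero>\<^bsub>tensor S L B\<^esub>" for t
  proof -
    obtain c where c: "Poly_Mapping.keys c \<subseteq> carrier L \<times> carrier A" "t = tensor_class S L A c"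
      using t by (auto simp: LA.carrier_T)
    have keys_f: "Poly_Mapping.keys (frag_map2 (\<lambda>x. x) f c) \<subseteq> carrier L \<times> carrier B"
      by (rule keys_frag_map2[OF c(1) _ lmod_hom_closed[OF f]])
    have "frag_map2 (\<lambda>x. x) f c - 0 \<in> tensor_null S L B"
      using ft tensor_map_cls[OF LA lmod_hom_id f LB c(1)] LB.cls_eq_iff[OF keys_f, of 0]
      by (simp add: c(2) LB.zero_T)
    then obtain G where G: "finite G" "G \<subseteq> carrier B"
      "\<And>H. submodule H S B \<Longrightarrow> G \<subseteq> H \<Longrightarrow> frag_map2 (\<lambda>x. x) f c \<in> tensor_null S L (B\<lparr>carrier := H\<rparr>)"
      using tensor_null_finite[OF LB, of "frag_map2 (\<lambda>x. x) f c"] by auto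
    define F where "F = snd ` Poly_Mapping.keys c"
    have F: "finite F" "F \<subseteq> carrier A" using c(1) by (auto simp: F_def)
    have "finite (G \<union> f ` F)" "G \<union> f ` F \<subseteq> carrier B"
      using G(1,2) F lmod_hom_closed[OF f] by auto
    \<comment> \<open>\<open>K\<close> contains what makes the image of \<open>c\<close> vanish, and the images of the generators \<open>F\<close> of \<open>H\<close>,
      so that \<open>f\<close> maps \<open>H\<close> into \<open>K\<close>.\<close>
    from finitely_generated_submodule[OF B this] obtain K and \<rho> :: "'e \<Rightarrow> nat \<Rightarrow> 's"
      where K: "submodule K S B" "G \<union> f ` F \<subseteq> K" and \<rho>: "inj_on \<rho> K" by metis
    from finitely_generated_submodule[OF A F] obtain H and \<tau> :: "'d \<Rightarrow> nat \<Rightarrow> 's"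
      where H: "submodule H S A" "F \<subseteq> H" and \<tau>: "inj_on \<tau> H"
        and min: "\<And>K. submodule K S A \<Longrightarrow> F \<subseteq> K \<Longrightarrow> H \<subseteq> K" by metis
    let ?A = "A\<lparr>carrier := H\<rparr>" and ?B = "B\<lparr>carrier := K\<rparr>"
    have HA: "H \<subseteq> carrier A" and KB: "K \<subseteq> carrier B"
      using submodule_subset[OF A H(1)] submodule_subset[OF B K(1)] .
    have mA: "left_module S ?A" and mB: "left_module S ?B"
      using submodule_left_module[OF A H(1)] submodule_left_module[OF B K(1)] .
    have fH: "f x \<in> K" if "x \<in> H" for x
    proof -
      have "submodule {x \<in> carrier A. f x \<in> K} S A"
      proof (rule LA.B.submodule_intro)
        interpret K: abelian_subgroup K B by (rule submodule_abelian_subgroup[OF B K(1)])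
        show "\<zero>\<^bsub>A\<^esub> \<in> {x \<in> carrier A. f x \<in> K}" by (simp add: lmod_hom_zero[OF A B f])
      qed (auto simp: lmod_hom_add[OF f] lmod_hom_smult[OF f] submodule.smult_closed[OF K(1)]
          intro!: additive_subgroup.a_closed[OF abelian_subgroup.axioms(1)[OF
            submodule_abelian_subgroup[OF B K(1)]]])
      from min[OF this] show ?thesis using that K(2) F(2) by auto
    qed
    then have fAB: "f \<in> lmod_hom S ?A ?B"
      using HA by (intro lmod_homI) (auto simp: lmod_hom_add[OF f] lmod_hom_smult[OF f] subset_iff)
    \<comment> \<open>Flatness applies to the map \<open>g\<close> that corresponds to \<open>f\<close> on the copies of \<open>H\<close> and \<open>K\<close>.\<close>
    let ?A' = "transport \<tau> ?A" and ?B' = "transport \<rho> ?B"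
    have \<tau>': "inj_on \<tau> (carrier ?A)" and \<rho>': "inj_on \<rho> (carrier ?B)" using \<tau> \<rho> by simp_all
    note A' = transport_left_module[OF mA \<tau>'] and B' = transport_left_module[OF mB \<rho>']
    note \<tau>_hom = transport_hom[OF mA \<tau>'] and \<rho>_hom = transport_hom[OF mB \<rho>']
    define \<sigma> where "\<sigma> = inv_into (carrier ?A) \<tau>"
    have \<sigma>_hom: "\<sigma> \<in> lmod_hom S ?A' ?A" unfolding \<sigma>_def by (rule transport_inv_hom[OF mA \<tau>'])
    have \<sigma>\<tau>: "\<sigma> (\<tau> x) = x" if "x \<in> H" for x using that \<tau> by (simp add: \<sigma>_def)
    have tA: "tensor_factors S L ?A" and tB: "tensor_factors S L ?B"
      and tA': "tensor_factors S L ?A'" and tB': "tensor_factors S L ?B'"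
      using L mA mB A' B' by (simp_all add: tensor_factors_def)
    interpret tA': tensor_factors S L ?A' by (rule tA')
    interpret tB': tensor_factors S L ?B' by (rule tB')
    define g where "g y = \<rho> (f (\<sigma> y))" for y
    have g: "g \<in> lmod_hom S ?A' ?B'"
      unfolding g_def[abs_def] by (rule lmod_hom_comp[OF lmod_hom_comp[OF \<sigma>_hom fAB] \<rho>_hom])
    have "inj_on g (carrier ?A')"
    proof (rule inj_onI)
      fix x y assume xy: "x \<in> carrier ?A'" "y \<in> carrier ?A'" "g x = g y"
      then obtain u v where uv: "u \<in> H" "x = \<tau> u" "v \<in> H" "y = \<tau> v" by (auto simp: transport_def)
      then have "f u = f v" using xy(3) fH inj_onD[OF \<rho>] by (simp add: g_def \<sigma>\<tau>)
      then show "x = y" using inj_onD[OF inj] uv HA by auto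
    qed
    then have g_inj: "inj_on (tensor_map S L ?B' (\<lambda>x. x) g) (carrier (tensor S L ?A'))"
      using flat A' B' g unfolding flat_right_def by blast
    interpret gm: abelian_group_hom "tensor S L ?A'" "tensor S L ?B'" "tensor_map S L ?B' (\<lambda>x. x) g"
      by (rule tensor_map_hom[OF tA' lmod_hom_id g tB'])
    have cH: "y \<in> H" if "(x, y) \<in> Poly_Mapping.keys c" for x y
      using H(2) that by (force simp: F_def)
    then have keys_c: "Poly_Mapping.keys c \<subseteq> carrier L \<times> carrier ?A" using c(1) by auto
    let ?c = "frag_map2 (\<lambda>x. x) \<tau> c"
    have keys_c': "Poly_Mapping.keys ?c \<subseteq> carrier L \<times> carrier ?A'"
      by (rule keys_frag_map2[OF keys_c _ lmod_hom_closed[OF \<tau>_hom]])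
    have "frag_map2 (\<lambda>x. x) g ?c = frag_map2 (\<lambda>x. x) (\<lambda>y. \<rho> (f y)) c"
      unfolding frag_map2_comp by (rule frag_map2_cong) (simp add: g_def \<sigma>\<tau> cH)
    also have "\<dots> = frag_map2 (\<lambda>x. x) \<rho> (frag_map2 (\<lambda>x. x) f c)" by (simp add: frag_map2_comp)
    also have "\<dots> \<in> tensor_null S L ?B'"
      using tensor_null_map[OF tB lmod_hom_id \<rho>_hom tB' G(3)[OF K(1)]] K(2) by simp
    finally have "frag_map2 (\<lambda>x. x) g ?c \<in> tensor_null S L ?B'" .
    then have "tensor_map S L ?B' (\<lambda>x. x) g (tensor_class S L ?A' ?c) = \<zero>\<^bsub>tensor S L ?B'\<^esub>"
      using tensor_map_cls[OF tA' lmod_hom_id g tB' keys_c'] tB'.cls_eq_iff[of "frag_map2 (\<lambda>x. x) g ?c" 0]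
        keys_frag_map2[OF keys_c' _ lmod_hom_closed[OF g], of "\<lambda>x. x" "carrier L"]
      by (simp add: tB'.zero_T)
    also have "\<dots> = tensor_map S L ?B' (\<lambda>x. x) g \<zero>\<^bsub>tensor S L ?A'\<^esub>" by simp
    finally have "tensor_class S L ?A' ?c = \<zero>\<^bsub>tensor S L ?A'\<^esub>"
      using inj_onD[OF g_inj] keys_c' tA'.carrier_T by blast
    then have null: "?c \<in> tensor_null S L ?A'"
      using tA'.cls_eq_iff[OF keys_c', of 0] by (simp add: tA'.zero_T)
    have "\<sigma> \<in> lmod_hom S ?A' A"
      using lmod_hom_comp[OF \<sigma>_hom submodule_inclusion[OF HA]] by simp
    from tensor_null_map[OF tA' lmod_hom_id this LA null]
    have "frag_map2 (\<lambda>x. x) (\<lambda>y. \<sigma> (\<tau> y)) c \<in> tensor_null S L A" by (simp add: frag_map2_comp)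
    also have "frag_map2 (\<lambda>x. x) (\<lambda>y. \<sigma> (\<tau> y)) c = c"
      using frag_map2_cong[of c "\<lambda>x. x" "\<lambda>x. x" "\<lambda>y. \<sigma> (\<tau> y)" "\<lambda>y. y"] \<sigma>\<tau> cH by (simp add: frag_map2_id)
    finally show "t = \<zero>\<^bsub>tensor S L A\<^esub>"
      using LA.cls_eq_iff[OF c(1), of 0] by (simp add: c(2) LA.zero_T)
  qed
  note ker = this
  show ?thesis
  proof (rule inj_onI)
    fix t u assume tu: "t \<in> carrier (tensor S L A)" "u \<in> carrier (tensor S L A)"
      "tensor_map S L B (\<lambda>x. x) f t = tensor_map S L B (\<lambda>x. x) f u"
    have "tensor_map S L B (\<lambda>x. x) f (t \<ominus>\<^bsub>tensor S L A\<^esub> u) = \<zero>\<^bsub>tensor S L B\<^esub>"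
      using abelian_group_hom_minus[OF m.abelian_group_hom_axioms tu(1,2)] tu
      by (simp add: a_minus_def LB.T.r_neg)
    then have "t \<ominus>\<^bsub>tensor S L A\<^esub> u = \<zero>\<^bsub>tensor S L A\<^esub>"
      using ker[of "t \<ominus>\<^bsub>tensor S L A\<^esub> u"] tu by (simp add: a_minus_def)
    then show "t = u" using abelian_group_minus_eq_zero_iff[OF LA.abelian_group_T tu(1,2)] by simp
  qed
qed


section \<open>Homomorphisms out of a tensor product with a projective module\<close>

text \<open>The properties of \<open>L \<otimes> M\<close> and of \<open>M \<otimes> L\<close> as targets of the universal map \<open>\<tau>\<close> that is additive
  in both arguments and balanced over \<open>S\<close>. Both tensor products are instances, so that the
  isomorphisms for left and for right modules have one proof. The target \<open>Y\<close> of the universal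
  property is a parameter, to be instantiated with the terms of a resolution.\<close>

locale hom_tensor =
  fixes R :: "('r, 'x) ring_scheme" and S :: "('s, 'y) ring_scheme"
    and L :: "('r, 's, 'l) bimodule" and M :: "('s, 'm) module"
    and T :: "('r, 't) module" and \<tau> :: "'l \<Rightarrow> 'm \<Rightarrow> 't" and Y :: "('r, 'u) module"
  assumes L: "bimodule R S L" and M: "left_module S M" and T: "left_module R T" and Y: "left_module R Y"
    and \<tau>_closed: "\<lbrakk>l \<in> carrier L; m \<in> carrier M\<rbrakk> \<Longrightarrow> \<tau> l m \<in> carrier T"
    and \<tau>_add_left: "\<lbrakk>l \<in> carrier L; l' \<in> carrier L; m \<in> carrier M\<rbrakk> \<Longrightarrow> \<tau> (l \<oplus>\<^bsub>L\<^esub> l') m = \<tau> l m \<oplus>\<^bsub>T\<^esub> \<tau> l' m"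
    and \<tau>_add_right: "\<lbrakk>l \<in> carrier L; m \<in> carrier M; m' \<in> carrier M\<rbrakk> \<Longrightarrow> \<tau> l (m \<oplus>\<^bsub>M\<^esub> m') = \<tau> l m \<oplus>\<^bsub>T\<^esub> \<tau> l m'"
    and \<tau>_balanced: "\<lbrakk>s \<in> carrier S; l \<in> carrier L; m \<in> carrier M\<rbrakk> \<Longrightarrow> \<tau> (rsmult L l s) m = \<tau> l (s \<odot>\<^bsub>M\<^esub> m)"
    and \<tau>_linear: "\<lbrakk>r \<in> carrier R; l \<in> carrier L; m \<in> carrier M\<rbrakk> \<Longrightarrow> \<tau> (r \<odot>\<^bsub>L\<^esub> l) m = r \<odot>\<^bsub>T\<^esub> \<tau> l m"
    and \<tau>_induct: "\<lbrakk>t \<in> carrier T; \<And>l m. \<lbrakk>l \<in> carrier L; m \<in> carrier M\<rbrakk> \<Longrightarrow> P (\<tau> l m);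
        \<And>x y. \<lbrakk>x \<in> carrier T; y \<in> carrier T; P x; P y\<rbrakk> \<Longrightarrow> P (x \<oplus>\<^bsub>T\<^esub> y)\<rbrakk> \<Longrightarrow> P t"
    and \<tau>_universal: "\<lbrakk>\<And>l m. \<lbrakk>l \<in> carrier L; m \<in> carrier M\<rbrakk> \<Longrightarrow> \<beta> l m \<in> carrier Y;
        \<And>l l' m. \<lbrakk>l \<in> carrier L; l' \<in> carrier L; m \<in> carrier M\<rbrakk> \<Longrightarrow> \<beta> (l \<oplus>\<^bsub>L\<^esub> l') m = \<beta> l m \<oplus>\<^bsub>Y\<^esub> \<beta> l' m;
        \<And>l m m'. \<lbrakk>l \<in> carrier L; m \<in> carrier M; m' \<in> carrier M\<rbrakk> \<Longrightarrow> \<beta> l (m \<oplus>\<^bsub>M\<^esub> m') = \<beta> l m \<oplus>\<^bsub>Y\<^esub> \<beta> l m';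
        \<And>s l m. \<lbrakk>s \<in> carrier S; l \<in> carrier L; m \<in> carrier M\<rbrakk> \<Longrightarrow> \<beta> (rsmult L l s) m = \<beta> l (s \<odot>\<^bsub>M\<^esub> m)\<rbrakk> \<Longrightarrow>
        \<exists>h. (\<forall>t\<in>carrier T. h t \<in> carrier Y) \<and>
          (\<forall>x\<in>carrier T. \<forall>y\<in>carrier T. h (x \<oplus>\<^bsub>T\<^esub> y) = h x \<oplus>\<^bsub>Y\<^esub> h y) \<and>
          (\<forall>l\<in>carrier L. \<forall>m\<in>carrier M. h (\<tau> l m) = \<beta> l m)"
begin

lemma hom_eqI:
  assumes f: "f \<in> lmod_hom R T Y" and g: "g \<in> lmod_hom R T Y"
    and eq: "\<And>l m. \<lbrakk>l \<in> carrier L; m \<in> carrier M\<rbrakk> \<Longrightarrow> f (\<tau> l m) = g (\<tau> l m)" and t: "t \<in> carrier T"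
  shows "f t = g t"
  using t by (rule \<tau>_induct) (simp_all add: eq lmod_hom_add[OF f] lmod_hom_add[OF g])

definition curried :: "('t \<Rightarrow> 'u) \<Rightarrow> 'm \<Rightarrow> 'l \<Rightarrow> 'u" where
  "curried f m = (\<lambda>l\<in>carrier L. f (\<tau> l m))"

lemma curried_hom:
  assumes f: "f \<in> lmod_hom R T Y"
  shows "curried f \<in> lmod_hom S M (hom_mod R L Y)"
proof -
  interpret M: left_module S M by (rule M)
  interpret L: left_module R L by (rule bimodule_left[OF L])
  interpret L': left_module "opp S" "flip L" by (rule bimodule_right[OF L])
  note f_simps = lmod_hom_closed[OF f] lmod_hom_add[OF f] lmod_hom_smult[OF f]
  show ?thesis
  proof (rule lmod_homI)
    fix m assume m: "m \<in> carrier M"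
    have "(\<lambda>l. f (\<tau> l m)) \<in> lmod_hom R L Y"
      using m by (intro lmod_homI) (simp_all add: f_simps \<tau>_closed \<tau>_add_left \<tau>_linear)
    from lmod_hom_restrict[OF bimodule_left[OF L] this]
    show "curried f m \<in> carrier (hom_mod R L Y)" by (simp add: curried_def)
    show "curried f (m \<oplus>\<^bsub>M\<^esub> m') = curried f m \<oplus>\<^bsub>hom_mod R L Y\<^esub> curried f m'" if "m' \<in> carrier M" for m'
      using m that by (auto simp: curried_def \<tau>_add_right f_simps \<tau>_closed intro!: restrict_ext)
    show "curried f (s \<odot>\<^bsub>M\<^esub> m) = s \<odot>\<^bsub>hom_mod R L Y\<^esub> curried f m" if s: "s \<in> carrier S" for s
      using m s L'.smult_closed[of s] by (auto simp: curried_def \<tau>_balanced intro!: restrict_ext)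
  qed
qed

lemma uncurry:
  assumes \<phi>: "\<phi> \<in> lmod_hom S M (hom_mod R L Y)"
  obtains f where "f \<in> lmod_hom R T Y"
    "\<And>l m. \<lbrakk>l \<in> carrier L; m \<in> carrier M\<rbrakk> \<Longrightarrow> f (\<tau> l m) = \<phi> m l"
proof -
  interpret M: left_module S M by (rule M)
  interpret T: left_module R T by (rule T)
  interpret Y: left_module R Y by (rule Y)
  interpret L: left_module R L by (rule bimodule_left[OF L])
  have \<phi>m: "\<phi> m \<in> lmod_hom R L Y" if "m \<in> carrier M" for m
    using lmod_hom_closed[OF \<phi> that] by simp
  note \<phi>_simps = lmod_hom_closed[OF \<phi>m] lmod_hom_add[OF \<phi>m] lmod_hom_smult[OF \<phi>m]
    lmod_hom_add[OF \<phi>] lmod_hom_smult[OF \<phi>]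
  have "\<exists>h. (\<forall>t\<in>carrier T. h t \<in> carrier Y) \<and>
      (\<forall>x\<in>carrier T. \<forall>y\<in>carrier T. h (x \<oplus>\<^bsub>T\<^esub> y) = h x \<oplus>\<^bsub>Y\<^esub> h y) \<and>
      (\<forall>l\<in>carrier L. \<forall>m\<in>carrier M. h (\<tau> l m) = \<phi> m l)"
    by (rule \<tau>_universal) (simp_all add: \<phi>_simps)
  then obtain h where h: "\<And>t. t \<in> carrier T \<Longrightarrow> h t \<in> carrier Y"
    "\<And>x y. \<lbrakk>x \<in> carrier T; y \<in> carrier T\<rbrakk> \<Longrightarrow> h (x \<oplus>\<^bsub>T\<^esub> y) = h x \<oplus>\<^bsub>Y\<^esub> h y"
    "\<And>l m. \<lbrakk>l \<in> carrier L; m \<in> carrier M\<rbrakk> \<Longrightarrow> h (\<tau> l m) = \<phi> m l" by blast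
  have "h (r \<odot>\<^bsub>T\<^esub> t) = r \<odot>\<^bsub>Y\<^esub> h t" if r: "r \<in> carrier R" and t: "t \<in> carrier T" for r t
    using t
  proof (rule \<tau>_induct)
    fix l m assume "l \<in> carrier L" "m \<in> carrier M"
    then show "h (r \<odot>\<^bsub>T\<^esub> \<tau> l m) = r \<odot>\<^bsub>Y\<^esub> h (\<tau> l m)"
      using r by (simp add: \<tau>_linear[symmetric] h(3) \<phi>_simps)
  qed (use r in \<open>simp_all add: T.smult_r_distr Y.smult_r_distr h(1,2)\<close>)
  then have "h \<in> lmod_hom R T Y" using h(1,2) by (intro lmod_homI)
  then show thesis using that h(3) by blast
qed

end

text \<open>The map that induces the isomorphism sends a cycle \<open>f\<close> of \<open>Hom(T, W\<^sub>n)\<close> to the function that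
  maps \<open>m\<close> to the class of \<open>l \<mapsto> f (\<tau> l m)\<close>. Projectivity of \<open>M\<close> is used twice: a map from \<open>M\<close> to the
  homology lifts to the cycles, and a map from \<open>M\<close> to the boundaries lifts to the next term.\<close>

lemma rel_Ext_hom_tensor:
  fixes W :: "('r, 'u, 'u \<Rightarrow> 'n) aug_complex"
  assumes W: "left_res R \<C> N W" and P: "projective S M"
    and HT: "\<And>i. hom_tensor R S L M T \<tau> (obj W i)"
  shows "add_monoid (rel_Ext R T W n) \<cong> add_monoid (hom_group S M (rel_Ext_mod R L W n))"
proof -
  interpret W: left_res R \<C> N W by fact
  interpret HT: hom_tensor R S L M T \<tau> "obj W n" by (rule HT)
  note L = HT.L and T = HT.T and M = HT.M
  note Lm = bimodule_left[OF L]
  let ?C = "\<lambda>i. hom_mod R L (obj W i)" and ?d = "\<lambda>i. compose (carrier L) (diff W i)"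
  let ?Z = "cycles ?C ?d n" and ?B = "boundaries ?C ?d n"
  have Z_iff: "f \<in> ?Z \<longleftrightarrow> f \<in> lmod_hom R L (obj W n) \<and> f \<in> extensional (carrier L) \<and>
      (\<forall>l\<in>carrier L. f l \<in> cycles (obj W) (diff W) n)" for f
    using W.hom_cycles_iff[of f L n] by (simp add: cycles_eq)
  have C: "left_module S (?C i)" for i by (rule hom_mod_left_module[OF L W.obj_module])
  have d: "?d i \<in> lmod_hom S (?C (Suc i)) (?C i)" for i
    by (rule hom_mod_compose[OF L W.obj_module W.obj_module W.diff_hom])
  have Zs: "submodule ?Z S (?C n)" and Bs: "submodule ?B S (?C n)"
    by (rule chain_complex_submodules[where C = ?C and d = ?d, OF C d])+
  have BZ: "?B \<subseteq> ?Z"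
    using chain_complex_subgroups(3)[where C = "\<lambda>i. hom_group R L (obj W i)" and d = ?d and n = n, OF W.hom_complex[OF Lm]]
    by (simp add: cycles_eq boundaries_def)
  let ?H = "rel_Ext_mod R L W n"
  let ?\<pi> = "\<lambda>z. ?B +>\<^bsub>?C n\<^esub> z"
  have Hdef: "?H = subquot_mod (?C n) ?Z ?B" by (simp add: rel_Ext_mod_def homology_mod_def)
  have H: "left_module S ?H" unfolding Hdef by (rule subquot_mod_left_module[OF C Bs Zs BZ])
  have \<pi>: "?\<pi> \<in> lmod_hom S (?C n\<lparr>carrier := ?Z\<rparr>) ?H"
    unfolding Hdef by (rule subquot_mod_proj[OF C Bs Zs BZ])
  have \<pi>_zero: "?\<pi> z = \<zero>\<^bsub>?H\<^esub> \<longleftrightarrow> z \<in> ?B" if "z \<in> ?Z" for z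
    unfolding Hdef by (rule subquot_mod_proj_eq_zero[OF C Bs Zs BZ that])
  have \<pi>_surj: "?\<pi> ` carrier (?C n\<lparr>carrier := ?Z\<rparr>) = carrier ?H"
    by (simp add: Hdef subquot_mod_simps)
  have Zm: "left_module S (?C n\<lparr>carrier := ?Z\<rparr>)" and Bm: "left_module S (?C n\<lparr>carrier := ?B\<rparr>)"
    using submodule_left_module[OF C Zs] submodule_left_module[OF C Bs] .
  let ?ZT = "hom_cycles R T W n"
  let ?BT = "hom_boundaries R T W n"
  have curried_cycle: "HT.curried f m \<in> ?Z" if f: "f \<in> ?ZT" and m: "m \<in> carrier M" for f m
  proof -
    have f': "f \<in> lmod_hom R T (obj W n)" "\<And>t. t \<in> carrier T \<Longrightarrow> f t \<in> cycles (obj W) (diff W) n"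
      using f unfolding W.hom_cycles_iff by auto
    show ?thesis
      unfolding Z_iff
      using lmod_hom_closed[OF HT.curried_hom[OF f'(1)] m] f'(2) HT.\<tau>_closed m
      by (simp add: HT.curried_def)
  qed
  have curried_hom_Z: "HT.curried f \<in> lmod_hom S M (?C n\<lparr>carrier := ?Z\<rparr>)" if f: "f \<in> ?ZT" for f
  proof -
    have "f \<in> lmod_hom R T (obj W n)" using f unfolding W.hom_cycles_iff by auto
    note cf = HT.curried_hom[OF this]
    show ?thesis
      by (rule lmod_homI) (simp_all add: curried_cycle[OF f] lmod_hom_add[OF cf] lmod_hom_smult[OF cf]
          del: hom_mod_simps)
  qed
  show ?thesis
    unfolding rel_Ext_def homology_def
  proof (rule subquot_iso[where \<phi> = "\<lambda>f. \<lambda>m\<in>carrier M. ?\<pi> (HT.curried f m)"])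
    show "abelian_subgroup ?BT (hom_group R T (obj W n))" "abelian_subgroup ?ZT (hom_group R T (obj W n))"
        "?BT \<subseteq> ?ZT"
      by (rule chain_complex_subgroups W.hom_complex[OF T] | assumption)+
    show "abelian_group (hom_group S M ?H)" by (rule hom_group_abelian_group[OF M H])
  next
    fix f assume f: "f \<in> ?ZT"
    from lmod_hom_restrict[OF M lmod_hom_comp[OF curried_hom_Z[OF f] \<pi>]]
    show "(\<lambda>m\<in>carrier M. ?\<pi> (HT.curried f m)) \<in> carrier (hom_group S M ?H)" by simp
    have fh: "f \<in> lmod_hom R T (obj W n)" and fe: "f \<in> extensional (carrier T)"
      using f unfolding W.hom_cycles_iff by auto
    fix g assume g: "g \<in> ?ZT"
    have sum: "HT.curried (f \<oplus>\<^bsub>hom_group R T (obj W n)\<^esub> g) m = HT.curried f m \<oplus>\<^bsub>?C n\<^esub> HT.curried g m"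
      if "m \<in> carrier M" for m
      using that by (auto simp: HT.curried_def HT.\<tau>_closed intro!: restrict_ext)
    have "?\<pi> (HT.curried f m \<oplus>\<^bsub>?C n\<^esub> HT.curried g m) = ?\<pi> (HT.curried f m) \<oplus>\<^bsub>?H\<^esub> ?\<pi> (HT.curried g m)"
      if "m \<in> carrier M" for m
      using lmod_hom_add[OF \<pi>, of "HT.curried f m" "HT.curried g m"] curried_cycle[OF f that]
        curried_cycle[OF g that] by simp
    then show "(\<lambda>m\<in>carrier M. ?\<pi> (HT.curried (f \<oplus>\<^bsub>hom_group R T (obj W n)\<^esub> g) m))
        = (\<lambda>m\<in>carrier M. ?\<pi> (HT.curried f m)) \<oplus>\<^bsub>hom_group S M ?H\<^esub> (\<lambda>m\<in>carrier M. ?\<pi> (HT.curried g m))"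
      unfolding hom_group_simps(3)[of S M ?H]
      by (intro restrict_ext) (simp only: sum restrict_apply' simp_thms)
  next
    fix \<psi> assume "\<psi> \<in> carrier (hom_group S M ?H)"
    then have \<psi>: "\<psi> \<in> lmod_hom S M ?H" "\<psi> \<in> extensional (carrier M)" by auto
    \<comment> \<open>Surjectivity: \<open>\<psi>\<close> lifts to the cycles, and the lift corresponds to a map \<open>f\<close> on \<open>T\<close>, which is a
      cycle because \<open>d f\<close> vanishes on the elements \<open>\<tau> l m\<close>.\<close>
    from projective_lift[OF P Zm H \<pi> \<pi>_surj \<psi>(1)]
    obtain \<phi> where \<phi>Z: "\<phi> \<in> lmod_hom S M (?C n\<lparr>carrier := ?Z\<rparr>)"
      and \<phi>\<psi>: "\<And>m. m \<in> carrier M \<Longrightarrow> ?\<pi> (\<phi> m) = \<psi> m" by blast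
    have \<phi>_cycle: "\<phi> m \<in> ?Z" if "m \<in> carrier M" for m using lmod_hom_closed[OF \<phi>Z that] by simp
    have "\<phi> \<in> lmod_hom S M (?C n)"
      using lmod_hom_comp[OF \<phi>Z submodule_inclusion[OF submodule_subset[OF C Zs]]] by simp
    from HT.uncurry[OF this] obtain f where f: "f \<in> lmod_hom R T (obj W n)"
      and f\<phi>: "\<And>l m. \<lbrakk>l \<in> carrier L; m \<in> carrier M\<rbrakk> \<Longrightarrow> f (\<tau> l m) = \<phi> m l" by blast
    have "diff W k (f t) = \<zero>\<^bsub>obj W k\<^esub>" if k: "n = Suc k" and t: "t \<in> carrier T" for k t
    proof (rule hom_tensor.hom_eqI[OF HT _ lmod_hom_const_zero[OF T W.obj_module] _ t])
      show "(\<lambda>t. diff W k (f t)) \<in> lmod_hom R T (obj W k)"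
        using lmod_hom_comp[OF f] W.diff_hom[of k] k by simp
      show "diff W k (f (\<tau> l m)) = \<zero>\<^bsub>obj W k\<^esub>" if "l \<in> carrier L" "m \<in> carrier M" for l m
        using \<phi>_cycle[OF that(2)] that k unfolding Z_iff by (simp add: f\<phi> cycles_eq)
    qed
    then have cyc: "restrict f (carrier T) \<in> ?ZT"
      unfolding W.hom_cycles_iff
      using lmod_hom_restrict[OF T f] lmod_hom_closed[OF f] by (simp add: cycles_eq)
    have "HT.curried (restrict f (carrier T)) m = \<phi> m" if m: "m \<in> carrier M" for m
    proof
      fix l
      show "HT.curried (restrict f (carrier T)) m l = \<phi> m l"
        using m \<phi>_cycle[OF m] f\<phi>[of l m] HT.\<tau>_closed[of l m] unfolding Z_iff
        by (cases "l \<in> carrier L") (simp_all add: HT.curried_def extensional_def)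
    qed
    then have "(\<lambda>m\<in>carrier M. ?\<pi> (HT.curried (restrict f (carrier T)) m)) = \<psi>"
      using \<phi>\<psi> by (intro extensionalityI[OF restrict_extensional \<psi>(2)]) simp
    then show "\<exists>f\<in>?ZT. (\<lambda>m\<in>carrier M. ?\<pi> (HT.curried f m)) = \<psi>" using cyc by blast
  next
    fix f assume f: "f \<in> ?ZT"
    then have fh: "f \<in> lmod_hom R T (obj W n)" and fe: "f \<in> extensional (carrier T)"
      unfolding W.hom_cycles_iff by auto
    note cf = HT.curried_hom[OF fh]
    have "(\<lambda>m\<in>carrier M. ?\<pi> (HT.curried f m)) = \<zero>\<^bsub>hom_group S M ?H\<^esub> \<longleftrightarrow>
        (\<forall>m\<in>carrier M. ?\<pi> (HT.curried f m) = \<zero>\<^bsub>?H\<^esub>)"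
      by (auto simp: fun_eq_iff restrict_def)
    also have "\<dots> \<longleftrightarrow> (\<forall>m\<in>carrier M. HT.curried f m \<in> ?B)"
      using \<pi>_zero[OF curried_cycle[OF f]] by blast
    also have "\<dots> \<longleftrightarrow> f \<in> ?BT"
    proof
      assume cB: "\<forall>m\<in>carrier M. HT.curried f m \<in> ?B"
      \<comment> \<open>The curried map lifts along the differential onto the boundaries, and uncurrying the lift
        gives a map on \<open>T\<close> with boundary \<open>f\<close>.\<close>
      have cfB: "HT.curried f \<in> lmod_hom S M (?C n\<lparr>carrier := ?B\<rparr>)"
        by (rule lmod_homI) (simp_all add: cB lmod_hom_add[OF cf] lmod_hom_smult[OF cf]
            del: hom_mod_simps)
      have dB: "?d n \<in> lmod_hom S (?C (Suc n)) (?C n\<lparr>carrier := ?B\<rparr>)"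
        by (rule lmod_homI) (simp_all add: boundaries_def lmod_hom_add[OF d] lmod_hom_smult[OF d]
            del: hom_mod_simps)
      have "?d n ` carrier (?C (Suc n)) = carrier (?C n\<lparr>carrier := ?B\<rparr>)" by (simp add: boundaries_def)
      from projective_lift[OF P C Bm dB this cfB]
      obtain \<phi> where \<phi>: "\<phi> \<in> lmod_hom S M (?C (Suc n))"
        and d\<phi>: "\<And>m. m \<in> carrier M \<Longrightarrow> ?d n (\<phi> m) = HT.curried f m" by blast
      from hom_tensor.uncurry[OF HT \<phi>] obtain g where g: "g \<in> lmod_hom R T (obj W (Suc n))"
        and g\<phi>: "\<And>l m. \<lbrakk>l \<in> carrier L; m \<in> carrier M\<rbrakk> \<Longrightarrow> g (\<tau> l m) = \<phi> m l" by blast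
      have "f t = diff W n (g t)" if t: "t \<in> carrier T" for t
      proof (rule HT.hom_eqI[OF fh lmod_hom_comp[OF g W.diff_hom] _ t])
        show "f (\<tau> l m) = diff W n (g (\<tau> l m))" if "l \<in> carrier L" "m \<in> carrier M" for l m
          using fun_cong[OF d\<phi>[OF that(2)], of l] that by (simp add: g\<phi> compose_def HT.curried_def)
      qed
      then show "f \<in> ?BT" unfolding W.hom_boundaries_iff[OF T] using fe g by blast
    next
      assume "f \<in> ?BT"
      then obtain g where g: "g \<in> lmod_hom R T (obj W (Suc n))"
        and fg: "\<And>t. t \<in> carrier T \<Longrightarrow> f t = diff W n (g t)"
        unfolding W.hom_boundaries_iff[OF T] by blast
      show "\<forall>m\<in>carrier M. HT.curried f m \<in> ?B"
      proof
        fix m assume m: "m \<in> carrier M"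
        interpret HT': hom_tensor R S L M T \<tau> "obj W (Suc n)" by (rule HT)
        have "HT.curried f m = ?d n (HT'.curried g m)"
          using m by (auto simp: HT.curried_def HT'.curried_def compose_def fg HT.\<tau>_closed intro!: restrict_ext)
        then show "HT.curried f m \<in> ?B"
          using lmod_hom_closed[OF HT'.curried_hom[OF g] m] by (simp add: boundaries_def del: hom_mod_simps)
      qed
    qed
    finally show "(\<lambda>m\<in>carrier M. ?\<pi> (HT.curried f m)) = \<zero>\<^bsub>hom_group S M ?H\<^esub> \<longleftrightarrow> f \<in> ?BT" .
  qed
qed

lemma hom_tensor_left:
  assumes L: "bimodule R S L" and M: "left_module S M" and Y: "left_module R Y"
  shows "hom_tensor R S L M (tensor_left S L M) (pure_tensor S (flip L) M) Y"
proof -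
  interpret LM: tensor_factors S "flip L" M by (rule tensor_factors_left[OF L M])
  show ?thesis
  proof (rule hom_tensor.intro)
    show "left_module R (tensor_left S L M)" by (rule tensor_left_module[OF L M])
    show "P t" if "t \<in> carrier (tensor_left S L M)"
      "\<And>l m. \<lbrakk>l \<in> carrier L; m \<in> carrier M\<rbrakk> \<Longrightarrow> P (pure_tensor S (flip L) M l m)"
      "\<And>x y. \<lbrakk>x \<in> carrier (tensor_left S L M); y \<in> carrier (tensor_left S L M); P x; P y\<rbrakk>
        \<Longrightarrow> P (x \<oplus>\<^bsub>tensor_left S L M\<^esub> y)" for P t
      by (rule LM.tensor_induct[of t]) (use that in \<open>simp_all add: tensor_left_simps\<close>)
    show "\<exists>h. (\<forall>t\<in>carrier (tensor_left S L M). h t \<in> carrier Y) \<and>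
        (\<forall>x\<in>carrier (tensor_left S L M). \<forall>y\<in>carrier (tensor_left S L M).
          h (x \<oplus>\<^bsub>tensor_left S L M\<^esub> y) = h x \<oplus>\<^bsub>Y\<^esub> h y) \<and>
        (\<forall>l\<in>carrier L. \<forall>m\<in>carrier M. h (pure_tensor S (flip L) M l m) = \<beta> l m)"
      if \<beta>: "\<And>l m. \<lbrakk>l \<in> carrier L; m \<in> carrier M\<rbrakk> \<Longrightarrow> \<beta> l m \<in> carrier Y"
        "\<And>l l' m. \<lbrakk>l \<in> carrier L; l' \<in> carrier L; m \<in> carrier M\<rbrakk> \<Longrightarrow> \<beta> (l \<oplus>\<^bsub>L\<^esub> l') m = \<beta> l m \<oplus>\<^bsub>Y\<^esub> \<beta> l' m"
        "\<And>l m m'. \<lbrakk>l \<in> carrier L; m \<in> carrier M; m' \<in> carrier M\<rbrakk> \<Longrightarrow> \<beta> l (m \<oplus>\<^bsub>M\<^esub> m') = \<beta> l m \<oplus>\<^bsub>Y\<^esub> \<beta> l m'"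
        "\<And>s l m. \<lbrakk>s \<in> carrier S; l \<in> carrier L; m \<in> carrier M\<rbrakk> \<Longrightarrow> \<beta> (rsmult L l s) m = \<beta> l (s \<odot>\<^bsub>M\<^esub> m)" for \<beta>
    proof -
      obtain h where h: "abelian_group_hom (tensor S (flip L) M) Y h"
        "\<And>l m. \<lbrakk>l \<in> carrier (flip L); m \<in> carrier M\<rbrakk> \<Longrightarrow> h (pure_tensor S (flip L) M l m) = \<beta> l m"
        by (rule LM.tensor_universal[OF left_module.axioms(2)[OF Y], of \<beta>]) (simp_all add: \<beta>)
      interpret h: abelian_group_hom "tensor S (flip L) M" Y h by (rule h(1))
      show ?thesis by (intro exI[of _ h]) (simp add: tensor_left_simps h(2))
    qed
  qed (use LM.pure_closed LM.pure_add_left LM.pure_add_right LM.pure_balanced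
      tensor_left_smult_pure[OF L M] in \<open>simp_all add: L M Y tensor_left_simps(1-3)\<close>)
qed

lemma hom_tensor_right:
  fixes L :: "('s, 'r, 'l) bimodule"
  assumes L: "bimodule S R L" and M: "right_module S M" and Y: "right_module R Y"
  shows "hom_tensor (opp R) (opp S) (flip L) M (tensor_right S M L) (\<lambda>l m. pure_tensor S M L m l) Y"
proof -
  interpret TM: tensor_factors S M L by (rule tensor_factors_right[OF M L])
  show ?thesis
  proof (rule hom_tensor.intro)
    show "bimodule (opp R) (opp S) (flip L)" by (rule bimodule_flip[OF L])
    show "right_module R (tensor_right S M L)" by (rule tensor_right_module[OF M L])
    show "P t" if "t \<in> carrier (tensor_right S M L)"
      "\<And>l m. \<lbrakk>l \<in> carrier (flip L); m \<in> carrier M\<rbrakk> \<Longrightarrow> P (pure_tensor S M L m l)"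
      "\<And>x y. \<lbrakk>x \<in> carrier (tensor_right S M L); y \<in> carrier (tensor_right S M L); P x; P y\<rbrakk>
        \<Longrightarrow> P (x \<oplus>\<^bsub>tensor_right S M L\<^esub> y)" for P t
      by (rule TM.tensor_induct[of t]) (use that in \<open>simp_all add: tensor_right_simps\<close>)
    show "\<exists>h. (\<forall>t\<in>carrier (tensor_right S M L). h t \<in> carrier Y) \<and>
        (\<forall>x\<in>carrier (tensor_right S M L). \<forall>y\<in>carrier (tensor_right S M L).
          h (x \<oplus>\<^bsub>tensor_right S M L\<^esub> y) = h x \<oplus>\<^bsub>Y\<^esub> h y) \<and>
        (\<forall>l\<in>carrier (flip L). \<forall>m\<in>carrier M. h (pure_tensor S M L m l) = \<beta> l m)"
      if \<beta>: "\<And>l m. \<lbrakk>l \<in> carrier (flip L); m \<in> carrier M\<rbrakk> \<Longrightarrow> \<beta> l m \<in> carrier Y"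
        "\<And>l l' m. \<lbrakk>l \<in> carrier (flip L); l' \<in> carrier (flip L); m \<in> carrier M\<rbrakk> \<Longrightarrow>
          \<beta> (l \<oplus>\<^bsub>flip L\<^esub> l') m = \<beta> l m \<oplus>\<^bsub>Y\<^esub> \<beta> l' m"
        "\<And>l m m'. \<lbrakk>l \<in> carrier (flip L); m \<in> carrier M; m' \<in> carrier M\<rbrakk> \<Longrightarrow>
          \<beta> l (m \<oplus>\<^bsub>M\<^esub> m') = \<beta> l m \<oplus>\<^bsub>Y\<^esub> \<beta> l m'"
        "\<And>s l m. \<lbrakk>s \<in> carrier (opp S); l \<in> carrier (flip L); m \<in> carrier M\<rbrakk> \<Longrightarrow>
          \<beta> (rsmult (flip L) l s) m = \<beta> l (s \<odot>\<^bsub>M\<^esub> m)" for \<beta>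
    proof -
      obtain h where h: "abelian_group_hom (tensor S M L) Y h"
        "\<And>m l. \<lbrakk>m \<in> carrier M; l \<in> carrier L\<rbrakk> \<Longrightarrow> h (pure_tensor S M L m l) = \<beta> l m"
        by (rule TM.tensor_universal[OF left_module.axioms(2)[OF Y], of "\<lambda>m l. \<beta> l m"])
           (use \<beta> in simp_all)
      interpret h: abelian_group_hom "tensor S M L" Y h by (rule h(1))
      show ?thesis by (intro exI[of _ h]) (simp add: tensor_right_simps h(2))
    qed
  qed (use TM.pure_closed TM.pure_add_left TM.pure_add_right TM.pure_balanced
      tensor_right_smult_pure[OF M L] in \<open>simp_all add: M Y tensor_right_simps(1-3)\<close>)
qed


section \<open>Associativity of the tensor product\<close>

text \<open>For fixed \<open>b\<close> the map \<open>t \<otimes> b \<mapsto> (id \<otimes> (\<lambda>m. m \<otimes> b)) t\<close>, and for fixed \<open>l\<close> the map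
  \<open>l \<otimes> y \<mapsto> ((\<lambda>m. l \<otimes> m) \<otimes> id) y\<close> in the other direction, is itself induced by a homomorphism in one
  factor, so that both are well defined by functoriality.\<close>

lemma tensor_assoc:
  fixes M :: "('s, 'r, 'm) bimodule"
  assumes L: "right_module S L" and M: "bimodule S R M" and B: "left_module R B"
  defines "LM \<equiv> tensor_right S L M" and "MB \<equiv> tensor_left R M B"
  obtains \<alpha> \<alpha>' where "abelian_group_hom (tensor R LM B) (tensor S L MB) \<alpha>"
    "abelian_group_hom (tensor S L MB) (tensor R LM B) \<alpha>'"
    "\<And>x. x \<in> carrier (tensor R LM B) \<Longrightarrow> \<alpha>' (\<alpha> x) = x"
    "\<And>y. y \<in> carrier (tensor S L MB) \<Longrightarrow> \<alpha> (\<alpha>' y) = y"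
    "\<And>t b. \<lbrakk>t \<in> carrier LM; b \<in> carrier B\<rbrakk> \<Longrightarrow> \<alpha> (pure_tensor R LM B t b)
      = tensor_map S L MB (\<lambda>x. x) (\<lambda>m. pure_tensor R (flip M) B m b) t"
proof -
  have tLM: "tensor_factors S L M" by (rule tensor_factors_right[OF L M])
  have tMB: "tensor_factors R (flip M) B" by (rule tensor_factors_left[OF M B])
  have LMm: "right_module R LM" unfolding LM_def by (rule tensor_right_module[OF L M])
  have MBm: "left_module S MB" unfolding MB_def by (rule tensor_left_module[OF M B])
  have t1: "tensor_factors R LM B" and t2: "tensor_factors S L MB"
    using LMm MBm L B by (simp_all add: tensor_factors_def)
  interpret tLM: tensor_factors S L M by (rule tLM)
  interpret tMB: tensor_factors R "flip M" B by (rule tMB)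
  interpret t1: tensor_factors R LM B by (rule t1)
  interpret t2: tensor_factors S L MB by (rule t2)
  have LM_simps: "carrier LM = carrier (tensor S L M)" "x \<oplus>\<^bsub>LM\<^esub> y = x \<oplus>\<^bsub>tensor S L M\<^esub> y" for x y
    by (simp_all add: LM_def tensor_right_simps)
  have MB_simps: "carrier MB = carrier (tensor R (flip M) B)" "x \<oplus>\<^bsub>MB\<^esub> y = x \<oplus>\<^bsub>tensor R (flip M) B\<^esub> y" for x y
    by (simp_all add: MB_def tensor_left_simps)
  let ?lm = "pure_tensor S L M" and ?mb = "pure_tensor R (flip M) B"
  have mb: "(\<lambda>m. ?mb m b) \<in> lmod_hom S M MB" if b: "b \<in> carrier B" for b
    by (rule lmod_homI)
       (use b tMB.pure_add_left tMB.pure_closed in \<open>simp_all add: MB_simps tensor_left_smult_pure[OF M B, folded MB_def]\<close>)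
  have lm: "(\<lambda>m. ?lm l m) \<in> lmod_hom R (flip M) LM" if l: "l \<in> carrier L" for l
    by (rule lmod_homI)
       (use l tLM.pure_add_right tLM.pure_closed in \<open>simp_all add: LM_simps tensor_right_smult_pure[OF L M, folded LM_def]\<close>)
  define \<beta> where "\<beta> t b = tensor_map S L MB (\<lambda>x. x) (\<lambda>m. ?mb m b) t" for t b
  define \<gamma> where "\<gamma> l y = tensor_map R LM B (\<lambda>m. ?lm l m) (\<lambda>x. x) y" for l y
  have \<beta>_hom: "abelian_group_hom (tensor S L M) (tensor S L MB) (\<lambda>t. \<beta> t b)" if "b \<in> carrier B" for b
    unfolding \<beta>_def by (rule tensor_map_hom[OF tLM lmod_hom_id mb[OF that] t2])
  have \<gamma>_hom: "abelian_group_hom (tensor R (flip M) B) (tensor R LM B) (\<gamma> l)" if "l \<in> carrier L" for l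
    unfolding \<gamma>_def by (rule tensor_map_hom[OF tMB lm[OF that] lmod_hom_id t1])
  have \<beta>_pure: "\<beta> (?lm l m) b = pure_tensor S L MB l (?mb m b)"
    if "l \<in> carrier L" "m \<in> carrier M" "b \<in> carrier B" for l m b
    unfolding \<beta>_def by (rule tensor_map_pure[OF tLM lmod_hom_id mb[OF that(3)] t2 that(1,2)])
  have \<gamma>_pure: "\<gamma> l (?mb m b) = pure_tensor R LM B (?lm l m) b"
    if "l \<in> carrier L" "m \<in> carrier M" "b \<in> carrier B" for l m b
    unfolding \<gamma>_def by (rule tensor_map_pure[OF tMB lm[OF that(1)] lmod_hom_id t1]) (use that in simp_all)
  note \<beta>_closed = abelian_group_hom.hom_closed[OF \<beta>_hom] and \<beta>_add = abelian_group_hom.hom_add[OF \<beta>_hom]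
  note \<gamma>_closed = abelian_group_hom.hom_closed[OF \<gamma>_hom] and \<gamma>_add = abelian_group_hom.hom_add[OF \<gamma>_hom]
  have \<beta>_add': "\<beta> t (b \<oplus>\<^bsub>B\<^esub> b') = \<beta> t b \<oplus>\<^bsub>tensor S L MB\<^esub> \<beta> t b'"
    if t: "t \<in> carrier (tensor S L M)" and b: "b \<in> carrier B" "b' \<in> carrier B" for t b b'
  proof -
    have bb: "b \<oplus>\<^bsub>B\<^esub> b' \<in> carrier B" using b by simp
    have "\<beta> t (b \<oplus>\<^bsub>B\<^esub> b') = tensor_map S L MB (\<lambda>x. x) (\<lambda>m. ?mb m b \<oplus>\<^bsub>MB\<^esub> ?mb m b') t"
      unfolding \<beta>_def
      by (rule tensor_map_cong[OF tLM t2 lmod_hom_id mb[OF bb]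
            lmod_hom_pointwise_add[OF tLM.left MBm mb[OF b(1)] mb[OF b(2)]] _ t])
         (use b in \<open>simp add: tMB.pure_add_right MB_simps\<close>)
    then show ?thesis
      unfolding \<beta>_def tensor_map_add[OF tLM t2 mb[OF b(1)] mb[OF b(2)] t] .
  qed
  have \<beta>_balanced: "\<beta> (r \<odot>\<^bsub>LM\<^esub> t) b = \<beta> t (r \<odot>\<^bsub>B\<^esub> b)"
    if r: "r \<in> carrier R" and t: "t \<in> carrier (tensor S L M)" and b: "b \<in> carrier B" for r t b
  proof -
    note rs = bimodule_rsmult_hom[OF M r]
    have rb: "r \<odot>\<^bsub>B\<^esub> b \<in> carrier B" using r b by simp
    have "\<beta> (r \<odot>\<^bsub>LM\<^esub> t) b = tensor_map S L MB (\<lambda>x. x) (\<lambda>m. ?mb (rsmult M m r) b) t"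
      unfolding \<beta>_def LM_def tensor_right_simps
      by (rule tensor_map_comp[OF tLM tLM t2 lmod_hom_id rs lmod_hom_id mb[OF b] t])
    also have "\<dots> = \<beta> t (r \<odot>\<^bsub>B\<^esub> b)"
      unfolding \<beta>_def
      by (rule tensor_map_cong[OF tLM t2 lmod_hom_id lmod_hom_comp[OF rs mb[OF b]] mb[OF rb] _ t])
         (use tMB.pure_balanced[OF r _ b] in simp)
    finally show ?thesis .
  qed
  have \<gamma>_add': "\<gamma> (l \<oplus>\<^bsub>L\<^esub> l') y = \<gamma> l y \<oplus>\<^bsub>tensor R LM B\<^esub> \<gamma> l' y"
    if l: "l \<in> carrier L" "l' \<in> carrier L" and y: "y \<in> carrier (tensor R (flip M) B)" for l l' y
    using y
  proof (induction rule: tMB.tensor_induct)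
    case (pure m b)
    then show ?case
      using l by (simp add: \<gamma>_pure tLM.pure_add_left t1.pure_add_left[unfolded LM_simps])
  next
    case (add x y)
    then show ?case using l by (simp add: \<gamma>_add \<gamma>_closed t1.T.a_ac)
  qed
  have \<gamma>_balanced: "\<gamma> (s \<odot>\<^bsub>L\<^esub> l) y = \<gamma> l (s \<odot>\<^bsub>MB\<^esub> y)"
    if s: "s \<in> carrier S" and l: "l \<in> carrier L" and y: "y \<in> carrier (tensor R (flip M) B)" for s l y
  proof -
    note sm = bimodule_smult_hom[OF M s]
    have sl: "s \<odot>\<^bsub>L\<^esub> l \<in> carrier L" using tLM.A.smult_closed s l by simp
    have eq: "\<gamma> l (s \<odot>\<^bsub>MB\<^esub> y) = tensor_map R LM B (\<lambda>m. ?lm l (s \<odot>\<^bsub>M\<^esub> m)) (\<lambda>x. x) y"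
      unfolding \<gamma>_def MB_def tensor_left_simps
      by (rule tensor_map_comp[OF tMB tMB t1 sm lmod_hom_id lm[OF l] lmod_hom_id y])
    show ?thesis
      unfolding eq unfolding \<gamma>_def
      by (rule tMB.tensor_hom_eqI[OF tensor_map_hom[OF tMB lm[OF sl] lmod_hom_id t1]
            tensor_map_hom[OF tMB lmod_hom_comp[OF sm lm[OF l]] lmod_hom_id t1] _ y])
         (simp add: tensor_map_pure[OF tMB lm[OF sl] lmod_hom_id t1]
            tensor_map_pure[OF tMB lmod_hom_comp[OF sm lm[OF l]] lmod_hom_id t1] tLM.pure_balanced[OF s l])
  qed
  obtain \<alpha> where \<alpha>: "abelian_group_hom (tensor R LM B) (tensor S L MB) \<alpha>"
    and \<alpha>_pure: "\<And>t b. \<lbrakk>t \<in> carrier LM; b \<in> carrier B\<rbrakk> \<Longrightarrow> \<alpha> (pure_tensor R LM B t b) = \<beta> t b"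
    by (rule t1.tensor_universal[OF t2.abelian_group_T, of \<beta>])
       (simp_all add: LM_simps \<beta>_closed \<beta>_add \<beta>_add' \<beta>_balanced)
  obtain \<alpha>' where \<alpha>': "abelian_group_hom (tensor S L MB) (tensor R LM B) \<alpha>'"
    and \<alpha>'_pure: "\<And>l y. \<lbrakk>l \<in> carrier L; y \<in> carrier MB\<rbrakk> \<Longrightarrow> \<alpha>' (pure_tensor S L MB l y) = \<gamma> l y"
    by (rule t2.tensor_universal[OF t1.abelian_group_T, of \<gamma>])
       (simp_all add: MB_simps \<gamma>_closed \<gamma>_add \<gamma>_add' \<gamma>_balanced)
  have \<alpha>'\<beta>: "\<alpha>' (\<beta> t b) = pure_tensor R LM B t b" if t: "t \<in> carrier (tensor S L M)" and b: "b \<in> carrier B" for t b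
    using t
  proof (induction rule: tLM.tensor_induct)
    case (pure l m)
    then show ?case using b tMB.pure_closed by (simp add: \<beta>_pure \<alpha>'_pure \<gamma>_pure MB_simps)
  next
    case (add x y)
    then show ?case
      using b t1.pure_add_left[of x y b] abelian_group_hom.hom_add[OF \<alpha>' \<beta>_closed[OF b add(1)] \<beta>_closed[OF b add(2)]]
      by (simp add: \<beta>_add LM_simps)
  qed
  have \<alpha>\<gamma>: "\<alpha> (\<gamma> l y) = pure_tensor S L MB l y" if l: "l \<in> carrier L" and y: "y \<in> carrier (tensor R (flip M) B)" for l y
    using y
  proof (induction rule: tMB.tensor_induct)
    case (pure m b)
    then show ?case using l tLM.pure_closed by (simp add: \<beta>_pure \<alpha>_pure \<gamma>_pure LM_simps)
  next
    case (add x y)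
    then show ?case
      using l t2.pure_add_right[of l x y] abelian_group_hom.hom_add[OF \<alpha> \<gamma>_closed[OF l add(1)] \<gamma>_closed[OF l add(2)]]
      by (simp add: \<gamma>_add MB_simps)
  qed
  show thesis
  proof (rule that[OF \<alpha> \<alpha>'])
    show "\<alpha>' (\<alpha> x) = x" if "x \<in> carrier (tensor R LM B)" for x
      by (rule t1.tensor_hom_eqI[OF abelian_group_hom_compose[OF \<alpha> \<alpha>']
            abelian_group_hom_intro[OF t1.abelian_group_T t1.abelian_group_T] _ that])
         (simp_all add: \<alpha>_pure \<alpha>'\<beta> LM_simps)
    show "\<alpha> (\<alpha>' y) = y" if "y \<in> carrier (tensor S L MB)" for y
      by (rule t2.tensor_hom_eqI[OF abelian_group_hom_compose[OF \<alpha>' \<alpha>]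
            abelian_group_hom_intro[OF t2.abelian_group_T t2.abelian_group_T] _ that])
         (simp_all add: \<alpha>'_pure \<alpha>\<gamma> MB_simps)
    show "\<alpha> (pure_tensor R LM B t b) = tensor_map S L MB (\<lambda>x. x) (\<lambda>m. ?mb m b) t"
      if "t \<in> carrier LM" "b \<in> carrier B" for t b
      using \<alpha>_pure[OF that] by (simp add: \<beta>_def)
  qed
qed


section \<open>Flat modules and cohomology\<close>

text \<open>Flatness identifies \<open>L \<otimes> Z\<close> with the cocycles of \<open>L \<otimes> C\<close>, since \<open>C\<^sup>n / Z\<close> embeds into
  \<open>C\<^sup>n\<^sup>+\<^sup>1\<close>; right exactness identifies the kernel of \<open>L \<otimes> Z \<rightarrow> L \<otimes> (Z / B)\<close> with the image of
  \<open>L \<otimes> B\<close>, that is, with the coboundaries.\<close>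

lemma flat_cohomology:
  fixes C :: "nat \<Rightarrow> ('s, 'c) module"
  assumes flat: "flat_right S L" and C: "\<And>i. left_module S (C i)"
    and d: "\<And>i. d i \<in> lmod_hom S (C i) (C (Suc i))"
    and dd: "\<And>i x. x \<in> carrier (C i) \<Longrightarrow> d (Suc i) (d i x) = \<zero>\<^bsub>C (Suc (Suc i))\<^esub>"
  shows "add_monoid (cohomology (\<lambda>i. tensor S L (C i)) (\<lambda>i. tensor_map S L (C (Suc i)) (\<lambda>x. x) (d i)) n)
    \<cong> add_monoid (tensor S L (cohomology_mod C d n))"
proof -
  have L: "right_module S L" using flat by (simp add: flat_right_def)
  have tf: "tensor_factors S L N" if "left_module S N" for N :: "('s, 'q) module"
    using L that by (simp add: tensor_factors_def)
  have tf': "tensor_factors S L N" if "left_module S N" for N :: "('s, 'c) module"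
    using L that by (simp add: tensor_factors_def)
  note tC = tf'[OF C]
  let ?D = "\<lambda>i. tensor S L (C i)" and ?e = "\<lambda>i. tensor_map S L (C (Suc i)) (\<lambda>x. x) (d i)"
  have e: "abelian_group_hom (?D i) (?D (Suc i)) (?e i)" for i
    by (rule tensor_map_hom[OF tC lmod_hom_id d tC])
  have ee: "?e (Suc i) (?e i t) = \<zero>\<^bsub>?D (Suc (Suc i))\<^esub>" if t: "t \<in> carrier (?D i)" for i t
    by (subst tensor_map_comp[OF tC tC tC lmod_hom_id d lmod_hom_id d t],
        rule tensor_map_zero[OF tC tC lmod_hom_comp[OF d d] dd t])
  let ?Z = "cocycles C d n" and ?B = "coboundaries C d n"
  have Zs: "submodule ?Z S (C n)" and Bs: "submodule ?B S (C n)"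
    by (rule cochain_complex_submodules[where C = C and d = d, OF C d])+
  have BZ: "?B \<subseteq> ?Z"
    by (rule cochain_complex_subgroups(3)[where C = C and d = d, OF lmod_hom_abelian_group_hom[OF C C d] dd])
  have ZC: "?Z \<subseteq> carrier (C n)" by (auto simp: cocycles_eq)
  let ?Zm = "C n\<lparr>carrier := ?Z\<rparr>" and ?Bm = "C n\<lparr>carrier := ?B\<rparr>"
  have Zm: "left_module S ?Zm" and Bm: "left_module S ?Bm"
    using submodule_left_module[OF C Zs] submodule_left_module[OF C Bs] .
  define H where "H = cohomology_mod C d n"
  let ?\<pi> = "\<lambda>z. ?B +>\<^bsub>C n\<^esub> z"
  have Hdef: "H = subquot_mod (C n) ?Z ?B" by (simp add: H_def cohomology_mod_def)
  have Hm: "left_module S H" unfolding Hdef by (rule subquot_mod_left_module[OF C Bs Zs BZ])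
  have \<pi>: "?\<pi> \<in> lmod_hom S ?Zm H" unfolding Hdef by (rule subquot_mod_proj[OF C Bs Zs BZ])
  have \<pi>_zero: "?\<pi> z = \<zero>\<^bsub>H\<^esub> \<longleftrightarrow> z \<in> ?B" if "z \<in> ?Z" for z
    unfolding Hdef by (rule subquot_mod_proj_eq_zero[OF C Bs Zs BZ that])
  have \<pi>_surj: "?\<pi> ` carrier ?Zm = carrier H" by (simp add: Hdef subquot_mod_simps)
  note tZ = tf'[OF Zm] and tB = tf'[OF Bm] and tH = tf[OF Hm]
  interpret tZ: tensor_factors S L ?Zm by (rule tZ)
  interpret tH: tensor_factors S L H by (rule tH)
  note \<iota> = submodule_inclusion[OF ZC]
  let ?I = "tensor_map S L (C n) (\<lambda>x. x) (\<lambda>x. x)" and ?P = "tensor_map S L H (\<lambda>x. x) ?\<pi>"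
  interpret I: abelian_group_hom "tensor S L ?Zm" "?D n" ?I
    by (rule tensor_map_hom[OF tZ lmod_hom_id \<iota> tC])
  interpret P: abelian_group_hom "tensor S L ?Zm" "tensor S L H" ?P
    by (rule tensor_map_hom[OF tZ lmod_hom_id \<pi> tH])
  have I_inj: "inj_on ?I (carrier (tensor S L ?Zm))"
    by (rule flat_inj[OF flat Zm C \<iota>]) (simp add: inj_on_def)
  have dI: "submodule (d n ` carrier (C n)) S (C (Suc n))"
    by (rule lmod_hom_image_submodule[OF C C d])
  have cocycle_iff: "x \<in> cocycles ?D ?e n \<longleftrightarrow> x \<in> ?I ` carrier (tensor S L ?Zm)" for x
  proof
    let ?Im = "C (Suc n)\<lparr>carrier := d n ` carrier (C n)\<rparr>"
    have Im: "left_module S ?Im" by (rule submodule_left_module[OF C dI])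
    note tIm = tf'[OF Im]
    interpret tIm: tensor_factors S L ?Im by (rule tIm)
    have \<kappa>: "(\<lambda>x. x) \<in> lmod_hom S ?Im (C (Suc n))"
      by (rule submodule_inclusion) (use lmod_hom_closed[OF d] in auto)
    have dIm: "d n \<in> lmod_hom S (C n) ?Im"
      by (rule lmod_homI) (simp_all add: lmod_hom_add[OF d] lmod_hom_smult[OF d])
    interpret dm: abelian_group_hom "?D n" "tensor S L ?Im" "tensor_map S L ?Im (\<lambda>x. x) (d n)"
      by (rule tensor_map_hom[OF tC lmod_hom_id dIm tIm])
    interpret \<kappa>m: abelian_group_hom "tensor S L ?Im" "?D (Suc n)" "tensor_map S L (C (Suc n)) (\<lambda>x. x) (\<lambda>x. x)"
      by (rule tensor_map_hom[OF tIm lmod_hom_id \<kappa> tC])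
    have \<kappa>_inj: "inj_on (tensor_map S L (C (Suc n)) (\<lambda>x. x) (\<lambda>x. x)) (carrier (tensor S L ?Im))"
      by (rule flat_inj[OF flat Im C \<kappa>]) (simp add: inj_on_def)
    assume "x \<in> cocycles ?D ?e n"
    then have x: "x \<in> carrier (?D n)" and ex: "?e n x = \<zero>\<^bsub>?D (Suc n)\<^esub>" by (auto simp: cocycles_eq)
    have "tensor_map S L (C (Suc n)) (\<lambda>x. x) (\<lambda>x. x) (tensor_map S L ?Im (\<lambda>x. x) (d n) x)
        = tensor_map S L (C (Suc n)) (\<lambda>x. x) (\<lambda>x. x) \<zero>\<^bsub>tensor S L ?Im\<^esub>"
      unfolding \<kappa>m.hom_zero
      using tensor_map_comp[OF tC tIm tC lmod_hom_id dIm lmod_hom_id \<kappa> x] ex by simp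
    then have "tensor_map S L ?Im (\<lambda>x. x) (d n) x = \<zero>\<^bsub>tensor S L ?Im\<^esub>"
      by (rule inj_onD[OF \<kappa>_inj]) (use x in simp_all)
    from tensor_right_exact[OF tZ tC tIm \<iota> dIm _ _ x this]
    show "x \<in> ?I ` carrier (tensor S L ?Zm)" by (simp add: cocycles_eq)
  next
    assume "x \<in> ?I ` carrier (tensor S L ?Zm)"
    then obtain t where t: "t \<in> carrier (tensor S L ?Zm)" "x = ?I t" by blast
    have "?e n x = \<zero>\<^bsub>?D (Suc n)\<^esub>"
      unfolding t(2) tensor_map_comp[OF tZ tC tC lmod_hom_id \<iota> lmod_hom_id d t(1)]
      by (rule tensor_map_zero[OF tZ tC lmod_hom_comp[OF \<iota> d] _ t(1)]) (simp add: cocycles_eq)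
    then show "x \<in> cocycles ?D ?e n" using t by (simp add: cocycles_eq)
  qed
  have kernel: "?P t = \<zero>\<^bsub>tensor S L H\<^esub> \<longleftrightarrow> ?I t \<in> coboundaries ?D ?e n"
    if t: "t \<in> carrier (tensor S L ?Zm)" for t
  proof
    have j: "(\<lambda>x. x) \<in> lmod_hom S ?Bm ?Zm" by (rule lmod_homI) (use BZ in auto)
    have j': "(\<lambda>x. x) \<in> lmod_hom S ?Bm (C n)" by (rule submodule_inclusion) (use BZ ZC in auto)
    assume Pt: "?P t = \<zero>\<^bsub>tensor S L H\<^esub>"
    have "t \<in> tensor_map S L ?Zm (\<lambda>x. x) (\<lambda>x. x) ` carrier (tensor S L ?Bm)"
    proof (rule tensor_right_exact[OF tB tZ tH j \<pi> \<pi>_surj _ t Pt])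
      fix z assume "z \<in> carrier ?Zm" "?\<pi> z = \<zero>\<^bsub>H\<^esub>"
      then have "z \<in> ?B" using \<pi>_zero[of z] by simp
      then show "z \<in> (\<lambda>x. x) ` carrier ?Bm" by simp
    qed
    then obtain u where u: "u \<in> carrier (tensor S L ?Bm)" and tu: "t = tensor_map S L ?Zm (\<lambda>x. x) (\<lambda>x. x) u"
      by blast
    have It: "?I t = ?I u"
      unfolding tu by (rule tensor_map_comp[OF tB tZ tC lmod_hom_id j lmod_hom_id \<iota> u])
    show "?I t \<in> coboundaries ?D ?e n"
    proof (cases n)
      case 0
      \<comment> \<open>The coboundaries in degree \<open>0\<close> are zero, and so their inclusion is the zero map.\<close>
      have "?I u = \<zero>\<^bsub>?D n\<^esub>"
        by (rule tensor_map_zero[OF tB tC j' _ u]) (simp add: coboundaries_def 0)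
      then show ?thesis unfolding It by (simp add: coboundaries_def 0)
    next
      case (Suc k)
      have dB: "d k \<in> lmod_hom S (C k) ?Bm"
        by (rule lmod_homI) (use lmod_hom_add[OF d[of k]] lmod_hom_smult[OF d[of k]] in
            \<open>simp_all add: coboundaries_def Suc\<close>)
      have "d k ` carrier (C k) = carrier ?Bm" by (simp add: coboundaries_def Suc)
      from tensor_map_surj[OF tC tB dB this] u
      obtain w where w: "w \<in> carrier (?D k)" "u = tensor_map S L ?Bm (\<lambda>x. x) (d k) w" by auto
      have "?I u = tensor_map S L (C n) (\<lambda>x. x) (d k) w"
        unfolding w(2) by (rule tensor_map_comp[OF tC tB tC lmod_hom_id dB lmod_hom_id j' w(1)])
      then show ?thesis unfolding It using w(1) by (simp add: coboundaries_def Suc)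
    qed
  next
    assume cob: "?I t \<in> coboundaries ?D ?e n"
    show "?P t = \<zero>\<^bsub>tensor S L H\<^esub>"
    proof (cases n)
      case 0
      then have "?I t = \<zero>\<^bsub>?D n\<^esub>" using cob by (simp add: coboundaries_def)
      also have "\<dots> = ?I \<zero>\<^bsub>tensor S L ?Zm\<^esub>" by simp
      finally have "t = \<zero>\<^bsub>tensor S L ?Zm\<^esub>" using inj_onD[OF I_inj] t by blast
      then show ?thesis by simp
    next
      case (Suc k)
      then obtain w where w: "w \<in> carrier (?D k)" "?I t = tensor_map S L (C n) (\<lambda>x. x) (d k) w"
        using cob by (auto simp: coboundaries_def)
      have dB: "d k x \<in> ?B" if "x \<in> carrier (C k)" for x using that by (simp add: coboundaries_def Suc)
      have dZ: "d k \<in> lmod_hom S (C k) ?Zm"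
        by (rule lmod_homI) (use dB BZ lmod_hom_add[OF d[of k]] lmod_hom_smult[OF d[of k]] Suc in auto)
      let ?t = "tensor_map S L ?Zm (\<lambda>x. x) (d k) w"
      have t': "?t \<in> carrier (tensor S L ?Zm)"
        by (rule abelian_group_hom.hom_closed[OF tensor_map_hom[OF tC lmod_hom_id dZ tZ] w(1)])
      have "?I ?t = ?I t"
        unfolding w(2) by (rule tensor_map_comp[OF tC tZ tC lmod_hom_id dZ lmod_hom_id \<iota> w(1)])
      then have "?P t = ?P ?t" using inj_onD[OF I_inj _ t' t] by simp
      also have "\<dots> = tensor_map S L H (\<lambda>x. x) (\<lambda>x. ?\<pi> (d k x)) w"
        by (rule tensor_map_comp[OF tC tZ tH lmod_hom_id dZ lmod_hom_id \<pi> w(1)])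
      also have "\<dots> = \<zero>\<^bsub>tensor S L H\<^esub>"
        by (rule tensor_map_zero[OF tC tH lmod_hom_comp[OF dZ \<pi>] _ w(1)]) (use dB BZ \<pi>_zero in auto)
      finally show ?thesis .
    qed
  qed
  let ?J = "inv_into (carrier (tensor S L ?Zm)) ?I"
  have J: "?J x \<in> carrier (tensor S L ?Zm)" "?I (?J x) = x" if "x \<in> cocycles ?D ?e n" for x
    using that unfolding cocycle_iff by (rule inv_into_into, rule f_inv_into_f)
  have JI: "?J (?I t) = t" if "t \<in> carrier (tensor S L ?Zm)" for t by (rule inv_into_f_f[OF I_inj that])
  show ?thesis
    unfolding cohomology_def H_def[symmetric]
  proof (rule subquot_iso[where \<phi> = "\<lambda>x. ?P (?J x)"])
    show "abelian_subgroup (coboundaries ?D ?e n) (?D n)" "abelian_subgroup (cocycles ?D ?e n) (?D n)"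
        "coboundaries ?D ?e n \<subseteq> cocycles ?D ?e n"
      by (rule cochain_complex_subgroups[where C = ?D and d = ?e, OF e ee] | assumption)+
    show "abelian_group (tensor S L H)" by (rule tH.abelian_group_T)
    show "?P (?J x) \<in> carrier (tensor S L H)" if "x \<in> cocycles ?D ?e n" for x using J[OF that] by simp
    show "?P (?J (x \<oplus>\<^bsub>?D n\<^esub> y)) = ?P (?J x) \<oplus>\<^bsub>tensor S L H\<^esub> ?P (?J y)"
      if "x \<in> cocycles ?D ?e n" "y \<in> cocycles ?D ?e n" for x y
    proof -
      have "?J (x \<oplus>\<^bsub>?D n\<^esub> y) = ?J x \<oplus>\<^bsub>tensor S L ?Zm\<^esub> ?J y"
        using JI[OF tZ.T.add.m_closed[OF J(1)[OF that(1)] J(1)[OF that(2)]]]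
        unfolding I.hom_add[OF J(1)[OF that(1)] J(1)[OF that(2)]] J(2)[OF that(1)] J(2)[OF that(2)] .
      then show ?thesis using P.hom_add[OF J(1)[OF that(1)] J(1)[OF that(2)]] by simp
    qed
    show "\<exists>x\<in>cocycles ?D ?e n. ?P (?J x) = h" if h: "h \<in> carrier (tensor S L H)" for h
    proof -
      have "h \<in> ?P ` carrier (tensor S L ?Zm)"
        unfolding tensor_map_surj[OF tZ tH \<pi> \<pi>_surj] by (rule h)
      then obtain t where t: "t \<in> carrier (tensor S L ?Zm)" "?P t = h" by blast
      have "?I t \<in> cocycles ?D ?e n" unfolding cocycle_iff using t(1) by (rule imageI)
      moreover have "?P (?J (?I t)) = h" unfolding JI[OF t(1)] by (rule t(2))
      ultimately show ?thesis by blast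
    qed
    show "?P (?J x) = \<zero>\<^bsub>tensor S L H\<^esub> \<longleftrightarrow> x \<in> coboundaries ?D ?e n" if "x \<in> cocycles ?D ?e n" for x
      using kernel[OF J(1)[OF that]] unfolding J(2)[OF that] .
  qed
qed

text \<open>The associativity isomorphisms commute with the differentials, since they send \<open>t \<otimes> b\<close> to the
  image of \<open>t\<close> under \<open>id \<otimes> (\<lambda>m. m \<otimes> b)\<close>; they reduce the claim to the cohomology of the complex \<open>L \<otimes> (M \<otimes> V)\<close>.\<close>

lemma rel_Tor_tensor_flat:
  fixes M :: "('s, 'r, 'm) bimodule" and V :: "('r, 'u, 'n \<Rightarrow> 'u) aug_complex"
  assumes V: "right_res R \<C> N V" and flat: "flat_right S L" and M: "bimodule S R M"
  shows "add_monoid (rel_Tor R (tensor_right S L M) V n) \<cong> add_monoid (tensor S L (rel_Tor_mod R M V n))"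
proof -
  interpret V: right_res R \<C> N V by fact
  have L: "right_module S L" using flat by (simp add: flat_right_def)
  let ?LM = "tensor_right S L M" and ?C = "\<lambda>i. tensor_left R M (obj V i)"
    and ?d = "\<lambda>i. tensor_map R (flip M) (obj V (Suc i)) (\<lambda>x. x) (diff V i)"
  let ?A = "\<lambda>i. tensor R ?LM (obj V i)" and ?\<delta> = "\<lambda>i. tensor_map R ?LM (obj V (Suc i)) (\<lambda>x. x) (diff V i)"
  let ?D = "\<lambda>i. tensor S L (?C i)" and ?e = "\<lambda>i. tensor_map S L (?C (Suc i)) (\<lambda>x. x) (?d i)"
  have C: "left_module S (?C i)" for i by (rule tensor_left_module[OF M V.obj_module])
  have d: "?d i \<in> lmod_hom S (?C i) (?C (Suc i))" for i
    by (rule tensor_left_map[OF M V.diff_hom V.obj_module V.obj_module])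
  have dd: "?d (Suc i) (?d i x) = \<zero>\<^bsub>?C (Suc (Suc i))\<^esub>" if "x \<in> carrier (?C i)" for i x
    using V.tensor_complex(2)[OF bimodule_right[OF M], of x i] that by (simp add: tensor_left_simps)
  have LMm: "right_module R ?LM" by (rule tensor_right_module[OF L M])
  have tA: "tensor_factors R ?LM (obj V i)" for i using LMm V.obj_module by (simp add: tensor_factors_def)
  have tM: "tensor_factors R (flip M) (obj V i)" for i by (rule tensor_factors_left[OF M V.obj_module])
  have tD: "tensor_factors S L (?C i)" for i using L C by (simp add: tensor_factors_def)
  have tLM: "tensor_factors S L M" by (rule tensor_factors_right[OF L M])
  define assoc where "assoc i \<alpha> \<alpha>' \<longleftrightarrow>
      abelian_group_hom (?A i) (?D i) \<alpha> \<and> abelian_group_hom (?D i) (?A i) \<alpha>' \<and>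
      (\<forall>x\<in>carrier (?A i). \<alpha>' (\<alpha> x) = x) \<and> (\<forall>y\<in>carrier (?D i). \<alpha> (\<alpha>' y) = y) \<and>
      (\<forall>t\<in>carrier ?LM. \<forall>b\<in>carrier (obj V i). \<alpha> (pure_tensor R ?LM (obj V i) t b)
        = tensor_map S L (?C i) (\<lambda>x. x) (\<lambda>m. pure_tensor R (flip M) (obj V i) m b) t)" for i \<alpha> \<alpha>'
  have "\<exists>\<alpha> \<alpha>'. assoc i \<alpha> \<alpha>'" for i
  proof (rule tensor_assoc[OF L M V.obj_module[of i]])
    fix \<alpha> \<alpha>'
    assume "abelian_group_hom (?A i) (?D i) \<alpha>" "abelian_group_hom (?D i) (?A i) \<alpha>'"
      "\<And>x. x \<in> carrier (?A i) \<Longrightarrow> \<alpha>' (\<alpha> x) = x" "\<And>y. y \<in> carrier (?D i) \<Longrightarrow> \<alpha> (\<alpha>' y) = y"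
      "\<And>t b. \<lbrakk>t \<in> carrier ?LM; b \<in> carrier (obj V i)\<rbrakk> \<Longrightarrow> \<alpha> (pure_tensor R ?LM (obj V i) t b)
        = tensor_map S L (?C i) (\<lambda>x. x) (\<lambda>m. pure_tensor R (flip M) (obj V i) m b) t"
    then have "assoc i \<alpha> \<alpha>'" unfolding assoc_def by (intro conjI ballI)
    then show "\<exists>\<alpha> \<alpha>'. assoc i \<alpha> \<alpha>'" by (intro exI)
  qed
  then have "\<forall>i. \<exists>\<alpha> \<alpha>'. assoc i \<alpha> \<alpha>'" by (rule allI)
  from choice[OF this] obtain \<alpha> where "\<forall>i. \<exists>\<alpha>'. assoc i (\<alpha> i) \<alpha>'" ..
  from choice[OF this] obtain \<alpha>' where "\<forall>i. assoc i (\<alpha> i) (\<alpha>' i)" ..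
  then have assoc: "assoc i (\<alpha> i) (\<alpha>' i)" for i by (rule spec)
  note assoc = assoc[unfolded assoc_def]
  have \<alpha>: "abelian_group_hom (?A i) (?D i) (\<alpha> i)" for i using assoc[of i] by (elim conjE)
  have \<alpha>': "abelian_group_hom (?D i) (?A i) (\<alpha>' i)" for i using assoc[of i] by (elim conjE)
  have \<alpha>'\<alpha>: "\<alpha>' i (\<alpha> i x) = x" if "x \<in> carrier (?A i)" for i x
    using assoc[of i] that by (elim conjE) (rule bspec)
  have \<alpha>\<alpha>': "\<alpha> i (\<alpha>' i y) = y" if "y \<in> carrier (?D i)" for i y
    using assoc[of i] that by (elim conjE) (rule bspec)
  have \<alpha>_pure: "\<alpha> i (pure_tensor R ?LM (obj V i) t b)
      = tensor_map S L (?C i) (\<lambda>x. x) (\<lambda>m. pure_tensor R (flip M) (obj V i) m b) t"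
    if "t \<in> carrier ?LM" "b \<in> carrier (obj V i)" for i t b
  proof -
    have "\<forall>t\<in>carrier ?LM. \<forall>b\<in>carrier (obj V i). \<alpha> i (pure_tensor R ?LM (obj V i) t b)
        = tensor_map S L (?C i) (\<lambda>x. x) (\<lambda>m. pure_tensor R (flip M) (obj V i) m b) t"
      using assoc[of i] by (elim conjE)
    from bspec[OF bspec[OF this that(1)] that(2)] show ?thesis .
  qed
  have mb: "(\<lambda>m. pure_tensor R (flip M) (obj V i) m b) \<in> lmod_hom S M (?C i)" if b: "b \<in> carrier (obj V i)" for i b
  proof -
    interpret tM: tensor_factors R "flip M" "obj V i" by (rule tM)
    show ?thesis
      by (rule lmod_homI)
         (use b tM.pure_add_left tM.pure_closed tensor_left_smult_pure[OF M V.obj_module] in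
           \<open>simp_all add: tensor_left_simps(1-3)\<close>)
  qed
  have natural: "\<alpha> (Suc i) (?\<delta> i x) = ?e i (\<alpha> i x)" if x: "x \<in> carrier (?A i)" for i x
  proof -
    interpret tA: tensor_factors R ?LM "obj V i" by (rule tA)
    interpret tA': tensor_factors R ?LM "obj V (Suc i)" by (rule tA)
    have \<delta>: "abelian_group_hom (?A i) (?A (Suc i)) (?\<delta> i)" by (rule V.tensor_complex[OF LMm])
    have e: "abelian_group_hom (?D i) (?D (Suc i)) (?e i)" by (rule tensor_map_hom[OF tD lmod_hom_id d tD])
    show ?thesis
    proof (rule tA.tensor_hom_eqI[OF abelian_group_hom_compose[OF \<delta> \<alpha>] abelian_group_hom_compose[OF \<alpha> e] _ x])
      fix t b assume t: "t \<in> carrier ?LM" and b: "b \<in> carrier (obj V i)"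
      note db = lmod_hom_closed[OF V.diff_hom b]
      have t': "t \<in> carrier (tensor S L M)" using t by (simp add: tensor_right_simps)
      have "\<alpha> (Suc i) (?\<delta> i (pure_tensor R ?LM (obj V i) t b))
          = tensor_map S L (?C (Suc i)) (\<lambda>x. x) (\<lambda>m. pure_tensor R (flip M) (obj V (Suc i)) m (diff V i b)) t"
        unfolding tensor_map_pure[OF tA lmod_hom_id V.diff_hom tA t b] by (rule \<alpha>_pure[OF t db])
      also have "\<dots> = tensor_map S L (?C (Suc i)) (\<lambda>x. x) (\<lambda>m. ?d i (pure_tensor R (flip M) (obj V i) m b)) t"
        by (rule tensor_map_cong[OF tLM tD lmod_hom_id mb[OF db] lmod_hom_comp[OF mb[OF b] d] _ t'])
           (simp add: tensor_map_pure[OF tM lmod_hom_id V.diff_hom tM _ b])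
      also have "\<dots> = ?e i (tensor_map S L (?C i) (\<lambda>x. x) (\<lambda>m. pure_tensor R (flip M) (obj V i) m b) t)"
        by (rule tensor_map_comp[OF tLM tD tD lmod_hom_id mb[OF b] lmod_hom_id d t', symmetric])
      also have "\<dots> = ?e i (\<alpha> i (pure_tensor R ?LM (obj V i) t b))" by (simp only: \<alpha>_pure[OF t b])
      finally show "\<alpha> (Suc i) (?\<delta> i (pure_tensor R ?LM (obj V i) t b)) = ?e i (\<alpha> i (pure_tensor R ?LM (obj V i) t b))" .
    qed
  qed
  note \<delta> = V.tensor_complex[OF LMm]
  have e: "abelian_group_hom (?D i) (?D (Suc i)) (?e i)" for i by (rule tensor_map_hom[OF tD lmod_hom_id d tD])
  have ee: "?e (Suc i) (?e i t) = \<zero>\<^bsub>?D (Suc (Suc i))\<^esub>" if t: "t \<in> carrier (?D i)" for i t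
    by (subst tensor_map_comp[OF tD tD tD lmod_hom_id d lmod_hom_id d t],
        rule tensor_map_zero[OF tD tD lmod_hom_comp[OF d d] dd t])
  note \<alpha>_closed = abelian_group_hom.hom_closed[OF \<alpha>] and \<alpha>_zero = abelian_group_hom.hom_zero[OF \<alpha>]
  note \<alpha>'_closed = abelian_group_hom.hom_closed[OF \<alpha>'] and \<alpha>'_zero = abelian_group_hom.hom_zero[OF \<alpha>']
  have natural': "?\<delta> i (\<alpha>' i y) = \<alpha>' (Suc i) (?e i y)" if y: "y \<in> carrier (?D i)" for i y
    using natural[OF \<alpha>'_closed[OF y]] \<alpha>\<alpha>'[OF y]
      \<alpha>'\<alpha>[OF abelian_group_hom.hom_closed[OF \<delta>(1) \<alpha>'_closed[OF y]]] by metis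
  have "add_monoid (cohomology ?A ?\<delta> n) \<cong> add_monoid (cohomology ?D ?e n)"
    unfolding cohomology_def
  proof (rule subquot_iso_mutual[OF _ _ _ _ _ _ \<alpha> \<alpha>'])
    show "abelian_subgroup (coboundaries ?A ?\<delta> n) (?A n)" "abelian_subgroup (cocycles ?A ?\<delta> n) (?A n)"
        "coboundaries ?A ?\<delta> n \<subseteq> cocycles ?A ?\<delta> n"
      by (rule cochain_complex_subgroups[where C = ?A and d = ?\<delta>, OF \<delta>] | assumption)+
    show sub: "abelian_subgroup (coboundaries ?D ?e n) (?D n)" "abelian_subgroup (cocycles ?D ?e n) (?D n)"
        "coboundaries ?D ?e n \<subseteq> cocycles ?D ?e n"
      by (rule cochain_complex_subgroups[where C = ?D and d = ?e, OF e ee] | assumption)+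
    show "\<alpha> n ` cocycles ?A ?\<delta> n \<subseteq> cocycles ?D ?e n"
      using \<alpha>_closed \<alpha>_zero by (auto simp: cocycles_eq natural[symmetric])
    show "\<alpha>' n ` cocycles ?D ?e n \<subseteq> cocycles ?A ?\<delta> n"
      using \<alpha>'_closed \<alpha>'_zero by (auto simp: cocycles_eq natural')
    show "\<alpha> n ` coboundaries ?A ?\<delta> n \<subseteq> coboundaries ?D ?e n"
      using \<alpha>_closed \<alpha>_zero by (cases n) (auto simp: coboundaries_def natural)
    show "\<alpha>' n ` coboundaries ?D ?e n \<subseteq> coboundaries ?A ?\<delta> n"
      using \<alpha>'_closed \<alpha>'_zero by (cases n) (auto simp: coboundaries_def natural'[symmetric])
    show "x \<ominus>\<^bsub>?A n\<^esub> \<alpha>' n (\<alpha> n x) \<in> coboundaries ?A ?\<delta> n" if "x \<in> cocycles ?A ?\<delta> n" for x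
    proof -
      have x: "x \<in> carrier (?A n)" using that by (simp add: cocycles_eq)
      have G: "abelian_group (?A n)" using \<alpha> by (simp add: abelian_group_hom_def)
      have "abelian_subgroup (coboundaries ?A ?\<delta> n) (?A n)"
        by (rule cochain_complex_subgroups[where C = ?A and d = ?\<delta>, OF \<delta>] | assumption)+
      from additive_subgroup.zero_closed[OF abelian_subgroup.axioms(1)[OF this]]
      show ?thesis using abelian_group_minus_eq_zero_iff[OF G x x] \<alpha>'\<alpha>[OF x] by simp
    qed
    show "y \<ominus>\<^bsub>?D n\<^esub> \<alpha> n (\<alpha>' n y) \<in> coboundaries ?D ?e n" if "y \<in> cocycles ?D ?e n" for y
    proof -
      have y: "y \<in> carrier (?D n)" using that by (simp add: cocycles_eq)
      have G: "abelian_group (?D n)" using \<alpha>' by (simp add: abelian_group_hom_def)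
      from additive_subgroup.zero_closed[OF abelian_subgroup.axioms(1)[OF sub(1)]]
      show ?thesis using abelian_group_minus_eq_zero_iff[OF G y y] \<alpha>\<alpha>'[OF y] by simp
    qed
  qed
  also have "add_monoid (cohomology ?D ?e n) \<cong> add_monoid (tensor S L (cohomology_mod ?C ?d n))"
    by (rule flat_cohomology[where C = ?C and d = ?d, OF flat C d dd])
  finally show ?thesis by (simp add: rel_Tor_def rel_Tor_mod_def)
qed

section \<open>The three isomorphisms\<close>

theorem proposition2p8:
  fixes R :: "'r ring" and S :: "'s ring"
  assumes "ring R" and "ring S"
  shows
    "(\<forall>(L :: ('r, 's, 'l) bimodule) (M :: ('s, 'm) module) (N :: ('r, 'n) module)
        (W :: ('r, 'u, 'u \<Rightarrow> 'n) aug_complex) (W' :: ('r, 'u, 'u \<Rightarrow> 'n) aug_complex) n.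
        bimodule R S L \<and> projective S M \<and> left_module R N \<and>
        left_resolution R (WI R) N W \<and> left_resolution R (WI R) N W' \<longrightarrow>
        add_monoid (rel_Ext R (tensor_left S L M) W n) \<cong>
        add_monoid (hom_group S M (rel_Ext_mod R L W' n))) \<and>
     (\<forall>(L :: ('s, 'r, 'l) bimodule) (M :: ('s, 'm) module) (N :: ('r, 'n) module)
        (W :: ('r, 'u, 'u \<Rightarrow> 'n) aug_complex) (W' :: ('r, 'u, 'u \<Rightarrow> 'n) aug_complex) n.
        bimodule S R L \<and> projective (opp S) M \<and> right_module R N \<and>
        left_resolution (opp R) (WF R) N W \<and> left_resolution (opp R) (WF R) N W' \<longrightarrow>
        add_monoid (rel_Ext (opp R) (tensor_right S M L) W n) \<cong>
        add_monoid (hom_group (opp S) M (rel_Ext_mod (opp R) (flip L) W' n))) \<and>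
     (\<forall>(L :: ('s, 'l) module) (M :: ('s, 'r, 'm) bimodule) (N :: ('r, 'n) module)
        (V :: ('r, 'u, 'n \<Rightarrow> 'u) aug_complex) (V' :: ('r, 'u, 'n \<Rightarrow> 'u) aug_complex) n.
        flat_right S L \<and> bimodule S R M \<and> left_module R N \<and>
        right_resolution R (WI R) N V \<and> right_resolution R (WI R) N V' \<longrightarrow>
        add_monoid (rel_Tor R (tensor_right S L M) V n) \<cong>
        add_monoid (tensor S L (rel_Tor_mod R M V' n)))"
proof (intro conjI allI impI; elim conjE)
  fix L :: "('r, 's, 'l) bimodule" and M :: "('s, 'm) module" and N :: "('r, 'n) module"
    and W W' :: "('r, 'u, 'u \<Rightarrow> 'n) aug_complex" and n
  assume L: "bimodule R S L" and M: "projective S M" and N: "left_module R N"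
    and res: "left_resolution R (WI R) N W" "left_resolution R (WI R) N W'"
  have W: "left_res R (WI R) N W" "left_res R (WI R) N W'"
    using N res by (auto simp: left_res_def WI_def weak_injective_def)
  have Mm: "left_module S M" using M by (simp add: projective_def)
  have "add_monoid (rel_Ext R (tensor_left S L M) W n) \<cong> add_monoid (rel_Ext R (tensor_left S L M) W' n)"
    by (rule rel_Ext_resolution_independent[OF W tensor_left_module[OF L Mm]])
  also have "\<dots> \<cong> add_monoid (hom_group S M (rel_Ext_mod R L W' n))"
    by (rule rel_Ext_hom_tensor[OF W(2) M hom_tensor_left[OF L Mm left_res.obj_module[OF W(2)]]])
  finally show "add_monoid (rel_Ext R (tensor_left S L M) W n) \<cong>
      add_monoid (hom_group S M (rel_Ext_mod R L W' n))" .
next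
  fix L :: "('s, 'r, 'l) bimodule" and M :: "('s, 'm) module" and N :: "('r, 'n) module"
    and W W' :: "('r, 'u, 'u \<Rightarrow> 'n) aug_complex" and n
  assume L: "bimodule S R L" and M: "projective (opp S) M" and N: "right_module R N"
    and res: "left_resolution (opp R) (WF R) N W" "left_resolution (opp R) (WF R) N W'"
  have W: "left_res (opp R) (WF R) N W" "left_res (opp R) (WF R) N W'"
    using N res by (auto simp: left_res_def WF_def weak_flat_def)
  have Mm: "right_module S M" using M by (simp add: projective_def)
  have "add_monoid (rel_Ext (opp R) (tensor_right S M L) W n) \<cong>
      add_monoid (rel_Ext (opp R) (tensor_right S M L) W' n)"
    by (rule rel_Ext_resolution_independent[OF W tensor_right_module[OF Mm L]])
  also have "\<dots> \<cong> add_monoid (hom_group (opp S) M (rel_Ext_mod (opp R) (flip L) W' n))"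
    by (rule rel_Ext_hom_tensor[OF W(2) M hom_tensor_right[OF L Mm left_res.obj_module[OF W(2)]]])
  finally show "add_monoid (rel_Ext (opp R) (tensor_right S M L) W n) \<cong>
      add_monoid (hom_group (opp S) M (rel_Ext_mod (opp R) (flip L) W' n))" .
next
  fix L :: "('s, 'l) module" and M :: "('s, 'r, 'm) bimodule" and N :: "('r, 'n) module"
    and V V' :: "('r, 'u, 'n \<Rightarrow> 'u) aug_complex" and n
  assume L: "flat_right S L" and M: "bimodule S R M" and N: "left_module R N"
    and res: "right_resolution R (WI R) N V" "right_resolution R (WI R) N V'"
  have V: "right_res R (WI R) N V" "right_res R (WI R) N V'"
    using N res by (auto simp: right_res_def WI_def weak_injective_def)
  have Lm: "right_module S L" using L by (simp add: flat_right_def)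
  have "add_monoid (rel_Tor R (tensor_right S L M) V n) \<cong> add_monoid (rel_Tor R (tensor_right S L M) V' n)"
    by (rule rel_Tor_resolution_independent[OF V tensor_right_module[OF Lm M]])
  also have "\<dots> \<cong> add_monoid (tensor S L (rel_Tor_mod R M V' n))"
    by (rule rel_Tor_tensor_flat[OF V(2) L M])
  finally show "add_monoid (rel_Tor R (tensor_right S L M) V n) \<cong>
      add_monoid (tensor S L (rel_Tor_mod R M V' n))" .
qed

end
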